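(* Assume the standing setting with $I=[0,\infty)$, that $X$ a.s. has no negative jumps, and that $0$ is absorbing for $X$. Suppose there exist $Q\in(0,\infty)$, $z_0\in[0,\infty)$ and a $C^1$ map $g:[z_0,\infty)\to[0,\infty)$ with $g(z_0)=0$, $g>0$ on $(z_0,\infty)$ and $\int_z^\infty\frac{dw}{g(w)}<\infty$ for every $z\in(z_0,\infty)$, such that $$\mathbb{P}_x[e^{-qT_\ell^-};T_\ell^-<\zeta]=\frac{\int_{z_0}^\infty\frac{1}{g(z)}\exp\big(-xz-\int_z^\infty\frac{q}{g}\big)dz}{\int_{z_0}^\infty\frac{1}{g(z)}\exp\big(-\ell z-\int_z^\infty\frac{q}{g}\big)dz}\quad\text{for all }0\le\ell\le x\text{ and all }q\in(Q,\infty).$$ Then there exist a Laplace exponent $\psi$ of a spectrally positive Lévy process and $p\in[0,\infty)$, with $\int^\infty_{\psi^{-1}(0)+1}\frac{dz}{\psi(z)}<\infty$, such that $X$ under $(\mathbb{P}_x)_{x\in[0,\infty)}$ has the law of a continuous-state branching process with branching mechanism $\psi-p$ (state space $[0,\infty)$, cemetery $\infty$); necessarily $z_0=\psi^{-1}(p)$ and $g=(\psi-p)|_{[\psi^{-1}(p),\infty)}$. In particular the laws of $X$ are uniquely determined by $z_0$ and $g$.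
   Context: Standing setting: $I\subset\mathbb{R}$ is an interval unbounded above. $X=(X_t)_{t\in[0,\zeta)}$ is a process under complete probability measures $(\mathbb{P}_x)_{x\in I}$ (whose domains all contain $\mathcal{F}_\infty$), adapted to a filtration $\mathcal{F}=(\mathcal{F}_t)_{t\ge0}$ that is complete in the sense that each $\mathcal{F}_t$ contains every set differing from an event of $\mathcal{F}_t$ by a set that is $\mathbb{P}_x$-null for all $x\in I$. The lifetime $\zeta$ is an $\mathcal{F}$-stopping time with $\zeta>0$ a.s., and $X_t:=\infty$ (cemetery) for $t\ge\zeta$. "a.s." means $\mathbb{P}_x$-a.s. for every $x\in I$, and "negligible" means $\mathbb{P}_x$-null for every $x$. Assumptions: paths of $X$ are càdlàg in $I$ on $[0,\zeta)$; on $\{0<\zeta<\infty\}$ the limit $X_{\zeta-}$ exists in $I\cup\{\infty\}$ a.s. (set $X_{\zeta-}:=\infty$ when it does not exist); $x\mapsto\mathbb{P}_x(t<\zeta,X_t\in A)$ is universally measurable for Borel $A\subset I$; normality: $X_0=x$ $\mathbb{P}_x$-a.s.; strong Markov: for every $\mathcal{F}$-stopping time $S$ and measurable $H\ge0$, $\mathbb{P}_x[H(X_{S+\cdot})\mid\mathcal{F}_S]=\mathbb{P}_{X_S}[H(X)]$ $\mathbb{P}_x$-a.s. on $\{S<\zeta\}$; quasi left-continuity: if $\mathcal{F}$-stopping times $T_n$ increase a.s. to $T$ then $X_{T_n}\to X_T$ a.s. on $\{T<\zeta\}$; non-announceability: for every a.s. nondecreasing sequence $(T_n)$ of $\mathcal{F}$-stopping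 times, the event $\{T_n<\zeta\ \forall n\}\cap\{\lim_n T_n=\zeta\}\cap\{\zeta<\infty,X_{\zeta-}<\infty\}$ is negligible. Notation: $\mathbb{P}_x[Y;A]:=\mathbb{E}_x[Y\mathbf{1}_A]$; for $\ell\in I$, $T_\ell^-:=\inf\{t\in[0,\zeta):X_t\le\ell\}$ ($\inf\emptyset=\infty$). "$0$ is absorbing" means $X_t=0$ for all $t\ge T_0^-$ a.s. on $\{T_0^-<\zeta\}$ (and then $\zeta=\infty$ there). A spectrally positive Lévy process is a Lévy process with no negative jumps that is not a subordinator; its Laplace exponent is $\psi(z)=\log\mathbb{E}_0[e^{-z\xi_1}]=-\gamma z+\frac{\sigma^2}{2}z^2+\int_{(0,\infty)}(e^{-zh}+zh\mathbf{1}_{(0,1]}(h)-1)\,\mathsf{m}(dh)$, $z\ge0$, so $\psi(0)=0$; $\psi^{-1}$ is its right-continuous inverse. A continuous-state branching process with branching mechanism $\psi-p$ ($p\ge0$) is a Markov process with values in $[0,\infty]$ (with $0$ and $\infty$ absorbing, $\infty$ the cemetery) such that $\mathbb{E}_x[e^{-\lambda X_t}]=e^{-xu_t(\lambda)}$ for $x,\lambda,t\ge0$ (with $e^{-\lambda\infty}:=0$), where $u_t(\lambda)$ solves $\partial_tu_t(\lambda)+\psi(u_t(\lambda))-p=0$, $u_0(\lambda)=\lambda$. *)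

theory Defs
  imports "HOL-Probability.Probability"
begin

text \<open>State space I = [0,\<infinity>) together with the cemetery \<infinity> is modelled by the type ennreal.
  Times t are nonnegative reals; random times (lifetime, stopping times) take values in ennreal
  (value \<infinity> allowed). The sample space is Omega, P x is the probability measure started at x
  (x \<ge> 0), F t is the sigma-algebra at time t \<ge> 0, X t \<omega> the state, zeta the lifetime.\<close>

definition Xat :: "(real \<Rightarrow> 'a \<Rightarrow> ennreal) \<Rightarrow> ('a \<Rightarrow> ennreal) \<Rightarrow> 'a \<Rightarrow> ennreal" where
  "Xat X T \<omega> = (if T \<omega> = \<infinity> then \<infinity> else X (enn2real (T \<omega>)) \<omega>)"

definition path :: "(real \<Rightarrow> 'a \<Rightarrow> ennreal) \<Rightarrow> 'a \<Rightarrow> (real \<Rightarrow> ennreal)" where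
  "path X \<omega> = (\<lambda>s\<in>{0..}. X s \<omega>)"

definition shifted_path :: "(real \<Rightarrow> 'a \<Rightarrow> ennreal) \<Rightarrow> ('a \<Rightarrow> ennreal) \<Rightarrow> 'a \<Rightarrow> (real \<Rightarrow> ennreal)" where
  "shifted_path X S \<omega> = (\<lambda>s\<in>{0..}. Xat X (\<lambda>\<omega>'. S \<omega>' + ennreal s) \<omega>)"

definition path_space :: "(real \<Rightarrow> ennreal) measure" where
  "path_space = Pi\<^sub>M {0..} (\<lambda>_. borel)"

definition F_infty :: "'a set \<Rightarrow> (real \<Rightarrow> 'a set set) \<Rightarrow> 'a set set" where
  "F_infty \<Omega> F = sigma_sets \<Omega> (\<Union>t\<in>{0..}. F t)"

definition is_stopping_time :: "'a set \<Rightarrow> (real \<Rightarrow> 'a set set) \<Rightarrow> ('a \<Rightarrow> ennreal) \<Rightarrow> bool" where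
  "is_stopping_time \<Omega> F T \<longleftrightarrow> (\<forall>t\<ge>0. {\<omega>\<in>\<Omega>. T \<omega> \<le> ennreal t} \<in> F t)"

definition F_at :: "'a set \<Rightarrow> (real \<Rightarrow> 'a set set) \<Rightarrow> ('a \<Rightarrow> ennreal) \<Rightarrow> 'a set set" where
  "F_at \<Omega> F T = {A. A \<in> F_infty \<Omega> F \<and> (\<forall>t\<ge>0. A \<inter> {\<omega>\<in>\<Omega>. T \<omega> \<le> ennreal t} \<in> F t)}"

definition univ_measurable_on_I :: "(real \<Rightarrow> real) \<Rightarrow> bool" where
  "univ_measurable_on_I f \<longleftrightarrow>
     (\<forall>\<mu>. finite_measure \<mu> \<and> sets \<mu> = sets (restrict_space borel {0::real..}) \<longrightarrow>
          f \<in> borel_measurable (completion \<mu>))"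

definition X_zeta_minus :: "(real \<Rightarrow> 'a \<Rightarrow> ennreal) \<Rightarrow> ('a \<Rightarrow> ennreal) \<Rightarrow> 'a \<Rightarrow> ennreal" where
  "X_zeta_minus X \<zeta> \<omega> =
     (if \<exists>l. ((\<lambda>s. X s \<omega>) \<longlongrightarrow> l) (at_left (enn2real (\<zeta> \<omega>)))
      then Lim (at_left (enn2real (\<zeta> \<omega>))) (\<lambda>s. X s \<omega>) else \<infinity>)"

definition T_minus :: "(real \<Rightarrow> 'a \<Rightarrow> ennreal) \<Rightarrow> ('a \<Rightarrow> ennreal) \<Rightarrow> real \<Rightarrow> 'a \<Rightarrow> ennreal" where
  "T_minus X \<zeta> l \<omega> = Inf {ennreal t |t. 0 \<le> t \<and> ennreal t < \<zeta> \<omega> \<and> X t \<omega> \<le> ennreal l}"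

definition standing_setting ::
  "'a set \<Rightarrow> (real \<Rightarrow> 'a measure) \<Rightarrow> (real \<Rightarrow> 'a set set) \<Rightarrow> (real \<Rightarrow> 'a \<Rightarrow> ennreal) \<Rightarrow> ('a \<Rightarrow> ennreal) \<Rightarrow> bool"
where
  "standing_setting \<Omega> P F X \<zeta> \<longleftrightarrow>
    \<comment> \<open>complete probability measures on a common sample space, domains containing F_\<infinity>\<close>
    (\<forall>x\<ge>0. prob_space (P x) \<and> complete_measure (P x) \<and> space (P x) = \<Omega>
             \<and> F_infty \<Omega> F \<subseteq> sets (P x)) \<and>
    \<comment> \<open>filtration\<close>
    (\<forall>t\<ge>0. sigma_algebra \<Omega> (F t)) \<and>
    (\<forall>s t. 0 \<le> s \<and> s \<le> t \<longrightarrow> F s \<subseteq> F t) \<and>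
    \<comment> \<open>completeness of the filtration\<close>
    (\<forall>t\<ge>0. \<forall>A\<in>F t. \<forall>B. B \<subseteq> \<Omega> \<and> (\<forall>x\<ge>0. (A - B) \<union> (B - A) \<in> null_sets (P x)) \<longrightarrow> B \<in> F t) \<and>
    \<comment> \<open>adaptedness\<close>
    (\<forall>t\<ge>0. \<forall>B\<in>sets (borel :: ennreal measure). {\<omega>\<in>\<Omega>. X t \<omega> \<in> B} \<in> F t) \<and>
    \<comment> \<open>lifetime: stopping time, positive a.s., cemetery after the lifetime\<close>
    is_stopping_time \<Omega> F \<zeta> \<and>
    (\<forall>x\<ge>0. AE \<omega> in P x. 0 < \<zeta> \<omega>) \<and>
    (\<forall>\<omega>\<in>\<Omega>. \<forall>t\<ge>0. X t \<omega> = \<infinity> \<longleftrightarrow> \<zeta> \<omega> \<le> ennreal t) \<and>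
    \<comment> \<open>cadlag paths in I on [0,\<zeta>)\<close>
    (\<forall>\<omega>\<in>\<Omega>. \<forall>t\<ge>0. ennreal t < \<zeta> \<omega> \<longrightarrow>
        ((\<lambda>s. X s \<omega>) \<longlongrightarrow> X t \<omega>) (at_right t) \<and>
        (0 < t \<longrightarrow> (\<exists>l. l \<noteq> \<infinity> \<and> ((\<lambda>s. X s \<omega>) \<longlongrightarrow> l) (at_left t)))) \<and>
    \<comment> \<open>existence of X_{\<zeta>-} in I \<union> {\<infinity>} a.s. on {0 < \<zeta> < \<infinity>}\<close>
    (\<forall>x\<ge>0. AE \<omega> in P x. 0 < \<zeta> \<omega> \<and> \<zeta> \<omega> < \<infinity> \<longrightarrow>
        (\<exists>l. ((\<lambda>s. X s \<omega>) \<longlongrightarrow> l) (at_left (enn2real (\<zeta> \<omega>))))) \<and>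
    \<comment> \<open>universal measurability of the transition function\<close>
    (\<forall>t\<ge>0. \<forall>A\<in>sets (borel :: real measure). A \<subseteq> {0..} \<longrightarrow>
        univ_measurable_on_I (\<lambda>x. measure (P x) {\<omega>\<in>\<Omega>. ennreal t < \<zeta> \<omega> \<and> X t \<omega> \<in> ennreal ` A})) \<and>
    \<comment> \<open>normality\<close>
    (\<forall>x\<ge>0. AE \<omega> in P x. X 0 \<omega> = ennreal x) \<and>
    \<comment> \<open>strong Markov property (defining identity of the conditional expectation given F_S,
        on the event {S < \<zeta>})\<close>
    (\<forall>S H. is_stopping_time \<Omega> F S \<and> H \<in> borel_measurable path_space \<longrightarrow>
       (\<forall>x\<ge>0. \<forall>A\<in>F_at \<Omega> F S.
          (\<integral>\<^sup>+ \<omega>. H (shifted_path X S \<omega>) * indicator (A \<inter> {\<omega>. S \<omega> < \<zeta> \<omega>}) \<omega> \<partial>P x) =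
          (\<integral>\<^sup>+ \<omega>. (\<integral>\<^sup>+ \<omega>'. H (path X \<omega>') \<partial>P (enn2real (Xat X S \<omega>)))
                     * indicator (A \<inter> {\<omega>. S \<omega> < \<zeta> \<omega>}) \<omega> \<partial>P x))) \<and>
    \<comment> \<open>quasi left-continuity\<close>
    (\<forall>T Tn. is_stopping_time \<Omega> F T \<and> (\<forall>n. is_stopping_time \<Omega> F (Tn n)) \<longrightarrow>
       (\<forall>x\<ge>0. (AE \<omega> in P x. incseq (\<lambda>n. Tn n \<omega>) \<and> (\<lambda>n. Tn n \<omega>) \<longlonglongrightarrow> T \<omega>) \<longrightarrow>
          (AE \<omega> in P x. T \<omega> < \<zeta> \<omega> \<longrightarrow> (\<lambda>n. Xat X (Tn n) \<omega>) \<longlonglongrightarrow> Xat X T \<omega>))) \<and>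
    \<comment> \<open>non-announceability of the lifetime on {\<zeta> < \<infinity>, X_{\<zeta>-} < \<infinity>}\<close>
    (\<forall>Tn. (\<forall>n. is_stopping_time \<Omega> F (Tn n)) \<and> (\<forall>x\<ge>0. AE \<omega> in P x. incseq (\<lambda>n. Tn n \<omega>)) \<longrightarrow>
       (\<forall>x\<ge>0. AE \<omega> in P x.
          \<not> ((\<forall>n. Tn n \<omega> < \<zeta> \<omega>) \<and> (\<lambda>n. Tn n \<omega>) \<longlonglongrightarrow> \<zeta> \<omega> \<and>
              \<zeta> \<omega> < \<infinity> \<and> X_zeta_minus X \<zeta> \<omega> < \<infinity>)))"

definition no_negative_jumps ::
  "(real \<Rightarrow> 'a measure) \<Rightarrow> (real \<Rightarrow> 'a \<Rightarrow> ennreal) \<Rightarrow> ('a \<Rightarrow> ennreal) \<Rightarrow> bool" where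
  "no_negative_jumps P X \<zeta> \<longleftrightarrow>
     (\<forall>x\<ge>0. AE \<omega> in P x. \<forall>t>0. ennreal t < \<zeta> \<omega> \<longrightarrow>
        (\<forall>l. ((\<lambda>s. X s \<omega>) \<longlongrightarrow> l) (at_left t) \<longrightarrow> l \<le> X t \<omega>))"

definition zero_absorbing ::
  "(real \<Rightarrow> 'a measure) \<Rightarrow> (real \<Rightarrow> 'a \<Rightarrow> ennreal) \<Rightarrow> ('a \<Rightarrow> ennreal) \<Rightarrow> bool" where
  "zero_absorbing P X \<zeta> \<longleftrightarrow>
     (\<forall>x\<ge>0. AE \<omega> in P x. T_minus X \<zeta> 0 \<omega> < \<zeta> \<omega> \<longrightarrow>
        (\<forall>t\<ge>0. T_minus X \<zeta> 0 \<omega> \<le> ennreal t \<longrightarrow> X t \<omega> = 0))"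

text \<open>Laplace exponent of a spectrally positive Levy process, via its Levy-Khintchine triplet
  (\<gamma>, \<sigma>, m): m a Levy measure on (0,\<infinity>), and the process is not a subordinator, i.e. not
  (\<sigma> = 0, \<integral>_(0,1] h m(dh) < \<infinity> and drift \<gamma> - \<integral>_(0,1] h m(dh) \<ge> 0).\<close>
definition spos_levy_exponent :: "(real \<Rightarrow> real) \<Rightarrow> bool" where
  "spos_levy_exponent \<psi> \<longleftrightarrow>
     (\<exists>(\<gamma>::real) (\<sigma>::real) (m::real measure).
        0 \<le> \<sigma> \<and> sets m = sets borel \<and> emeasure m {..0} = 0 \<and>
        (\<integral>\<^sup>+ h. ennreal (min 1 (h\<^sup>2)) \<partial>m) < \<infinity> \<and>
        (\<forall>z\<ge>0. \<psi> z = - \<gamma> * z + \<sigma>\<^sup>2 / 2 * z\<^sup>2 +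
             (\<integral> h. exp (- z * h) + z * h * indicator {0<..1} h - 1 \<partial>m)) \<and>
        \<not> (\<sigma> = 0 \<and> (\<integral>\<^sup>+ h. ennreal h * indicator {0<..1} h \<partial>m) < \<infinity> \<and>
             \<gamma> - (\<integral> h. h * indicator {0<..1} h \<partial>m) \<ge> 0))"

definition psi_inv :: "(real \<Rightarrow> real) \<Rightarrow> real \<Rightarrow> real" where
  "psi_inv \<psi> p = Inf {z. 0 \<le> z \<and> p < \<psi> z}"

definition exp_neg :: "real \<Rightarrow> ennreal \<Rightarrow> real" where
  "exp_neg lam v = (if v = \<infinity> then 0 else exp (- lam * enn2real v))"

text \<open>X under (P x) is a continuous-state branching process with branching mechanism \<psi> - p:
  E_x[e^{-\<lambda> X_t}] = e^{-x u_t(\<lambda>)} where \<partial>_t u_t(\<lambda>) + \<psi>(u_t(\<lambda>)) - p = 0, u_0(\<lambda>) = \<lambda>.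
  (Markov property, absorption in 0 and in the cemetery \<infinity> are part of the standing setting.)\<close>
definition is_CSBP ::
  "(real \<Rightarrow> 'a measure) \<Rightarrow> (real \<Rightarrow> 'a \<Rightarrow> ennreal) \<Rightarrow> (real \<Rightarrow> real) \<Rightarrow> real \<Rightarrow> bool" where
  "is_CSBP P X \<psi> p \<longleftrightarrow>
     (\<exists>u :: real \<Rightarrow> real \<Rightarrow> real.
        (\<forall>lam\<ge>0. u 0 lam = lam \<and>
           (\<forall>t\<ge>0. ((\<lambda>s. u s lam) has_real_derivative (p - \<psi> (u t lam))) (at t within {0..}))) \<and>
        (\<forall>x\<ge>0. \<forall>t\<ge>0. \<forall>lam\<ge>0.
           (\<integral> \<omega>. exp_neg lam (X t \<omega>) \<partial>P x) = exp (- x * u t lam)))"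

end

theory Submission
  imports Defs "HOL-Real_Asymp.Real_Asymp"
begin

text \<open>Write tau z for the integral of 1/g over (z, oo).
  Integrating by parts at level 0, the transform of the extinction time is that of tau evaluated at an exponential variable of
  rate x, so P_x(X_t = 0) = exp(-x l) whenever t = tau l. By the Markov property at fixed times,
  E_x[exp(-l X_t)] = exp(-x u_t(l)) for l > z0, where u_t(l) flows along -g. Since s = exp(-c X_t) lies in the unit
  interval and moments determine measures there, multiplicativity in x extends from l > z0 to all l >= 0, and u_t is
  a semigroup of concave functions. The measures (1-s)^2/t^3 dP_{t^2} have bounded mass and converging moments as
  t tends to 0; a Helly limit yields the Levy-Khintchine form of Psi = lim (l - u_t(l))/t, which agrees with g above z0.
  Concavity makes these difference quotients locally equi-Lipschitz, whence the differential equation below z0.\<close>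

text \<open>The hypothesis gives information for q > Q and, through g, for l > z0, while the
  branching property, the differential equation and the Levy measure concern all l >= 0. Two
  constants bridge the gap. With c = z0 + 1 every level c j, j >= 1, lies above z0, so all moments
  of order j >= 1 of s = exp(-c X_t) are explicit; with q = Q + 1 every j q exceeds Q, so the same
  holds for exp(-q T), T being the extinction time. The moment of order 0 is not among the data:
  mass at s = 0, which encodes X_t = oo or T = oo, is invisible. Hence measures are compared through
  functions vanishing at 0, limits are identified for l > 0 first, and l = 0 is reached by
  continuity. Killing appears as p = -Psi 0, the limit of -Psi at 0, and not as an atom. Below z0
  the flow is not explicit. All control there comes from the concavity of u_t, its fixed point z0
  and its known behaviour at c.\<close>

section \<open>Moment problem on the unit interval\<close>

text \<open>A Weierstrass polynomial within e/2 of \<open>f\<close> has a constant term smaller than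
  e/2 because \<open>f 0 = 0\<close>; dropping it costs another e/2. The remaining monomials are
  those whose integrals are known.\<close>

lemma polynomial_approx_vanishing:
  fixes f :: "real \<Rightarrow> real"
  assumes "continuous_on {0..1} f" "f 0 = 0" "0 < e"
  obtains a :: "nat \<Rightarrow> real" and n where "\<And>s. s \<in> {0..1} \<Longrightarrow> \<bar>f s - (\<Sum>i=1..n. a i * s ^ i)\<bar> < e"
proof -
  obtain g where g: "real_polynomial_function g" "\<And>s. s \<in> {0..1} \<Longrightarrow> \<bar>f s - g s\<bar> < e/2"
    using Stone_Weierstrass_real_polynomial_function[of "{0..1}" f "e/2"] assms by auto
  obtain a n where an: "g = (\<lambda>x. \<Sum>i\<le>n. a i * x^i)"
    using g(1) real_polynomial_function_iff_sum by blast
  have split: "g s = a 0 + (\<Sum>i=1..n. a i * s^i)" for s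
    unfolding an by (simp add: sum.atMost_shift sum.atLeast1_atMost_eq)
  have a0: "\<bar>a 0\<bar> < e/2" using g(2)[of 0] assms(2) split[of 0] by (simp add: power_0_left)
  have "\<bar>f s - (\<Sum>i=1..n. a i * s ^ i)\<bar> < e" if "s \<in> {0..1}" for s
    using g(2)[OF that] a0 unfolding split by linarith
  then show thesis by (rule that)
qed

text \<open>The mass is left free because rescaled measures and their limits occur; the
  sigma-algebra is that of the whole line so that weak convergence on the reals applies.\<close>

definition unit_measure :: "real measure \<Rightarrow> bool" where
  "unit_measure M \<longleftrightarrow> finite_measure M \<and> sets M = sets borel \<and> (AE s in M. s \<in> {0..1})"

lemma unit_measure_integrable:
  assumes M: "unit_measure M" and f: "f \<in> borel_measurable borel" and B: "\<And>s. s \<in> {0..1} \<Longrightarrow> \<bar>f s :: real\<bar> \<le> B"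
  shows "integrable M f" and "\<bar>\<integral>s. f s \<partial>M\<bar> \<le> B * measure M UNIV"
proof -
  interpret finite_measure M using M by (simp add: unit_measure_def)
  have sM: "sets M = sets borel" "space M = UNIV"
    using M sets_eq_imp_space_eq[of M borel] by (auto simp: unit_measure_def)
  have ae: "AE s in M. norm (f s) \<le> B"
    using M unfolding unit_measure_def by (auto elim!: eventually_mono intro!: B simp del: atLeastAtMost_iff)
  have fM: "f \<in> borel_measurable M" using f measurable_cong_sets[OF sM(1) refl] by blast
  show "integrable M f" by (rule integrable_const_bound[OF ae fM])
  have "norm (\<integral>s. f s \<partial>M) \<le> (\<integral>s. norm (f s) \<partial>M)" by (rule integral_norm_bound)
  also have "\<dots> \<le> (\<integral>s. B \<partial>M)"
    using \<open>integrable M f\<close> ae by (intro integral_mono_AE) auto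
  also have "\<dots> = B * measure M UNIV" using sM by simp
  finally show "\<bar>\<integral>s. f s \<partial>M\<bar> \<le> B * measure M UNIV" by simp
qed

lemma continuous_unit_bound:
  fixes f :: "real \<Rightarrow> real"
  assumes "continuous_on {0..1} f"
  obtains B where "0 \<le> B" "\<And>s. s \<in> {0..1} \<Longrightarrow> \<bar>f s\<bar> \<le> B"
proof -
  have "bounded (f ` {0..1})" using assms compact_continuous_image compact_imp_bounded by blast
  then obtain B where "\<forall>y\<in>f ` {0..1}. norm y \<le> B" by (auto simp: bounded_iff)
  then show thesis by (intro that[of "max 0 B"]) (auto simp: le_max_iff_disj)
qed

lemma unit_power_abs_le: "s \<in> {0..1} \<Longrightarrow> \<bar>s ^ j :: real\<bar> \<le> 1"
  by (simp add: power_le_one)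

lemma moment_integrable: "unit_measure M \<Longrightarrow> integrable M (\<lambda>s. s ^ j)"
  by (rule unit_measure_integrable(1)[where B=1]) (auto intro: unit_power_abs_le simp del: atLeastAtMost_iff)

text \<open>Uniform approximation times the common mass bound controls the integrals uniformly in
  \<open>t\<close>. The filter is general: it serves at 0 from the right and, with a constant
  family, for uniqueness.\<close>

lemma moment_convergence:
  fixes f :: "real \<Rightarrow> real" and M :: "'b \<Rightarrow> real measure"
  assumes M: "\<forall>\<^sub>F t in F. unit_measure (M t) \<and> measure (M t) UNIV \<le> C"
    and N: "unit_measure N"
    and mom: "\<And>j. 1 \<le> j \<Longrightarrow> ((\<lambda>t. \<integral>s. s ^ j \<partial>M t) \<longlongrightarrow> (\<integral>s. s ^ j \<partial>N)) F"
    and f: "continuous_on {0..1} f" "f 0 = 0" "f \<in> borel_measurable borel"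
  shows "((\<lambda>t. \<integral>s. f s \<partial>M t) \<longlongrightarrow> (\<integral>s. f s \<partial>N)) F"
proof (rule tendstoI)
  fix e :: real assume e: "0 < e"
  define C1 where "C1 = \<bar>C\<bar> + measure N UNIV + 1"
  have C1: "C1 > 0" "C \<le> C1" "measure N UNIV \<le> C1"
    using measure_nonneg[of N UNIV] unfolding C1_def by linarith+
  \<comment> \<open>Three errors of size e/4 arise: polynomial against \<open>f\<close> under
    \<open>M t\<close>, the same under \<open>N\<close>, and the difference of the polynomial
    integrals.\<close>
  define e' where "e' = e / (4 * C1)"
  have e': "e' > 0" using e C1 by (simp add: e'_def)
  obtain a n where an: "\<And>s. s \<in> {0..1} \<Longrightarrow> \<bar>f s - (\<Sum>i=1..n. a i * s ^ i)\<bar> < e'"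
    using polynomial_approx_vanishing[OF f(1,2) e'] by blast
  define p where "p s = (\<Sum>i=1..n. a i * s ^ i)" for s :: real
  have pm: "p \<in> borel_measurable borel" unfolding p_def by measurable
  obtain B where B: "\<And>s. s \<in> {0..1} \<Longrightarrow> \<bar>f s\<bar> \<le> B" using continuous_unit_bound[OF f(1)] by blast
  have pint: "integrable M p" "(\<integral>s. p s \<partial>M) = (\<Sum>i=1..n. a i * (\<integral>s. s ^ i \<partial>M))" if "unit_measure M" for M
    using moment_integrable[OF that] unfolding p_def by (auto simp: Bochner_Integration.integral_sum)
  have close: "\<bar>(\<integral>s. f s \<partial>M) - (\<integral>s. p s \<partial>M)\<bar> \<le> e / 4" if "unit_measure M" "measure M UNIV \<le> C1" for M
  proof -
    have "\<bar>\<integral>s. f s - p s \<partial>M\<bar> \<le> e' * measure M UNIV"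
      using an pm f(3) by (intro unit_measure_integrable(2)[OF that(1)]) (auto simp: p_def intro: less_imp_le)
    also have "\<dots> \<le> e' * C1" using e' that by (intro mult_left_mono) auto
    also have "\<dots> = e/4" using C1 by (simp add: e'_def)
    finally show ?thesis
      using pint(1)[OF that(1)] unit_measure_integrable(1)[OF that(1) f(3) B] by simp
  qed
  have "((\<lambda>t. \<Sum>i=1..n. a i * (\<integral>s. s ^ i \<partial>M t)) \<longlongrightarrow> (\<Sum>i=1..n. a i * (\<integral>s. s ^ i \<partial>N))) F"
    by (intro tendsto_sum tendsto_mult tendsto_const mom) auto
  then have "\<forall>\<^sub>F t in F. dist (\<Sum>i=1..n. a i * (\<integral>s. s ^ i \<partial>M t)) (\<Sum>i=1..n. a i * (\<integral>s. s ^ i \<partial>N)) < e/4"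
    using e by (intro tendstoD) auto
  with M show "\<forall>\<^sub>F t in F. dist (\<integral>s. f s \<partial>M t) (\<integral>s. f s \<partial>N) < e"
  proof eventually_elim
    case (elim t)
    then have "unit_measure (M t)" "measure (M t) UNIV \<le> C1" using C1(2) by auto
    from close[OF this] close[OF N C1(3)] pint(2)[OF N] pint(2)[OF this(1)] e elim(2)
    show ?case unfolding dist_real_def by linarith
  qed
qed

text \<open>This is convergence of a constant family. The two masses may differ by an atom at
  0.\<close>

lemma moment_unique:
  fixes f :: "real \<Rightarrow> real"
  assumes M: "unit_measure M" and N: "unit_measure N"
    and mom: "\<And>j. 1 \<le> j \<Longrightarrow> (\<integral>s. s ^ j \<partial>M) = (\<integral>s. s ^ j \<partial>N)"
    and f: "continuous_on {0..1} f" "f 0 = 0" "f \<in> borel_measurable borel"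
  shows "(\<integral>s. f s \<partial>M) = (\<integral>s. f s \<partial>N)"
proof -
  have "((\<lambda>_. \<integral>s. f s \<partial>M) \<longlongrightarrow> (\<integral>s. f s \<partial>N)) sequentially"
    by (rule moment_convergence[where C="measure M UNIV"]) (use assms in auto)
  then show ?thesis by (simp add: LIMSEQ_const_iff)
qed

text \<open>Continuous ramps decrease to the indicator of \<open>{a..}\<close>. They vanish at 0 as
  soon as n a >= 1, so \<open>0 < a\<close> keeps the tail away from the point that the moments do
  not see.\<close>

lemma moment_unique_tail:
  assumes M: "unit_measure M" and N: "unit_measure N"
    and mom: "\<And>j. 1 \<le> j \<Longrightarrow> (\<integral>s. s ^ j \<partial>M) = (\<integral>s. s ^ j \<partial>N)"
    and a: "0 < a"
  shows "measure M {a..} = measure N {a..}"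
proof -
  define f where "f n s = max 0 (min 1 (1 + real n * (s - a)))" for n and s :: real
  have tail: "(\<lambda>n. \<integral>s. f n s \<partial>M) \<longlonglongrightarrow> measure M {a..}" if M: "unit_measure M" for M
  proof -
    interpret finite_measure M using M by (simp add: unit_measure_def)
    have sM: "sets M = sets borel" "space M = UNIV"
      using M sets_eq_imp_space_eq[of M borel] by (auto simp: unit_measure_def)
    have "(\<lambda>n. \<integral>s. f n s \<partial>M) \<longlonglongrightarrow> (\<integral>s. indicator {a..} s \<partial>M)"
    proof (rule integral_dominated_convergence[where w="\<lambda>_. 1"])
      show "AE s in M. (\<lambda>n. f n s) \<longlonglongrightarrow> indicator {a..} s"
      proof (rule AE_I2)
        fix s
        show "(\<lambda>n. f n s) \<longlonglongrightarrow> indicator {a..} s"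
        proof (cases "a \<le> s")
          case True then have "f n s = 1" for n by (auto simp: f_def)
          then show ?thesis using True by simp
        next
          case False
          have "filterlim (\<lambda>n. real n * (a - s)) at_top sequentially"
            using False by real_asymp
          then have "\<forall>\<^sub>F n in sequentially. real n * (a - s) \<ge> 1" by (simp add: filterlim_at_top)
          then have "\<forall>\<^sub>F n in sequentially. f n s = 0"
            by eventually_elim (auto simp: f_def algebra_simps)
          then show ?thesis using False by (auto intro: tendsto_eventually)
        qed
      qed
    qed (auto simp: f_def sM measurable_cong_sets[OF sM(1) refl] intro!: borel_measurable_continuous_onI continuous_intros)
    then show ?thesis using sM by simp
  qed
  have "\<forall>\<^sub>F n in sequentially. real n * a \<ge> 1"
  proof -
    have "filterlim (\<lambda>n. real n * a) at_top sequentially" using a by real_asymp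
    then show ?thesis by (simp add: filterlim_at_top)
  qed
  then have "\<forall>\<^sub>F n in sequentially. (\<integral>s. f n s \<partial>M) = (\<integral>s. f n s \<partial>N)"
  proof eventually_elim
    case (elim n)
    show ?case
      by (rule moment_unique[OF M N mom])
         (use elim in \<open>auto simp: f_def intro!: borel_measurable_continuous_onI continuous_intros\<close>)
  qed
  with tail[OF M] have "(\<lambda>n. \<integral>s. f n s \<partial>N) \<longlonglongrightarrow> measure M {a..}"
    by (rule Lim_transform_eventually)
  with tail[OF N] show ?thesis using LIMSEQ_unique by blast
qed

text \<open>Helly selection works with probability measures, so the masses are first made convergent
  along a subsequence and divided out. If they tend to 0, so do all moments, and the null measure
  serves.\<close>

lemma moment_limit_exists:
  fixes M :: "nat \<Rightarrow> real measure"
  assumes M: "\<And>k. unit_measure (M k)" and C: "\<And>k. measure (M k) UNIV \<le> C"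
    and mom: "\<And>j. 1 \<le> j \<Longrightarrow> (\<lambda>k. \<integral>s. s ^ j \<partial>M k) \<longlonglongrightarrow> d j"
  shows "\<exists>N. unit_measure N \<and> (\<forall>j\<ge>1. (\<integral>s. s ^ j \<partial>N) = d j)"
proof -
  have "bounded (range (\<lambda>k. measure (M k) UNIV))"
    using C by (intro boundedI[where B=C]) auto
  then obtain m r where r: "strict_mono (r::nat\<Rightarrow>nat)" and m: "(\<lambda>k. measure (M (r k)) UNIV) \<longlonglongrightarrow> m"
    using bounded_imp_convergent_subsequence[of "\<lambda>k. measure (M k) UNIV"] by (auto simp: o_def)
  have m0: "m \<ge> 0" using m by (rule LIMSEQ_le_const) auto
  have momr: "(\<lambda>k. \<integral>s. s ^ j \<partial>M (r k)) \<longlonglongrightarrow> d j" if "1 \<le> j" for j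
    using LIMSEQ_subseq_LIMSEQ[OF mom[OF that] r] by (simp add: o_def)
  show ?thesis
  proof (cases "m = 0")
    case True
    have "d j = 0" if "1 \<le> j" for j
    proof -
      have "\<bar>\<integral>s. s ^ j \<partial>M (r k)\<bar> \<le> 1 * measure (M (r k)) UNIV" for k
        by (rule unit_measure_integrable(2)[OF M _ unit_power_abs_le]) simp_all
      then have le: "norm (\<integral>s. s ^ j \<partial>M (r k)) \<le> measure (M (r k)) UNIV" for k
        by simp
      have "(\<lambda>k. \<integral>s. s ^ j \<partial>M (r k)) \<longlonglongrightarrow> 0"
        by (rule Lim_null_comparison[OF always_eventually m[unfolded True]]) (rule allI, rule le)
      with momr[OF that] show ?thesis using LIMSEQ_unique by blast
    qed
    moreover have "unit_measure (null_measure borel)"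
      unfolding unit_measure_def
      by (auto intro!: finite_measureI simp: AE_iff_null null_sets_def)
    ultimately show ?thesis by (intro exI[of _ "null_measure borel"]) (auto simp: integral_null_measure)
  next
    case False
    then have mpos: "m > 0" using m0 by simp
    then obtain k0 where k0: "\<And>k. k \<ge> k0 \<Longrightarrow> measure (M (r k)) UNIV > 0"
      using order_tendstoD(1)[OF m mpos] by (auto simp: eventually_sequentially)
    define M' where "M' k = M (r (k + k0))" for k
    define w where "w k = measure (M' k) UNIV" for k
    have w: "w k > 0" for k using k0 by (simp add: w_def[abs_def] M'_def)
    have wm: "w \<longlonglongrightarrow> m" using LIMSEQ_ignore_initial_segment[OF m, of k0] by (simp add: w_def[abs_def] M'_def)
    have mom': "(\<lambda>k. \<integral>s. s ^ j \<partial>M' k) \<longlonglongrightarrow> d j" if "1 \<le> j" for j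
      using LIMSEQ_ignore_initial_segment[OF momr[OF that], of k0] by (simp add: M'_def)
    have uM: "unit_measure (M' k)" for k using M by (simp add: M'_def)
    have sM: "sets (M' k) = sets borel" "space (M' k) = UNIV" for k
      using uM[of k] sets_eq_imp_space_eq[of "M' k" borel] by (auto simp: unit_measure_def)
    define Q where "Q k = density (M' k) (\<lambda>_. ennreal (1 / w k))" for k
    have Q: "real_distribution (Q k)" for k
    proof -
      interpret finite_measure "M' k" using uM by (simp add: unit_measure_def)
      have "emeasure (Q k) UNIV = ennreal (1 / w k) * emeasure (M' k) UNIV"
        using sM[of k] by (simp add: Q_def emeasure_density nn_integral_cmult)
      also have "\<dots> = 1"
        using w[of k] by (simp add: emeasure_eq_measure w_def[symmetric] ennreal_mult[symmetric])
      finally show ?thesis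
        using sM by (intro real_distribution.intro prob_spaceI real_distribution_axioms.intro) (simp_all add: Q_def)
    qed
    have aeQ: "AE s in Q k. s \<in> {0..1}" for k
      unfolding Q_def using uM[of k] by (subst AE_density) (auto simp: unit_measure_def)
    have "tight Q"
      unfolding tight_def
    proof (intro conjI allI impI Q)
      fix e :: real assume "0 < e"
      \<comment> \<open>Tightness asks for intervals open on the left; the end -1 makes room for the
        point 0.\<close>
      have "measure (Q k) {-1<..1} = 1" for k
      proof -
        interpret real_distribution "Q k" by (rule Q)
        show ?thesis using aeQ[of k] by (subst prob_eq_1) (auto elim!: eventually_mono)
      qed
      then show "\<exists>a b. a < b \<and> (\<forall>n. 1 - e < measure (Q n) {a<..b})"
        using \<open>0 < e\<close> by (intro exI[of _ "-1"] exI[of _ 1]) auto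
    qed
    then obtain r' N where r': "strict_mono (r'::nat\<Rightarrow>nat)" and N: "real_distribution N" "weak_conv_m (Q \<circ> id \<circ> r') N"
      using tight_imp_convergent_subsubsequence[of Q id] strict_mono_id by blast
    interpret N: real_distribution N by (rule N)
    \<comment> \<open>Weak convergence needs test functions that are bounded and continuous on the
      whole line. Clamping makes powers bounded without changing them on the unit interval, and the
      image of the limit under \<open>cl\<close> is again carried by that interval.\<close>
    define cl where "cl s = max 0 (min 1 s)" for s :: real
    have clm: "cl \<in> borel_measurable borel" unfolding cl_def by measurable
    have Ncl: "m * (\<integral>s. cl s ^ j \<partial>N) = d j" if "1 \<le> j" for j
    proof -
      have 1: "(\<lambda>k. \<integral>s. cl s ^ j \<partial>(Q \<circ> id \<circ> r') k) \<longlonglongrightarrow> (\<integral>s. cl s ^ j \<partial>N)"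
      proof (rule weak_conv_imp_integral_bdd_continuous_conv[where B=1])
        show "isCont (\<lambda>s. cl s ^ j) x" for x unfolding cl_def by (intro continuous_intros)
        show "norm (cl x ^ j) \<le> 1" for x by (auto simp: cl_def power_le_one)
      qed (use Q N in \<open>auto simp: o_def\<close>)
      have 2: "(\<integral>s. cl s ^ j \<partial>Q k) = (\<integral>s. s ^ j \<partial>M' k) / w k" for k
      proof -
        have "AE s in Q k. cl s ^ j = s ^ j" using aeQ[of k] by eventually_elim (auto simp: cl_def)
        then have "(\<integral>s. cl s ^ j \<partial>Q k) = (\<integral>s. s ^ j \<partial>Q k)"
          using clm by (intro integral_cong_AE) (simp_all add: Q_def measurable_cong_sets[OF sM(1) refl])
        also have "\<dots> = (\<integral>s. (1 / w k) *\<^sub>R s ^ j \<partial>M' k)"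
          unfolding Q_def using w[of k] by (intro integral_density) (auto simp: measurable_cong_sets[OF sM(1) refl])
        finally show ?thesis by simp
      qed
      have "(\<lambda>k. (\<integral>s. s ^ j \<partial>M' k) / w k) \<longlonglongrightarrow> d j / m"
        using mom'[OF that] wm False by (intro tendsto_divide)
      then have "(\<lambda>k. (\<integral>s. s ^ j \<partial>M' (r' k)) / w (r' k)) \<longlonglongrightarrow> d j / m"
        using LIMSEQ_subseq_LIMSEQ[OF _ r'] by (fastforce simp: o_def)
      then have "(\<integral>s. cl s ^ j \<partial>N) = d j / m"
        using 1 LIMSEQ_unique by (fastforce simp: 2)
      then show ?thesis using False by simp
    qed
    define N' where "N' = density (distr N borel cl) (\<lambda>_. ennreal m)"
    have clN: "cl \<in> borel_measurable N" using clm by simp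
    have "unit_measure N'"
      unfolding unit_measure_def
    proof (intro conjI)
      show "finite_measure N'"
        unfolding N'_def using clN N.emeasure_space_1
        by (intro finite_measureI) (auto simp: emeasure_density nn_integral_cmult emeasure_distr ennreal_mult_eq_top_iff)
      show "AE s in N'. s \<in> {0..1}"
        unfolding N'_def using clN by (subst AE_density) (auto simp: AE_distr_iff cl_def)
    qed (simp add: N'_def)
    moreover have "(\<integral>s. s ^ j \<partial>N') = d j" if "1 \<le> j" for j
    proof -
      have "(\<integral>s. s ^ j \<partial>N') = (\<integral>s. m *\<^sub>R s ^ j \<partial>distr N borel cl)"
        unfolding N'_def using mpos by (intro integral_density) auto
      also have "\<dots> = m * (\<integral>s. cl s ^ j \<partial>N)"
        using clN by (simp add: integral_distr)
      finally show ?thesis using Ncl[OF that] by simp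
    qed
    ultimately show ?thesis by blast
  qed
qed

section \<open>Levy-Khintchine representation\<close>

text \<open>With s = exp(-c y) and l = c r this is the Levy-Khintchine integrand divided by (1-s)^2. It is normalised by a
  term affine in r so as to vanish at r = 1, r = 2 and, for r > 0, at s = 0: the affine part of Psi is then read off
  from two values, and mass escaping to y = oo plays no role. The atom at s = 1 carries the Gaussian part.\<close>

definition lk_kernel :: "real \<Rightarrow> real \<Rightarrow> real" where
  "lk_kernel r s = (if s = 1 then (r - 1) * (r - 2) / 2
     else (s powr r - 1 + r * (1 - s)) / (1 - s)\<^sup>2 - (r - 1))"

text \<open>In this form the integral of the kernel against a measure with density proportional to
  (1-s)^2 is a combination of Laplace transforms.\<close>

lemma lk_kernel_times_square:
  "(1 - s)\<^sup>2 * lk_kernel r s = s powr r - 1 + r * (1 - s) - (r - 1) * (1 - s)\<^sup>2"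
  by (auto simp: lk_kernel_def right_diff_distrib) (simp add: algebra_simps)

lemma lk_kernel_vanish: "0 < r \<Longrightarrow> lk_kernel r 0 = 0"
  by (simp add: lk_kernel_def)

lemma lk_kernel_measurable: "lk_kernel r \<in> borel_measurable borel"
  unfolding lk_kernel_def by measurable

text \<open>Near s = 1, s^r - 1 + r (1-s) behaves like r (r-1)/2 times (1-s)^2; subtracting r - 1
  gives the value (r-1)(r-2)/2 prescribed there.\<close>

lemma lk_kernel_continuous:
  assumes r: "0 < r"
  shows "continuous_on {0..1} (lk_kernel r)"
  unfolding continuous_on_eq_continuous_within
proof
  fix s :: real assume s: "s \<in> {0..1}"
  define f where "f s = (s powr r - 1 + r * (1 - s)) / (1 - s)\<^sup>2 - (r - 1)" for s
  show "continuous (at s within {0..1}) (lk_kernel r)"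
  proof (cases "s = 1")
    case True
    have "(f \<longlongrightarrow> (r - 1) * r / 2 - (r - 1)) (at 1)"
      unfolding f_def using r by real_asymp
    moreover have "(r - 1) * r / 2 - (r - 1) = (r - 1) * (r - 2) / 2" by (simp add: field_simps)
    ultimately have "(f \<longlongrightarrow> (r - 1) * (r - 2) / 2) (at 1 within {0..1})"
      by (metis tendsto_within_subset top_greatest)
    then have "(lk_kernel r \<longlongrightarrow> (r - 1) * (r - 2) / 2) (at 1 within {0..1})"
      by (rule Lim_transform_eventually) (auto simp: eventually_at_filter f_def lk_kernel_def)
    then show ?thesis using True by (simp add: continuous_within lk_kernel_def)
  next
    case False
    have "continuous (at s within {0..1}) f"
      unfolding continuous_within f_def using s False r
      by (intro tendsto_intros tendsto_powr') (auto simp: eventually_at_filter)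
    then show ?thesis
      by (rule continuous_transform_within[where \<delta>="1 - s"])
         (use s False in \<open>auto simp: f_def lk_kernel_def dist_real_def\<close>)
  qed
qed

text \<open>In r the kernel is a positive multiple of an exponential plus an affine term, and at s =
  1 a convex parabola.\<close>

lemma lk_kernel_convex:
  assumes s: "s \<in> {0<..1}"
  shows "convex_on UNIV (\<lambda>r. lk_kernel r s)"
proof (cases "s = 1")
  case True
  have "convex_on UNIV (\<lambda>r. (r - 1) * (r - 2) / 2 :: real)"
    by (rule convex_on_realI[where f'="\<lambda>r. r - 3/2"])
       (auto intro!: derivative_eq_intros simp: field_simps)
  then show ?thesis using True by (simp add: lk_kernel_def)
next
  case False
  have "convex_on UNIV (\<lambda>r. (s powr r - 1 + r * (1 - s)) / (1 - s)\<^sup>2 - (r - 1))"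
  proof (rule convex_on_realI[where f'="\<lambda>r. (s powr r * ln s + (1 - s)) / (1 - s)\<^sup>2 - 1"])
    fix x y :: real assume "x \<le> y"
    have "s powr y \<le> s powr x" using s \<open>x \<le> y\<close> by (intro powr_mono') auto
    moreover have "ln s \<le> 0" using s by simp
    ultimately have "s powr x * ln s \<le> s powr y * ln s" by (rule mult_right_mono_neg)
    then show "(s powr x * ln s + (1 - s)) / (1 - s)\<^sup>2 - 1 \<le> (s powr y * ln s + (1 - s)) / (1 - s)\<^sup>2 - 1"
      by (intro diff_right_mono divide_right_mono) auto
  next
    fix x :: real
    show "((\<lambda>r. (s powr r - 1 + r * (1 - s)) / (1 - s)\<^sup>2 - (r - 1)) has_real_derivative
        (s powr x * ln s + (1 - s)) / (1 - s)\<^sup>2 - 1) (at x)"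
    proof -
      have "((\<lambda>r. s powr r - 1 + r * (1 - s)) has_real_derivative (s powr x * ln s + (1 - s))) (at x)"
        using s by (auto intro!: derivative_eq_intros)
      from DERIV_diff[OF DERIV_cdivide[OF this] DERIV_diff[OF DERIV_ident DERIV_const[of 1]]]
      show ?thesis by simp
    qed
  qed simp
  then show ?thesis using False by (simp add: lk_kernel_def)
qed

text \<open>The point s = 0 is left out: since \<open>0 powr 0 = 0\<close>, the kernel at r = 0
  takes the value 0 there instead of 1.\<close>

lemma lk_kernel_nodes:
  assumes "s \<in> {0<..1}"
  shows "lk_kernel 0 s = 1" "lk_kernel 1 s = 0" "lk_kernel 2 s = 0"
proof -
  have "(s\<^sup>2 - 1 + 2 * (1 - s)) = (1 - s)\<^sup>2" by (simp add: power2_eq_square algebra_simps)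
  then show "lk_kernel 0 s = 1" "lk_kernel 1 s = 0" "lk_kernel 2 s = 0"
    using assms by (auto simp: lk_kernel_def)
qed

text \<open>Convexity in r together with the values 1, 0, 0 at 0, 1, 2: the chord over [0, 1] bounds
  from above, the zeros at 1 and 2 from below. The bound 1 will dominate the limit r to 0.\<close>

lemma lk_kernel_unit_interval:
  assumes s: "s \<in> {0<..1}" and r: "0 \<le> r" "r \<le> 1"
  shows "0 \<le> lk_kernel r s" "lk_kernel r s \<le> 1"
proof -
  note conv = lk_kernel_convex[OF s]
  have "lk_kernel ((1 - r) *\<^sub>R 0 + r *\<^sub>R 1) s \<le> (1 - r) * lk_kernel 0 s + r * lk_kernel 1 s"
    using r by (intro convex_onD[OF conv]) auto
  then show "lk_kernel r s \<le> 1" using r by (simp add: lk_kernel_nodes[OF s])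
  \<comment> \<open>The weight that makes 1 a convex combination of 2 and r.\<close>
  define a where "a = 1 / (2 - r)"
  have "a * (2 - r) = 1" using r by (simp add: a_def)
  then have "(1 - a) *\<^sub>R 2 + a *\<^sub>R r = 1" by (simp add: algebra_simps)
  moreover have "lk_kernel ((1 - a) *\<^sub>R 2 + a *\<^sub>R r) s \<le> (1 - a) * lk_kernel 2 s + a * lk_kernel r s"
    using r by (intro convex_onD[OF conv]) (auto simp: a_def)
  ultimately have "0 \<le> a * lk_kernel r s" by (simp only: lk_kernel_nodes[OF s])
  then show "0 \<le> lk_kernel r s" using r by (simp add: a_def zero_le_mult_iff zero_le_divide_iff)
qed

text \<open>By the zeros of the kernel at r = 1 and r = 2, \<open>A\<close> and \<open>B\<close> are
  the values of \<open>Psi\<close> at c and 2 c. Requiring s > 0 excludes jumps to oo from \<rho>;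
  killing is carried by \<open>Psi 0\<close> alone.\<close>

locale lk_data =
  fixes A B c :: real and \<rho> :: "real measure"
  assumes c: "0 < c" and unit: "unit_measure \<rho>" and pos: "AE s in \<rho>. 0 < s"
begin

definition Psi :: "real \<Rightarrow> real" where
  "Psi z = A * (2 - z / c) + B * (z / c - 1) + (\<integral>s. lk_kernel (z / c) s \<partial>\<rho>)"

lemma supp: "AE s in \<rho>. s \<in> {0<..1}"
  using unit pos unfolding unit_measure_def by auto

lemma sets_rho: "sets \<rho> = sets borel" and space_rho: "space \<rho> = UNIV"
  using unit sets_eq_imp_space_eq[of \<rho> borel] by (auto simp: unit_measure_def)

lemma measurable_rho: "f \<in> borel_measurable borel \<Longrightarrow> f \<in> borel_measurable \<rho>"
  using measurable_cong_sets[OF sets_rho refl] by blast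

sublocale finite_measure \<rho> using unit by (simp add: unit_measure_def)

text \<open>For r = 0 the kernel jumps at s = 0, so continuity on the closed interval is replaced by
  its constant value 1 off that point.\<close>

lemma kernel_integrable: "0 \<le> r \<Longrightarrow> integrable \<rho> (lk_kernel r)"
proof (cases "r = 0")
  case True
  have "AE s in \<rho>. lk_kernel 0 s = 1" using supp by eventually_elim (rule lk_kernel_nodes)
  then show ?thesis
    unfolding True using integrable_cong_AE[of "lk_kernel 0" \<rho> "\<lambda>_. 1"] measurable_rho[OF lk_kernel_measurable] by simp
next
  case False
  assume "0 \<le> r"
  then have "0 < r" using False by simp
  then obtain D where "\<And>s. s \<in> {0..1} \<Longrightarrow> \<bar>lk_kernel r s\<bar> \<le> D"
    using continuous_unit_bound[OF lk_kernel_continuous] by blast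
  then show ?thesis by (rule unit_measure_integrable(1)[OF unit lk_kernel_measurable])
qed

lemma Psi_0: "Psi 0 = 2 * A - B + measure \<rho> UNIV"
proof -
  have "AE s in \<rho>. lk_kernel 0 s = 1" using supp by eventually_elim (rule lk_kernel_nodes)
  then have "(\<integral>s. lk_kernel 0 s \<partial>\<rho>) = (\<integral>s. 1 \<partial>\<rho>)"
    by (intro integral_cong_AE) (auto intro: measurable_rho lk_kernel_measurable)
  then show ?thesis by (simp add: Psi_def space_rho)
qed

lemma Psi_convex: "convex_on {0..} Psi"
proof (intro convex_onI)
  fix t x y :: real assume t: "0 < t" "t < 1" and x: "x \<in> {0..}" and y: "y \<in> {0..}"
  have int: "integrable \<rho> (lk_kernel (x / c))" "integrable \<rho> (lk_kernel (y / c))"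
    "integrable \<rho> (lk_kernel (((1 - t) * x + t * y) / c))"
    using x y t c by (auto intro!: kernel_integrable)
  have "AE s in \<rho>. lk_kernel (((1 - t) * x + t * y) / c) s \<le> (1 - t) * lk_kernel (x / c) s + t * lk_kernel (y / c) s"
    using supp
  proof eventually_elim
    case (elim s)
    show ?case using convex_onD[OF lk_kernel_convex[OF elim], of t "x / c" "y / c"] t
      by (simp add: add_divide_distrib)
  qed
  then have "(\<integral>s. lk_kernel (((1 - t) * x + t * y) / c) s \<partial>\<rho>)
      \<le> (\<integral>s. (1 - t) * lk_kernel (x / c) s + t * lk_kernel (y / c) s \<partial>\<rho>)"
    using int by (intro integral_mono_AE) auto
  also have "\<dots> = (1 - t) * (\<integral>s. lk_kernel (x / c) s \<partial>\<rho>) + t * (\<integral>s. lk_kernel (y / c) s \<partial>\<rho>)"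
    using int by simp
  finally show "Psi ((1 - t) *\<^sub>R x + t *\<^sub>R y) \<le> (1 - t) * Psi x + t * Psi y"
    unfolding Psi_def by (simp add: add_divide_distrib diff_divide_distrib) (simp add: algebra_simps)
qed simp

text \<open>Convexity settles the open half line but would allow a jump at 0; there dominated
  convergence is used.\<close>

lemma Psi_continuous: "continuous_on {0..} Psi"
proof -
  have open_cont: "continuous_on {0<..} Psi"
    by (rule convex_on_continuous) (auto intro: convex_on_subset[OF Psi_convex])
  have at0: "(Psi \<longlongrightarrow> Psi 0) (at_right 0)"
  \<comment> \<open>Arguments below c keep r = S n / c in [0, 1], where the kernel is bounded by
    1.\<close>
  proof (rule tendsto_at_right_sequentially[where b=c])
    fix S :: "nat \<Rightarrow> real"
    assume S: "\<And>n. 0 < S n" "\<And>n. S n < c" "S \<longlonglongrightarrow> 0"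
    have "(\<lambda>n. \<integral>s. lk_kernel (S n / c) s \<partial>\<rho>) \<longlonglongrightarrow> (\<integral>s. lk_kernel 0 s \<partial>\<rho>)"
    proof (rule integral_dominated_convergence[where w="\<lambda>_. 1"])
      show "AE s in \<rho>. (\<lambda>n. lk_kernel (S n / c) s) \<longlonglongrightarrow> lk_kernel 0 s"
        using supp
      proof eventually_elim
        case (elim s)
        have "continuous_on UNIV (\<lambda>r. lk_kernel r s)"
          by (rule convex_on_continuous[OF open_UNIV lk_kernel_convex[OF elim]])
        then have "isCont (\<lambda>r. lk_kernel r s) 0" by (simp add: continuous_on_eq_continuous_at)
        moreover have "(\<lambda>n. S n / c) \<longlonglongrightarrow> 0" using S(3) by (rule tendsto_divide_zero)
        ultimately show ?case by (rule isCont_tendsto_compose)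
      qed
      show "AE s in \<rho>. norm (lk_kernel (S n / c) s) \<le> 1" for n
        using supp
      proof eventually_elim
        case (elim s)
        show ?case using lk_kernel_unit_interval[OF elim, of "S n / c"] S(1,2)[of n] c by simp
      qed
    qed (auto intro: measurable_rho lk_kernel_measurable)
    then show "(\<lambda>n. Psi (S n)) \<longlonglongrightarrow> Psi 0"
      unfolding Psi_def using S(3) c by (auto intro!: tendsto_eq_intros)
  qed (rule c)
  show ?thesis
    unfolding continuous_on_eq_continuous_within
  proof
    fix x :: real assume "x \<in> {0..}"
    show "continuous (at x within {0..}) Psi"
    proof (cases "x = 0")
      case True then show ?thesis using at0
        by (simp add: continuous_within at_within_Ici_at_right)
    next
      case False
      then have "isCont Psi x" using open_cont \<open>x \<in> {0..}\<close> by (auto simp: continuous_on_eq_continuous_at)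
      then show ?thesis by (rule continuous_at_imp_continuous_at_within)
    qed
  qed
qed

end

context lk_data begin

text \<open>Under s = exp(-c h), \<rho> divided by (1-s)^2 on (0, 1) becomes the Levy measure, the
  atom at s = 1 gives the Gaussian coefficient, and the mismatch of the compensators goes into the
  drift. A positive value of Psi - Psi 0 excludes subordinators, whose exponents are
  nonpositive.\<close>

lemma levy_khintchine:
  assumes zpos: "0 \<le> z1" "0 < Psi z1 - Psi 0"
  shows "spos_levy_exponent (\<lambda>z. Psi z - Psi 0)"
proof -
  define W where "W s = indicator {0<..<1} s / (1 - s)\<^sup>2" for s :: real
  define m where "m = distr (density \<rho> (\<lambda>s. ennreal (W s))) borel (\<lambda>s. - ln s / c)"
  have Wm: "W \<in> borel_measurable borel" unfolding W_def by measurable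
  have W0: "0 \<le> W s" for s by (simp add: W_def)
  have lnm: "(\<lambda>s. - ln s / c) \<in> borel_measurable borel" by measurable
  have lnm': "(\<lambda>s. - ln s / c) \<in> borel_measurable (density \<rho> f)" for f
    using measurable_rho[OF lnm] by simp
  have m_nn: "(\<integral>\<^sup>+h. f h \<partial>m) = (\<integral>\<^sup>+s. ennreal (W s) * f (- ln s / c) \<partial>\<rho>)"
    if f: "f \<in> borel_measurable borel" for f
  proof -
    have "(\<integral>\<^sup>+h. f h \<partial>m) = (\<integral>\<^sup>+s. f (- ln s / c) \<partial>density \<rho> (\<lambda>s. ennreal (W s)))"
      unfolding m_def using f lnm' by (intro nn_integral_distr) auto
    also have "\<dots> = (\<integral>\<^sup>+s. ennreal (W s) * f (- ln s / c) \<partial>\<rho>)"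
      using measurable_compose[OF lnm f] Wm by (intro nn_integral_density) (auto intro!: measurable_rho measurable_compose[OF measurable_rho])
    finally show ?thesis .
  qed
  have m_int: "integrable m f \<longleftrightarrow> integrable \<rho> (\<lambda>s. W s * f (- ln s / c))"
      "(\<integral>h. f h \<partial>m) = (\<integral>s. W s * f (- ln s / c) \<partial>\<rho>)"
    if f: "f \<in> borel_measurable borel" for f :: "real \<Rightarrow> real"
  proof -
    have fl: "(\<lambda>s. f (- ln s / c)) \<in> borel_measurable \<rho>" "W \<in> borel_measurable \<rho>"
      using measurable_compose[OF lnm f] Wm by (auto intro: measurable_rho)
    show "integrable m f \<longleftrightarrow> integrable \<rho> (\<lambda>s. W s * f (- ln s / c))"
      unfolding m_def using f lnm' fl W0
      by (subst integrable_distr_eq) (auto simp: integrable_density)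
    show "(\<integral>h. f h \<partial>m) = (\<integral>s. W s * f (- ln s / c) \<partial>\<rho>)"
      unfolding m_def using f lnm' fl W0
      by (subst integral_distr) (auto simp: integral_density)
  qed
  define \<rho>1 where "\<rho>1 = measure \<rho> {1}"
  define R where "R = measure \<rho> {0<..<1}"
  have total: "measure \<rho> UNIV = \<rho>1 + R"
  proof -
    have "measure \<rho> UNIV = measure \<rho> ({1} \<union> {0<..<1})"
      using supp by (intro finite_measure_eq_AE) (auto simp: sets_rho)
    also have "\<dots> = \<rho>1 + R"
      unfolding \<rho>1_def R_def by (intro finite_measure_Union) (auto simp: sets_rho)
    finally show ?thesis .
  qed
  \<comment> \<open>The kernel compensates with 1 - s, the Levy-Khintchine formula with -ln s cut
    off at h <= 1, that is at s >= exp(-c). Their weighted difference \<open>j\<close> is bounded,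
    since 1 - s + ln s is of second order at s = 1 and the logarithm is cut off near 0.\<close>
  define j where "j s = W s * ((1 - s) + (if exp (- c) \<le> s then ln s else 0))" for s
  have jm: "j \<in> borel_measurable borel" using Wm unfolding j_def by measurable
  define ec where "ec = 1 / (1 - exp (- c))"
  have ec: "0 \<le> ec" using c by (simp add: ec_def)
  \<comment> \<open>The sum of three bounds: \<open>ec\<close> below the cut-off, 2 on the rest of
    [1/2, 1), and 4 (1 + c) on the rest of (0, 1/2).\<close>
  have j_bound: "\<bar>j s\<bar> \<le> 6 + 4 * c + ec" if s: "s \<in> {0..1}" for s
  proof (cases "s \<in> {0<..<1}")
    case False
    then have "j s = 0" by (simp add: j_def W_def)
    then show ?thesis using c ec by simp
  next
    case True
    then have s01: "0 < s" "s < 1" by auto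
    have e1: "exp (- c) < 1" using c by simp
    consider "s < exp (- c)" | "exp (- c) \<le> s" "1/2 \<le> s" | "exp (- c) \<le> s" "s < 1/2" by linarith
    then show ?thesis
    proof cases
      case 1
      then have "j s = 1 / (1 - s)" using True by (simp add: j_def W_def power2_eq_square)
      moreover have "1 / (1 - s) \<le> ec"
        unfolding ec_def using 1 e1 s01 by (intro divide_left_mono mult_pos_pos) auto
      moreover have "0 \<le> 1 / (1 - s)" using s01 by simp
      ultimately show ?thesis using c by linarith
    next
      case 2
      have "\<bar>ln (1 + (s - 1)) - (s - 1)\<bar> \<le> 2 * (s - 1)\<^sup>2"
        using 2 s01 by (intro abs_ln_one_plus_x_minus_x_bound) auto
      then have "\<bar>(1 - s) + ln s\<bar> \<le> 2 * (1 - s)\<^sup>2" by (simp add: power2_commute algebra_simps)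
      then have "\<bar>j s\<bar> \<le> 2"
        using True 2 by (simp add: j_def W_def abs_mult divide_simps)
      then show ?thesis using c ec by linarith
    next
      case 3
      have "- c \<le> ln s" using 3 s01 by (simp add: ln_ge_iff)
      then have n: "\<bar>(1 - s) + ln s\<bar> \<le> 1 + c" using s01 ln_le_minus_one[of s] by (simp add: abs_le_iff)
      have "(1/2)\<^sup>2 \<le> (1 - s)\<^sup>2" using 3 by (intro power_mono) auto
      then have "1 / (1 - s)\<^sup>2 \<le> 4" using s01 by (simp add: field_simps power2_eq_square)
      then have "1 / (1 - s)\<^sup>2 * \<bar>(1 - s) + ln s\<bar> \<le> 4 * (1 + c)"
        using n by (intro mult_mono) auto
      then have "\<bar>j s\<bar> \<le> 4 * (1 + c)" using True 3 by (simp add: j_def W_def abs_mult)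
      then show ?thesis using c ec by (simp add: algebra_simps)
    qed
  qed
  have jint: "integrable \<rho> j" by (rule unit_measure_integrable(1)[OF unit jm j_bound])
  define J where "J = (\<integral>s. j s \<partial>\<rho>)"
  define lkf where "lkf z h = exp (- z * h) + z * h * indicator {0<..1} h - 1" for z h :: real
  have lkfm: "lkf z \<in> borel_measurable borel" for z unfolding lkf_def by measurable
  have decomp: "lk_kernel r s = \<rho>1' * indicator {1} s + W s * lkf (c * r) (- ln s / c) + r * j s - (r - 1) * indicator {0<..<1} s"
    if "\<rho>1' = (r - 1) * (r - 2) / 2" "s \<in> {0<..1}" for r s \<rho>1'
  proof (cases "s = 1")
    case True then show ?thesis using that by (simp add: lk_kernel_def W_def j_def)
  next
    case False
    then have s01: "0 < s" "s < 1" using that by auto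
    have 1: "exp (- (c * r) * (- ln s / c)) = s powr r" using s01 c by (simp add: powr_def)
    have 2: "(- ln s / c \<in> {0<..1}) \<longleftrightarrow> exp (- c) \<le> s"
    proof -
      have "0 < - ln s / c" using s01 c by (intro divide_pos_pos) auto
      moreover have "- ln s / c \<le> 1 \<longleftrightarrow> - c \<le> ln s" using c by (auto simp: field_simps)
      moreover have "- c \<le> ln s \<longleftrightarrow> exp (- c) \<le> s" using s01 by (simp add: ln_ge_iff)
      ultimately show ?thesis by simp
    qed
    have 3: "lkf (c * r) (- ln s / c) = s powr r - 1 - r * (if exp (- c) \<le> s then ln s else 0)"
      unfolding lkf_def indicator_def 1 2 using c by auto
    show ?thesis unfolding 3 using s01 by (simp add: lk_kernel_def W_def j_def diff_divide_distrib add_divide_distrib ring_distribs)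
  qed
  have lk_int: "integrable \<rho> (\<lambda>s. W s * lkf (c * r) (- ln s / c))"
    and lk_eq: "(\<integral>s. lk_kernel r s \<partial>\<rho>) = (r - 1) * (r - 2) / 2 * \<rho>1 + (\<integral>s. W s * lkf (c * r) (- ln s / c) \<partial>\<rho>) + r * J - (r - 1) * R"
    if r: "0 \<le> r" for r
  proof -
    define k where "k = (r - 1) * (r - 2) / 2"
    have ind: "integrable \<rho> (indicator {1} :: real \<Rightarrow> real)" "integrable \<rho> (indicator {0<..<1} :: real \<Rightarrow> real)"
      by (auto simp: sets_rho emeasure_eq_measure integrable_indicator_iff)
    have meas: "(\<lambda>s. W s * lkf (c * r) (- ln s / c)) \<in> borel_measurable \<rho>"
      using measurable_compose[OF lnm lkfm] Wm by (intro measurable_rho) auto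
    have "AE s in \<rho>. lk_kernel r s - k * indicator {1} s - r * j s + (r - 1) * indicator {0<..<1} s = W s * lkf (c * r) (- ln s / c)"
      using supp
    proof eventually_elim
      case (elim s) show ?case using decomp[OF k_def elim] by simp
    qed
    moreover have I: "integrable \<rho> (\<lambda>s. lk_kernel r s - k * indicator {1} s - r * j s + (r - 1) * indicator {0<..<1} s)"
      using kernel_integrable[OF r] ind jint by auto
    ultimately show 1: "integrable \<rho> (\<lambda>s. W s * lkf (c * r) (- ln s / c))"
      using meas integrable_cong_AE_imp by blast
    have "(\<integral>s. lk_kernel r s \<partial>\<rho>) = (\<integral>s. k * indicator {1} s + W s * lkf (c * r) (- ln s / c) + r * j s - (r - 1) * indicator {0<..<1} s \<partial>\<rho>)"
    proof (rule integral_cong_AE)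
      show "AE s in \<rho>. lk_kernel r s = k * indicator {1} s + W s * lkf (c * r) (- ln s / c) + r * j s - (r - 1) * indicator {0<..<1} s"
        using supp by eventually_elim (rule decomp[OF k_def])
    qed (use meas ind jint kernel_integrable[OF r] in auto)
    also have "\<dots> = k * \<rho>1 + (\<integral>s. W s * lkf (c * r) (- ln s / c) \<partial>\<rho>) + r * J - (r - 1) * R"
      using ind jint 1 by (simp add: \<rho>1_def R_def J_def sets_rho space_rho)
    finally show "(\<integral>s. lk_kernel r s \<partial>\<rho>) = (r - 1) * (r - 2) / 2 * \<rho>1 + (\<integral>s. W s * lkf (c * r) (- ln s / c) \<partial>\<rho>) + r * J - (r - 1) * R"
      by (simp add: k_def)
  qed
  \<comment> \<open>The coefficients of r and r^2 in \<open>Psi\<close>, for z = c r. The atom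
    enters through (r-1)(r-2)/2, which contributes -3/2 and 1/2.\<close>
  define \<gamma> where "\<gamma> = - (B - A + J - R - 3/2 * \<rho>1) / c"
  define \<sigma> where "\<sigma> = sqrt \<rho>1 / c"
  have \<sigma>2: "\<sigma>\<^sup>2 = \<rho>1 / c\<^sup>2" unfolding \<sigma>_def by (simp add: power_divide \<rho>1_def)
  have psi: "Psi z - Psi 0 = - \<gamma> * z + \<sigma>\<^sup>2 / 2 * z\<^sup>2 + (\<integral>h. lkf z h \<partial>m)" if z: "0 \<le> z" for z
  proof -
    define r where "r = z / c"
    have zr: "z = c * r" and r: "0 \<le> r" using c z by (auto simp: r_def)
    have "Psi z = A * (2 - r) + B * (r - 1) + ((r - 1) * (r - 2) / 2 * \<rho>1 + (\<integral>h. lkf z h \<partial>m) + r * J - (r - 1) * R)"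
      unfolding Psi_def r_def[symmetric] lk_eq[OF r] m_int(2)[OF lkfm] unfolding zr ..
    moreover have "- \<gamma> * z = r * (B - A + J - R - 3/2 * \<rho>1)"
      using c by (simp add: \<gamma>_def zr) (simp add: algebra_simps)
    moreover have "\<sigma>\<^sup>2 / 2 * z\<^sup>2 = \<rho>1 / 2 * r\<^sup>2" using c by (simp add: \<sigma>2 zr power_mult_distrib)
    ultimately show ?thesis unfolding Psi_0 total by (simp add: field_simps power2_eq_square)
  qed
  have lkf_int: "integrable m (lkf z)" if z: "0 \<le> z" for z
    unfolding m_int(1)[OF lkfm] using lk_int[of "z / c"] z c by simp
  have mpos: "emeasure m {..0} = 0"
  proof -
    have "emeasure m {..0} = (\<integral>\<^sup>+h. indicator {..0} h \<partial>m)" by (simp add: m_def)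
    also have "\<dots> = (\<integral>\<^sup>+s. ennreal (W s) * indicator {..0} (- ln s / c) \<partial>\<rho>)" by (rule m_nn) simp
    also have "\<dots> = (\<integral>\<^sup>+s. 0 \<partial>\<rho>)"
      using c by (intro nn_integral_cong) (auto simp: W_def indicator_def field_simps)
    finally show ?thesis by simp
  qed
  have mAE: "AE h in m. 0 < h"
    using mpos by (auto simp: AE_iff_null null_sets_def m_def not_less atMost_def)
  have finite: "(\<integral>\<^sup>+ h. ennreal (min 1 (h\<^sup>2)) \<partial>m) < \<infinity>"
  proof -
    \<comment> \<open>Below 1/2 the weight is at most 4; above, -ln s <= 2 (1-s) cancels the weight
      up to 4 / c^2.\<close>
    have le: "W s * min 1 ((- ln s / c)\<^sup>2) \<le> 4 + 4 / c\<^sup>2" for s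
    proof (cases "s \<in> {0<..<1}")
      case False then show ?thesis by (simp add: W_def)
    next
      case True
      then have s01: "0 < s" "s < 1" by auto
      show ?thesis
      proof (cases "s < 1/2")
        case True
        have "(1/2)\<^sup>2 \<le> (1 - s)\<^sup>2" using True by (intro power_mono) auto
        then have "W s \<le> 4" using s01 by (simp add: W_def field_simps power2_eq_square)
        then have "W s * min 1 ((- ln s / c)\<^sup>2) \<le> 4 * 1" using W0 by (intro mult_mono) auto
        then show ?thesis by (simp add: add_increasing2)
      next
        case False
        have "ln (1 / s) \<le> 1 / s - 1" using s01 by (intro ln_le_minus_one) auto
        then have "- ln s \<le> (1 - s) / s" using s01 by (simp add: ln_div diff_divide_distrib)
        also have "\<dots> \<le> (1 - s) / (1/2)" using False s01 by (intro divide_left_mono) auto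
        finally have "- ln s \<le> 2 * (1 - s)" by simp
        moreover have "0 \<le> - ln s" using s01 by simp
        ultimately have "(- ln s)\<^sup>2 \<le> (2 * (1 - s))\<^sup>2" by (intro power_mono)
        then have "(- ln s / c)\<^sup>2 \<le> 4 / c\<^sup>2 * (1 - s)\<^sup>2"
          using divide_right_mono[of "(- ln s)\<^sup>2" "(2 * (1 - s))\<^sup>2" "c\<^sup>2"]
          unfolding power_divide power_mult_distrib by simp
        then have "W s * min 1 ((- ln s / c)\<^sup>2) \<le> W s * (4 / c\<^sup>2 * (1 - s)\<^sup>2)"
          using W0 by (intro mult_left_mono) auto
        also have "\<dots> = 4 / c\<^sup>2" using s01 by (simp add: W_def)
        finally show ?thesis by simp
      qed
    qed
    have "(\<integral>\<^sup>+ h. ennreal (min 1 (h\<^sup>2)) \<partial>m) = (\<integral>\<^sup>+ s. ennreal (W s) * ennreal (min 1 ((- ln s / c)\<^sup>2)) \<partial>\<rho>)"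
      by (rule m_nn) measurable
    also have "\<dots> \<le> (\<integral>\<^sup>+ s. ennreal (4 + 4 / c\<^sup>2) \<partial>\<rho>)"
    proof (rule nn_integral_mono)
      fix s
      show "ennreal (W s) * ennreal (min 1 ((- ln s / c)\<^sup>2)) \<le> ennreal (4 + 4 / c\<^sup>2)"
        using ennreal_leI[OF le[of s]] W0[of s] by (subst (asm) ennreal_mult) auto
    qed
    also have "\<dots> < \<infinity>" by (simp add: emeasure_eq_measure ennreal_mult_less_top)
    finally show ?thesis .
  qed
  \<comment> \<open>For a subordinator, exp(-z h) <= 1 bounds the integrand by its compensator, and
    the drift then makes the exponent nonpositive at \<open>z1\<close>.\<close>
  have nosub: "\<not> (\<sigma> = 0 \<and> (\<integral>\<^sup>+ h. ennreal h * indicator {0<..1} h \<partial>m) < \<infinity> \<and>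
             \<gamma> - (\<integral> h. h * indicator {0<..1} h \<partial>m) \<ge> 0)"
  proof
    assume as: "\<sigma> = 0 \<and> (\<integral>\<^sup>+ h. ennreal h * indicator {0<..1} h \<partial>m) < \<infinity> \<and>
             \<gamma> - (\<integral> h. h * indicator {0<..1} h \<partial>m) \<ge> 0"
    have hint: "integrable m (\<lambda>h. h * indicator {0<..1} h)"
    proof (rule integrableI_nonneg)
      have "(\<integral>\<^sup>+ h. ennreal (h * indicator {0<..1} h) \<partial>m) = (\<integral>\<^sup>+ h. ennreal h * indicator {0<..1} h \<partial>m)"
        by (intro nn_integral_cong) (auto simp: indicator_def)
      then show "(\<integral>\<^sup>+ h. ennreal (h * indicator {0<..1} h) \<partial>m) < \<infinity>" using as by simp
    qed (auto simp: m_def indicator_def)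
    have "(\<integral>h. lkf z1 h \<partial>m) \<le> (\<integral>h. z1 * (h * indicator {0<..1} h) \<partial>m)"
    proof (rule integral_mono_AE[OF lkf_int[OF zpos(1)]])
      show "AE h in m. lkf z1 h \<le> z1 * (h * indicator {0<..1} h)"
        using mAE by eventually_elim (use zpos(1) in \<open>simp add: lkf_def\<close>)
    qed (use hint in auto)
    also have "\<dots> = z1 * (\<integral>h. h * indicator {0<..1} h \<partial>m)" by simp
    also have "\<dots> \<le> z1 * \<gamma>" using as zpos(1) by (intro mult_left_mono) auto
    finally have "Psi z1 - Psi 0 \<le> 0" using psi[OF zpos(1)] as by (simp add: mult.commute)
    then show False using zpos(2) by simp
  qed
  show ?thesis
    unfolding spos_levy_exponent_def
    using psi mpos finite nosub
    by (intro exI[of _ \<gamma>] exI[of _ \<sigma>] exI[of _ m])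
       (auto simp: lkf_def m_def \<sigma>_def \<rho>1_def c less_imp_le)
qed

end

section \<open>The infinitesimal generator of the cumulant semigroup\<close>

lemma convex_on_adjacent_slopes:
  fixes f :: "real \<Rightarrow> real"
  assumes "convex_on I f" "x \<in> I" "z \<in> I" "x < y" "y < z"
  shows "(f y - f x) / (y - x) \<le> (f z - f y) / (z - y)"
proof -
  have "(f y - f x) / (y - x) = (f x - f y) / (x - y)" "(f z - f y) / (z - y) = (f y - f z) / (y - z)"
    using minus_divide_divide[of "f x - f y" "x - y"] minus_divide_divide[of "f y - f z" "y - z"] by simp_all
  then show ?thesis using convex_on_slope_le[OF assms] by linarith
qed

text \<open>exp y dominates 1 + y + y^2/2, and (1 - y + y^2/2)(1 + y + y^2/2) = 1 + y^4/4 >=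
  1.\<close>

lemma exp_minus_quadratic_bound:
  fixes y :: real assumes y: "0 \<le> y" shows "exp (- y) - 1 + y \<le> y\<^sup>2 / 2"
proof -
  have "1 + y + y\<^sup>2 / 2 \<le> exp y" using y by (rule exp_lower_Taylor_quadratic)
  then have "(1 - y + y\<^sup>2 / 2) * (1 + y + y\<^sup>2 / 2) \<le> (1 - y + y\<^sup>2 / 2) * exp y"
  proof (rule mult_left_mono)
    have "0 \<le> (y - 1)\<^sup>2" by simp
    then show "0 \<le> 1 - y + y\<^sup>2 / 2" by (simp add: power2_eq_square algebra_simps)
  qed
  moreover have "(1 - y + y\<^sup>2 / 2) * (1 + y + y\<^sup>2 / 2) = 1 + y ^ 4 / 4"
    by (simp add: power2_eq_square power4_eq_xxxx algebra_simps)
  moreover have "0 \<le> y ^ 4 / 4" by simp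
  ultimately have "1 \<le> (1 - y + y\<^sup>2 / 2) * exp y" by linarith
  then have "exp (- y) \<le> 1 - y + y\<^sup>2 / 2" by (simp add: exp_minus divide_simps)
  then show ?thesis by simp
qed

lemma finite_measure_densityI:
  assumes "f \<in> borel_measurable M" "(\<integral>\<^sup>+x. f x \<partial>M) \<noteq> \<infinity>"
  shows "finite_measure (density M f)"
proof (rule finite_measureI)
  have "emeasure (density M f) (space M) = (\<integral>\<^sup>+x. f x * indicator (space M) x \<partial>M)"
    using assms(1) by (simp add: emeasure_density)
  also have "\<dots> = (\<integral>\<^sup>+x. f x \<partial>M)" by (rule nn_integral_cong) simp
  finally show "emeasure (density M f) (space (density M f)) \<noteq> \<infinity>" using assms(2) by simp
qed

text \<open>\<open>N t x\<close> stands for the law of exp(-c X_t) under P_x and \<open>u\<close>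
  for the cumulant. The derivative at time 0 is prescribed above z0 only; the rest has to come from
  the measures.\<close>

locale laplace_flow =
  fixes u :: "real \<Rightarrow> real \<Rightarrow> real" and N :: "real \<Rightarrow> real \<Rightarrow> real measure"
    and z0 c :: real and g :: "real \<Rightarrow> real"
  assumes z0: "0 \<le> z0" and c_gt: "z0 < c"
    and N: "\<And>t x. 0 \<le> t \<Longrightarrow> 0 \<le> x \<Longrightarrow> unit_measure (N t x)"
    and mass: "\<And>t x. 0 \<le> t \<Longrightarrow> 0 \<le> x \<Longrightarrow> measure (N t x) UNIV = 1"
    and lap: "\<And>t x r. 0 \<le> t \<Longrightarrow> 0 \<le> x \<Longrightarrow> 0 \<le> r \<Longrightarrow> (\<integral>s. s powr r \<partial>N t x) = exp (- x * u t (c * r))"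
    and u_nonneg: "\<And>t l. 0 \<le> t \<Longrightarrow> 0 \<le> l \<Longrightarrow> 0 \<le> u t l"
    and u_0: "\<And>l. 0 \<le> l \<Longrightarrow> u 0 l = l"
    and semigroup: "\<And>s t l. 0 \<le> s \<Longrightarrow> 0 \<le> t \<Longrightarrow> 0 \<le> l \<Longrightarrow> u (t + s) l = u t (u s l)"
    and above: "\<And>t l. 0 \<le> t \<Longrightarrow> z0 < l \<Longrightarrow> z0 < u t l \<and> u t l \<le> l"
    and deriv_above: "\<And>l. z0 < l \<Longrightarrow> ((\<lambda>t. (l - u t l) / t) \<longlongrightarrow> g l) (at_right 0)"
    and g_cont: "continuous_on {z0..} g" and g_z0: "g z0 = 0"
begin

lemma c: "0 < c" using z0 c_gt by simp

section \<open>Monotonicity, concavity and invariance of [0, z0]\<close>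

lemma integrable_powr: "0 \<le> t \<Longrightarrow> 0 \<le> x \<Longrightarrow> 0 \<le> r \<Longrightarrow> integrable (N t x) (\<lambda>s. s powr r)"
  by (rule unit_measure_integrable(1)[OF N, where B=1]) (auto simp: powr_le1)

lemma AE_unit: "0 \<le> t \<Longrightarrow> 0 \<le> x \<Longrightarrow> AE s in N t x. s \<in> {0..1}"
  using N unfolding unit_measure_def by blast

lemma lap': "0 \<le> t \<Longrightarrow> 0 \<le> x \<Longrightarrow> 0 \<le> l \<Longrightarrow> (\<integral>s. s powr (l / c) \<partial>N t x) = exp (- x * u t l)"
  using lap[of t x "l / c"] c by simp

lemma u_mono:
  assumes "0 \<le> t" "0 \<le> a" "a \<le> b" shows "u t a \<le> u t b"
proof -
  have "a / c \<le> b / c" using assms c by (intro divide_right_mono) auto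
  then have "(\<integral>s. s powr (b / c) \<partial>N t 1) \<le> (\<integral>s. s powr (a / c) \<partial>N t 1)"
    using assms c
  proof (intro integral_mono_AE integrable_powr)
    show "AE s in N t 1. s powr (b / c) \<le> s powr (a / c)"
      using AE_unit[OF assms(1) zero_le_one] by (rule eventually_mono) (use \<open>a / c \<le> b / c\<close> in \<open>auto intro!: powr_mono'\<close>)
  qed auto
  then show ?thesis using assms by (simp add: lap')
qed

text \<open>For each start q the function 1 - exp(-q u_t(l)) is concave in l, being the expectation
  of 1 - s^(l/c). Dividing by q and letting q tend to 0 passes concavity to u_t.\<close>

lemma u_concave:
  assumes t: "0 \<le> t" shows "convex_on {0..} (\<lambda>l. - u t l)"
proof (rule convex_onI)
  fix a x y :: real assume a: "0 < a" "a < 1" and x: "x \<in> {0..}" and y: "y \<in> {0..}"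
  define w where "w = (1 - a) * x + a * y"
  have w: "0 \<le> w" unfolding w_def using a x y by (auto intro!: add_nonneg_nonneg)
  define f where "f q l = (1 - exp (- q * u t l)) / q" for q l
  have lim: "((\<lambda>q. f q l) \<longlongrightarrow> u t l) (at_right 0)" for l
    unfolding f_def by real_asymp
  have ineq: "(1 - a) * f q x + a * f q y \<le> f q w" if q: "0 < q" for q
  proof -
    have "AE s in N t q. s powr (w / c) \<le> (1 - a) * s powr (x / c) + a * s powr (y / c)"
      using AE_unit[OF t less_imp_le[OF q]]
    proof eventually_elim
      case (elim s)
      show ?case
      proof (cases "s = 0")
        case False
        have "convex_on UNIV (exp :: real \<Rightarrow> real)" by (rule exp_convex)
        from convex_onD[OF this, of a "x / c * ln s" "y / c * ln s"] a
        show ?thesis using False elim by (simp add: powr_def w_def algebra_simps add_divide_distrib diff_divide_distrib)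
      qed simp
    qed
    then have "(\<integral>s. s powr (w / c) \<partial>N t q) \<le> (\<integral>s. (1 - a) * s powr (x / c) + a * s powr (y / c) \<partial>N t q)"
      using t q w x y c by (intro integral_mono_AE integrable_powr Bochner_Integration.integrable_add integrable_mult_right) auto
    also have "\<dots> = (1 - a) * exp (- q * u t x) + a * exp (- q * u t y)"
      using t q x y c integrable_powr[of t q "x / c"] integrable_powr[of t q "y / c"] by (simp add: lap')
    finally have "exp (- q * u t w) \<le> (1 - a) * exp (- q * u t x) + a * exp (- q * u t y)"
      using t q w by (simp add: lap')
    then have "((1 - a) * (1 - exp (- q * u t x)) + a * (1 - exp (- q * u t y))) / q \<le> (1 - exp (- q * u t w)) / q"
      using q by (intro divide_right_mono) (auto simp: algebra_simps)
    then show ?thesis by (simp add: f_def add_divide_distrib)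
  qed
  have "(1 - a) * u t x + a * u t y \<le> u t w"
  proof (rule tendsto_le[OF _ lim])
    show "((\<lambda>q. (1 - a) * f q x + a * f q y) \<longlongrightarrow> (1 - a) * u t x + a * u t y) (at_right 0)"
      by (intro tendsto_intros lim)
    show "\<forall>\<^sub>F q in at_right 0. (1 - a) * f q x + a * f q y \<le> f q w"
      using ineq by (auto simp: eventually_at_filter)
  qed simp
  then show "- u t ((1 - a) *\<^sub>R x + a *\<^sub>R y) \<le> (1 - a) * - u t x + a * - u t y"
    by (simp add: w_def)
qed simp

lemma u_le: "0 \<le> t \<Longrightarrow> 0 \<le> l \<Longrightarrow> u t l \<le> l + z0 + 1"
  using u_mono[of t l "l + z0 + 1"] above[of t "l + z0 + 1"] z0 by simp

text \<open>The upper bound is monotonicity compared with levels d > z0. For the lower one,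
  concavity and u_t(0) >= 0 give u_t(l) >= (l/d) u_t(d) >= l z0 / d, and d decreases to z0.\<close>

lemma below:
  assumes t: "0 \<le> t" and l: "0 \<le> l" "l \<le> z0" shows "l \<le> u t l" "u t l \<le> z0"
proof -
  show "u t l \<le> z0"
  proof (rule dense_ge)
    fix d assume d: "z0 < d"
    have "u t l \<le> u t d" using t l d by (intro u_mono) auto
    also have "\<dots> \<le> d" using above[OF t d] by simp
    finally show "u t l \<le> d" .
  qed
  show "l \<le> u t l"
  proof (cases "l = 0")
    case True then show ?thesis using u_nonneg[OF t] by simp
  next
    case False
    then have z0p: "0 < z0" using l by simp
    have "l * z0 / d \<le> u t l" if d: "z0 < d" for d
    proof -
      define a where "a = l / d"
      have a: "0 \<le> a" "a \<le> 1" using l d z0 by (auto simp: a_def)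
      have "- u t ((1 - a) *\<^sub>R 0 + a *\<^sub>R d) \<le> (1 - a) * - u t 0 + a * - u t d"
        using a d z0 by (intro convex_onD[OF u_concave[OF t]]) auto
      moreover have "(1 - a) *\<^sub>R 0 + a *\<^sub>R d = l" using d z0 by (simp add: a_def)
      moreover have "0 \<le> (1 - a) * u t 0" using a u_nonneg[OF t] by simp
      moreover have "a * z0 \<le> a * u t d" using a above[OF t d] by (intro mult_left_mono) auto
      ultimately have "a * z0 \<le> u t l" by simp
      then show ?thesis by (simp add: a_def)
    qed
    then have "\<forall>\<^sub>F d in at_right z0. l * z0 / d \<le> u t l" by (auto simp: eventually_at_filter)
    moreover have "((\<lambda>d. l * z0 / d) \<longlongrightarrow> l * z0 / z0) (at_right z0)"
      using z0p by (intro tendsto_intros) auto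
    ultimately have "l * z0 / z0 \<le> u t l" by (intro tendsto_upperbound) auto
    then show ?thesis using z0p by simp
  qed
qed

lemma u_z0: "0 \<le> t \<Longrightarrow> u t z0 = z0" using below[of t z0] z0 by auto

section \<open>Difference quotients at time 0 and their Levy-Khintchine limit\<close>

definition G :: "real \<Rightarrow> real \<Rightarrow> real" where "G t l = (l - u t l) / t"

text \<open>Linearising u in the starting point x = t^2 costs only O(t) and turns the difference quotient into an expectation.\<close>

definition Gq :: "real \<Rightarrow> real \<Rightarrow> real" where "Gq t l = (l - (1 - exp (- t\<^sup>2 * u t l)) / t\<^sup>2) / t"

lemma G_convex:
  assumes t: "0 < t" shows "convex_on {0..} (G t)"
proof -
  have "convex_on {0..} (\<lambda>l::real. l)" by (rule convex_onI) auto
  then have "convex_on {0..} (\<lambda>l. l + (- u t l))"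
    using t by (intro convex_on_add u_concave) auto
  then have "convex_on {0..} (\<lambda>l. (1 / t) * (l + (- u t l)))"
    using t by (intro convex_on_cmul) auto
  then show ?thesis by (simp add: G_def[abs_def] diff_divide_distrib add_divide_distrib)
qed

text \<open>With y = t^2 u_t(l) the error is (exp(-y) - 1 + y) / t^3 <= y^2 / (2 t^3) = t u_t(l)^2 /
  2, and u_t(l) is bounded uniformly in t by \<open>u_le\<close>.\<close>

lemma Gq_minus_G:
  assumes l: "0 \<le> l" shows "((\<lambda>t. Gq t l - G t l) \<longlongrightarrow> 0) (at_right 0)"
proof (rule Lim_null_comparison)
  define D where "D = l + z0 + 1"
  show "((\<lambda>t. t * D\<^sup>2 / 2) \<longlongrightarrow> 0) (at_right 0)" by real_asymp
  have "norm (Gq t l - G t l) \<le> t * D\<^sup>2 / 2" if t: "0 < t" for t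
  proof -
    define y where "y = t\<^sup>2 * u t l"
    have y: "0 \<le> y" using u_nonneg[of t l] t l by (simp add: y_def)
    have eq: "Gq t l - G t l = (exp (- y) - 1 + y) / t ^ 3"
      using t by (simp add: Gq_def G_def y_def field_simps power3_eq_cube power2_eq_square)
    have u2: "(u t l)\<^sup>2 \<le> D\<^sup>2"
      using u_nonneg[of t l] u_le[of t l] t l by (intro power_mono) (auto simp: D_def)
    have "0 \<le> exp (- y) - 1 + y" using exp_ge_add_one_self[of "- y"] by simp
    then have "norm (Gq t l - G t l) = (exp (- y) - 1 + y) / t ^ 3" using t eq by simp
    also have "\<dots> \<le> (y\<^sup>2 / 2) / t ^ 3" using exp_minus_quadratic_bound[OF y] t by (intro divide_right_mono) auto
    also have "\<dots> = t * (u t l)\<^sup>2 / 2" using t by (simp add: y_def power2_eq_square power3_eq_cube)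
    also have "\<dots> \<le> t * D\<^sup>2 / 2" using u2 t by simp
    finally show ?thesis .
  qed
  then show "\<forall>\<^sub>F t in at_right 0. norm (Gq t l - G t l) \<le> t * D\<^sup>2 / 2"
    by (auto simp: eventually_at_filter)
qed

lemma Gq_above:
  assumes "z0 < l" shows "((\<lambda>t. Gq t l) \<longlongrightarrow> g l) (at_right 0)"
  using tendsto_add[OF Gq_minus_G deriv_above[OF assms], of l] assms z0 by (simp add: G_def)

text \<open>The divisor t^3 is the start t^2, which linearises, times the time t, which
  differentiates. The factor (1-s)^2 turns expectations into second differences and thereby keeps
  the mass bounded.\<close>

definition rho_t :: "real \<Rightarrow> real measure" where
  "rho_t t = density (N t (t\<^sup>2)) (\<lambda>s. ennreal ((1 - s)\<^sup>2 / t ^ 3))"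

lemma rho_t_integral:
  assumes t: "0 < t" and f: "f \<in> borel_measurable borel"
  shows "(\<integral>s. f s \<partial>rho_t t) = (\<integral>s. (1 - s)\<^sup>2 * f s \<partial>N t (t\<^sup>2)) / t ^ 3"
proof -
  have sN: "sets (N t (t\<^sup>2)) = sets borel" using N[of t "t\<^sup>2"] t by (simp add: unit_measure_def)
  have "(\<integral>s. f s \<partial>rho_t t) = (\<integral>s. ((1 - s)\<^sup>2 / t ^ 3) *\<^sub>R f s \<partial>N t (t\<^sup>2))"
    unfolding rho_t_def using t f by (intro integral_density) (auto simp: measurable_cong_sets[OF sN refl])
  also have "\<dots> = (\<integral>s. ((1 - s)\<^sup>2 * f s) / t ^ 3 \<partial>N t (t\<^sup>2))" by simp
  finally show ?thesis by simp
qed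

lemma rho_t_unit:
  assumes t: "0 < t" shows "unit_measure (rho_t t)"
proof -
  have u: "unit_measure (N t (t\<^sup>2))" using N t by simp
  interpret finite_measure "N t (t\<^sup>2)" using u by (simp add: unit_measure_def)
  have sN: "sets (N t (t\<^sup>2)) = sets borel" using u by (simp add: unit_measure_def)
  have meas: "(\<lambda>s. (1 - s)\<^sup>2 / t ^ 3) \<in> borel_measurable (N t (t\<^sup>2))"
    by (simp add: measurable_cong_sets[OF sN refl])
  have "integrable (N t (t\<^sup>2)) (\<lambda>s. (1 - s)\<^sup>2 / t ^ 3)"
  proof (rule unit_measure_integrable(1)[OF u, where B="1 / t ^ 3"])
    fix s :: real assume "s \<in> {0..1}"
    then show "\<bar>(1 - s)\<^sup>2 / t ^ 3\<bar> \<le> 1 / t ^ 3"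
      using t by (simp add: abs_square_le_1 divide_right_mono)
  qed simp
  then have "(\<integral>\<^sup>+s. ennreal ((1 - s)\<^sup>2 / t ^ 3) \<partial>N t (t\<^sup>2)) \<noteq> \<infinity>"
    using t by (subst nn_integral_eq_integral) auto
  then have "finite_measure (rho_t t)"
    unfolding rho_t_def using meas by (intro finite_measure_densityI) auto
  moreover have "AE s in rho_t t. s \<in> {0..1}"
    unfolding rho_t_def using u meas by (subst AE_density) (auto simp: unit_measure_def)
  moreover have "sets (rho_t t) = sets borel" using sN by (simp add: rho_t_def)
  ultimately show ?thesis by (simp add: unit_measure_def)
qed

text \<open>The term c r is of order t^2, but it is linear in r and cancels in the three
  combinations below, leaving exactly the order t^3.\<close>

lemma expand_powr:
  assumes t: "0 < t" and r: "0 \<le> r"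
  shows "1 - (\<integral>s. s powr r \<partial>N t (t\<^sup>2)) = t\<^sup>2 * (c * r - t * Gq t (c * r))"
  using t r by (simp add: lap Gq_def field_simps)

text \<open>The 1 in (1-s)^2 = 1 - 2 s + s^2 is the total mass, not the expectation of
  \<open>s powr 0\<close>. Hence no \<open>Gq t 0\<close> occurs, and only the levels c and 2 c,
  both above z0, are involved.\<close>

lemma rho_t_mass:
  assumes t: "0 < t" shows "measure (rho_t t) UNIV = Gq t (2 * c) - 2 * Gq t c"
proof -
  have u: "unit_measure (N t (t\<^sup>2))" using N t by simp
  interpret finite_measure "N t (t\<^sup>2)" using u by (simp add: unit_measure_def)
  have sp: "space (N t (t\<^sup>2)) = UNIV" "space (rho_t t) = UNIV"
    using u rho_t_unit[OF t] sets_eq_imp_space_eq[of _ borel] unfolding unit_measure_def by (metis space_borel)+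
  have i: "integrable (N t (t\<^sup>2)) (\<lambda>s. s powr 1)" "integrable (N t (t\<^sup>2)) (\<lambda>s. s powr 2)"
    using t by (intro integrable_powr; simp)+
  have "measure (rho_t t) UNIV = (\<integral>s. 1 \<partial>rho_t t)" using sp by simp
  also have "\<dots> = (\<integral>s. (1 - s)\<^sup>2 * 1 \<partial>N t (t\<^sup>2)) / t ^ 3" by (rule rho_t_integral[OF t]) simp
  also have "(\<integral>s. (1 - s)\<^sup>2 * 1 \<partial>N t (t\<^sup>2)) = (\<integral>s. 1 - 2 * s powr 1 + s powr 2 \<partial>N t (t\<^sup>2))"
  proof (rule integral_cong_AE)
    show "AE s in N t (t\<^sup>2). (1 - s)\<^sup>2 * 1 = 1 - 2 * s powr 1 + s powr 2"
      using AE_unit[of t "t\<^sup>2"] t by (auto elim!: eventually_mono simp: power2_eq_square algebra_simps)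
  qed (use u in \<open>auto simp: unit_measure_def cong: measurable_cong_sets\<close>)
  also have "\<dots> = 2 * (1 - (\<integral>s. s powr 1 \<partial>N t (t\<^sup>2))) - (1 - (\<integral>s. s powr 2 \<partial>N t (t\<^sup>2)))"
    using i mass[of t "t\<^sup>2"] t sp by (simp del: powr_one powr_numeral)
  also have "\<dots> = t ^ 3 * (Gq t (2 * c) - 2 * Gq t c)"
    unfolding expand_powr[OF t zero_le_one] expand_powr[OF t zero_le_numeral]
    by (simp add: algebra_simps power2_eq_square power3_eq_cube)
  finally show ?thesis using t by simp
qed

text \<open>A second difference of \<open>Gq\<close> with step c. For j >= 1 all three levels lie
  above z0, where the limit is known.\<close>

lemma rho_t_moments:
  assumes t: "0 < t" and j: "1 \<le> j"
  shows "(\<integral>s. s ^ j \<partial>rho_t t) = Gq t (c * real j) - 2 * Gq t (c * (real j + 1)) + Gq t (c * (real j + 2))"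
proof -
  have u: "unit_measure (N t (t\<^sup>2))" using N t by simp
  have i: "integrable (N t (t\<^sup>2)) (\<lambda>s. s powr (real j))" "integrable (N t (t\<^sup>2)) (\<lambda>s. s powr (real j + 1))"
    "integrable (N t (t\<^sup>2)) (\<lambda>s. s powr (real j + 2))"
    using t by (intro integrable_powr; simp)+
  have "(\<integral>s. s ^ j \<partial>rho_t t) = (\<integral>s. (1 - s)\<^sup>2 * s ^ j \<partial>N t (t\<^sup>2)) / t ^ 3" by (rule rho_t_integral[OF t]) simp
  also have "(\<integral>s. (1 - s)\<^sup>2 * s ^ j \<partial>N t (t\<^sup>2))
      = (\<integral>s. s powr real j - 2 * s powr (real j + 1) + s powr (real j + 2) \<partial>N t (t\<^sup>2))"
  proof (rule integral_cong_AE)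
    show "AE s in N t (t\<^sup>2). (1 - s)\<^sup>2 * s ^ j = s powr real j - 2 * s powr (real j + 1) + s powr (real j + 2)"
    proof (rule AE_mp[OF AE_unit], goal_cases)
      case 3
      show ?case
      proof (rule AE_I2, rule impI)
      fix s :: real assume elim: "s \<in> {0..1}"
      show "(1 - s)\<^sup>2 * s ^ j = s powr real j - 2 * s powr (real j + 1) + s powr (real j + 2)"
      proof (cases "s = 0")
        case True then show ?thesis using j by simp
      next
        case False
        then have "0 < s" using elim by auto
        then show ?thesis by (simp add: powr_add powr_realpow power2_eq_square algebra_simps)
      qed
      qed
    qed (use t in auto)
  qed (use u in \<open>auto simp: unit_measure_def cong: measurable_cong_sets\<close>)
  also have "\<dots> = - (1 - (\<integral>s. s powr real j \<partial>N t (t\<^sup>2))) + 2 * (1 - (\<integral>s. s powr (real j + 1) \<partial>N t (t\<^sup>2)))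
      - (1 - (\<integral>s. s powr (real j + 2) \<partial>N t (t\<^sup>2)))"
    using i by simp
  also have "\<dots> = t ^ 3 * (Gq t (c * real j) - 2 * Gq t (c * (real j + 1)) + Gq t (c * (real j + 2)))"
    using expand_powr[OF t, of "real j"] expand_powr[OF t, of "real j + 1"] expand_powr[OF t, of "real j + 2"]
    by (simp add: algebra_simps power2_eq_square power3_eq_cube)
  finally show ?thesis using t by simp
qed

text \<open>A Levy-Khintchine formula that is exact before the limit: affine interpolation of
  \<open>Gq t\<close> at c and 2 c, with the kernel integral as remainder.\<close>

lemma rho_t_kernel:
  assumes t: "0 < t" and r: "0 \<le> r"
  shows "Gq t (c * r) = Gq t c * (2 - r) + Gq t (2 * c) * (r - 1) + (\<integral>s. lk_kernel r s \<partial>rho_t t)"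
proof -
  have u: "unit_measure (N t (t\<^sup>2))" using N t by simp
  interpret finite_measure "N t (t\<^sup>2)" using u by (simp add: unit_measure_def)
  have sp: "space (N t (t\<^sup>2)) = UNIV" "space (rho_t t) = UNIV"
    using u rho_t_unit[OF t] sets_eq_imp_space_eq[of _ borel] unfolding unit_measure_def by (metis space_borel)+
  have i: "integrable (N t (t\<^sup>2)) (\<lambda>s. s powr r)" "integrable (N t (t\<^sup>2)) (\<lambda>s. s powr 1)" "integrable (N t (t\<^sup>2)) (\<lambda>s. s powr 2)"
    using t r by (intro integrable_powr; simp)+
  have "(\<integral>s. lk_kernel r s \<partial>rho_t t) = (\<integral>s. (1 - s)\<^sup>2 * lk_kernel r s \<partial>N t (t\<^sup>2)) / t ^ 3"
    by (rule rho_t_integral[OF t lk_kernel_measurable])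
  also have "(\<integral>s. (1 - s)\<^sup>2 * lk_kernel r s \<partial>N t (t\<^sup>2))
      = (\<integral>s. s powr r + (r - 2) * s powr 1 - (r - 1) * s powr 2 \<partial>N t (t\<^sup>2))"
    unfolding lk_kernel_times_square
  proof (rule integral_cong_AE)
    show "AE s in N t (t\<^sup>2). s powr r - 1 + r * (1 - s) - (r - 1) * (1 - s)\<^sup>2
        = s powr r + (r - 2) * s powr 1 - (r - 1) * s powr 2"
      using AE_unit[of t "t\<^sup>2"] t by (auto elim!: eventually_mono simp: power2_eq_square algebra_simps)
  qed (use u in \<open>auto simp: unit_measure_def cong: measurable_cong_sets\<close>)
  also have "\<dots> = - (1 - (\<integral>s. s powr r \<partial>N t (t\<^sup>2))) - (r - 2) * (1 - (\<integral>s. s powr 1 \<partial>N t (t\<^sup>2)))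
       + (r - 1) * (1 - (\<integral>s. s powr 2 \<partial>N t (t\<^sup>2)))"
    using i by (simp del: powr_one powr_numeral add: algebra_simps)
  also have "\<dots> = t ^ 3 * (Gq t (c * r) - Gq t c * (2 - r) - Gq t (2 * c) * (r - 1))"
    unfolding expand_powr[OF t zero_le_one] expand_powr[OF t zero_le_numeral] expand_powr[OF t r]
    by (simp add: algebra_simps power2_eq_square power3_eq_cube)
  finally show ?thesis using t by simp
qed

text \<open>A subsequence is used only to produce a measure with the right moments;
  \<open>moment_convergence\<close> then gives the limit along all t. It needs r > 0, so that the
  kernel is continuous and vanishes at s = 0.\<close>

lemma limit_measure:
  "\<exists>\<rho>. lk_data c \<rho> \<and>
    (\<forall>l>0. ((\<lambda>t. G t l) \<longlongrightarrow> lk_data.Psi (g c) (g (2 * c)) c \<rho> l) (at_right 0))"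
proof -
  define d where "d j = g (c * real j) - 2 * g (c * (real j + 1)) + g (c * (real j + 2))" for j :: nat
  have cj: "z0 < c * real j" if "1 \<le> j" for j
  proof -
    have "c * 1 \<le> c * real j" using that c by (intro mult_left_mono) auto
    then show ?thesis using c_gt by simp
  qed
  have mom: "((\<lambda>t. \<integral>s. s ^ j \<partial>rho_t t) \<longlongrightarrow> d j) (at_right 0)" if j: "1 \<le> j" for j
  proof (rule Lim_transform_eventually)
    show "((\<lambda>t. Gq t (c * real j) - 2 * Gq t (c * (real j + 1)) + Gq t (c * (real j + 2))) \<longlongrightarrow> d j) (at_right 0)"
      unfolding d_def using cj[OF j] cj[of "j + 1"] cj[of "j + 2"] j
      by (intro tendsto_intros Gq_above) (auto simp: add.commute)
    show "\<forall>\<^sub>F t in at_right 0. Gq t (c * real j) - 2 * Gq t (c * (real j + 1)) + Gq t (c * (real j + 2)) = (\<integral>s. s ^ j \<partial>rho_t t)"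
      using rho_t_moments[OF _ j] by (auto simp: eventually_at_filter)
  qed
  have masslim: "((\<lambda>t. measure (rho_t t) UNIV) \<longlongrightarrow> g (2 * c) - 2 * g c) (at_right 0)"
  proof (rule Lim_transform_eventually)
    show "((\<lambda>t. Gq t (2 * c) - 2 * Gq t c) \<longlongrightarrow> g (2 * c) - 2 * g c) (at_right 0)"
      using c c_gt by (intro tendsto_intros Gq_above) auto
    show "\<forall>\<^sub>F t in at_right 0. Gq t (2 * c) - 2 * Gq t c = measure (rho_t t) UNIV"
      using rho_t_mass by (auto simp: eventually_at_filter)
  qed
  define C where "C = g (2 * c) - 2 * g c + 1"
  have evC: "\<forall>\<^sub>F t in at_right 0. unit_measure (rho_t t) \<and> measure (rho_t t) UNIV \<le> C"
  proof -
    have "\<forall>\<^sub>F t in at_right 0. measure (rho_t t) UNIV < C"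
      using masslim by (rule order_tendstoD) (simp add: C_def)
    moreover have "\<forall>\<^sub>F t in at_right 0. unit_measure (rho_t t)"
      using rho_t_unit by (auto simp: eventually_at_filter)
    ultimately show ?thesis by eventually_elim simp
  qed
  then obtain b where b: "0 < b" "\<And>t. 0 < t \<Longrightarrow> t < b \<Longrightarrow> unit_measure (rho_t t) \<and> measure (rho_t t) UNIV \<le> C"
    by (auto simp: eventually_at_right_field)
  define tk where "tk k = b / (real k + 2)" for k :: nat
  have tk: "0 < tk k" "tk k < b" for k
    using b(1) divide_strict_left_mono[of 1 "real k + 2" b] by (auto simp: tk_def)
  have tk0: "filterlim tk (at_right 0) sequentially"
    unfolding tk_def using b(1) by real_asymp
  have "\<exists>N. unit_measure N \<and> (\<forall>j\<ge>1. (\<integral>s. s ^ j \<partial>N) = d j)"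
    by (rule moment_limit_exists[of "\<lambda>k. rho_t (tk k)" C])
       (use b(2)[OF tk] filterlim_compose[OF mom tk0] in auto)
  then obtain \<nu> where \<nu>: "unit_measure \<nu>" "\<And>j. 1 \<le> j \<Longrightarrow> (\<integral>s. s ^ j \<partial>\<nu>) = d j" by auto
  interpret \<nu>: finite_measure \<nu> using \<nu>(1) by (simp add: unit_measure_def)
  have s\<nu>: "sets \<nu> = sets borel" using \<nu>(1) by (simp add: unit_measure_def)
  \<comment> \<open>Mass escaping to oo may collect at s = 0; deleting it leaves the moments of
    order j >= 1 unchanged.\<close>
  define \<rho> where "\<rho> = density \<nu> (\<lambda>s. ennreal (indicator {0<..} s))"
  have ind: "(\<lambda>s. indicator {0<..} s :: real) \<in> borel_measurable \<nu>"
    by (simp add: measurable_cong_sets[OF s\<nu> refl])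
  have "finite_measure \<rho>"
    unfolding \<rho>_def using ind s\<nu> by (intro finite_measure_densityI) (auto simp: ennreal_indicator \<nu>.emeasure_eq_measure)
  then have \<rho>u: "unit_measure \<rho>"
    using \<nu>(1) ind unfolding unit_measure_def \<rho>_def by (auto simp: AE_density)
  have \<rho>pos: "AE s in \<rho>. 0 < s"
    using ind unfolding \<rho>_def by (subst AE_density) (auto simp: indicator_def)
  have \<rho>mom: "(\<integral>s. s ^ j \<partial>\<rho>) = d j" if j: "1 \<le> j" for j
  proof -
    have "(\<integral>s. s ^ j \<partial>\<rho>) = (\<integral>s. indicator {0<..} s *\<^sub>R s ^ j \<partial>\<nu>)"
      unfolding \<rho>_def using ind by (intro integral_density) (auto simp: measurable_cong_sets[OF s\<nu> refl])
    also have "\<dots> = (\<integral>s. s ^ j \<partial>\<nu>)"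
    proof (rule integral_cong_AE)
      have "AE s in \<nu>. s \<in> {0..1}" using \<nu>(1) by (simp add: unit_measure_def del: atLeastAtMost_iff)
      then show "AE s in \<nu>. indicator {0<..} s *\<^sub>R s ^ j = s ^ j"
        by eventually_elim (use j in \<open>auto simp: indicator_def\<close>)
    qed (use ind in \<open>auto simp: measurable_cong_sets[OF s\<nu> refl]\<close>)
    finally show ?thesis using \<nu>(2)[OF j] by simp
  qed
  interpret lk: lk_data "g c" "g (2 * c)" c \<rho> by unfold_locales (fact c \<rho>u \<rho>pos)+
  have Psi: "((\<lambda>t. G t l) \<longlongrightarrow> lk.Psi l) (at_right 0)" if l: "0 < l" for l
  proof -
    define r where "r = l / c"
    have r: "0 < r" and lr: "l = c * r" using l c by (auto simp: r_def)
    have "((\<lambda>t. \<integral>s. lk_kernel r s \<partial>rho_t t) \<longlongrightarrow> (\<integral>s. lk_kernel r s \<partial>\<rho>)) (at_right 0)"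
      by (rule moment_convergence[OF evC \<rho>u _ lk_kernel_continuous[OF r] lk_kernel_vanish[OF r] lk_kernel_measurable])
         (simp add: \<rho>mom mom)
    then have "((\<lambda>t. Gq t c * (2 - r) + Gq t (2 * c) * (r - 1) + (\<integral>s. lk_kernel r s \<partial>rho_t t)) \<longlongrightarrow> lk.Psi l) (at_right 0)"
      unfolding lk.Psi_def r_def[symmetric] using c c_gt by (intro tendsto_intros Gq_above) auto
    then have "((\<lambda>t. Gq t l) \<longlongrightarrow> lk.Psi l) (at_right 0)"
      by (rule Lim_transform_eventually)
         (use rho_t_kernel r in \<open>auto simp: eventually_at_filter lr\<close>)
    from tendsto_diff[OF this Gq_minus_G[of l]] l show ?thesis by simp
  qed
  show ?thesis using lk.lk_data_axioms Psi by blast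
qed

end

lemma continuous_on_Ici_at_right:
  fixes f :: "real \<Rightarrow> real"
  shows "continuous_on {a..} f \<Longrightarrow> (f \<longlongrightarrow> f a) (at_right a)"
  unfolding continuous_on_def by (metis at_within_Ici_at_right atLeast_iff order_refl)

section \<open>Regularity of the flow in time, below z0\<close>

context laplace_flow begin

text \<open>\<open>G s\<close> is convex and vanishes at z0, so its slopes to the left of z0 are at
  most the slope from z0 to c, which is bounded because \<open>G s c\<close> tends to
  \<open>g c\<close>.\<close>

lemma increment_bound:
  "\<exists>K \<delta>. 0 < K \<and> 0 < \<delta> \<and> (\<forall>s l. 0 < s \<longrightarrow> s < \<delta> \<longrightarrow> 0 \<le> l \<longrightarrow> l \<le> z0 \<longrightarrow> - K \<le> G s l)
    \<and> (\<forall>s. 0 < s \<longrightarrow> s < \<delta> \<longrightarrow> G s c \<le> K)"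
proof -
  define C where "C = \<bar>g c\<bar> + 1"
  have "\<forall>\<^sub>F t in at_right 0. G t c < C"
    using deriv_above[OF c_gt, folded G_def] by (rule order_tendstoD) (simp add: C_def)
  then obtain \<delta> where \<delta>: "0 < \<delta>" "\<And>t. 0 < t \<Longrightarrow> t < \<delta> \<Longrightarrow> G t c < C"
    by (auto simp: eventually_at_right_field)
  define K where "K = C + z0 * (C / (c - z0))"
  have K: "C \<le> K" "z0 * (C / (c - z0)) \<le> K" "0 < K"
  proof -
    have "0 < C" by (simp add: C_def)
    then have "0 \<le> z0 * (C / (c - z0))" using z0 c_gt by (intro mult_nonneg_nonneg divide_nonneg_nonneg) auto
    then show "C \<le> K" "z0 * (C / (c - z0)) \<le> K" "0 < K" using \<open>0 < C\<close> by (auto simp: K_def)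
  qed
  have low: "- K \<le> G s l" if s: "0 < s" "s < \<delta>" and l: "0 \<le> l" "l \<le> z0" for s l
  proof (cases "l = z0")
    case True
    then show ?thesis using u_z0[of s] s K by (simp add: G_def)
  next
    case False
    then have lz: "l < z0" using l by simp
    have "(G s z0 - G s l) / (z0 - l) \<le> (G s c - G s z0) / (c - z0)"
      using l z0 c_gt c by (intro convex_on_adjacent_slopes[OF G_convex[OF s(1)] _ _ lz]) auto
    also have "G s z0 = 0" using u_z0[of s] s by (simp add: G_def)
    finally have "- G s l / (z0 - l) \<le> G s c / (c - z0)" by simp
    also have "\<dots> \<le> C / (c - z0)" using \<delta>(2)[OF s] c_gt by (intro divide_right_mono) auto
    finally have "- G s l \<le> C / (c - z0) * (z0 - l)"
      using lz by (simp only: pos_divide_le_eq diff_gt_0_iff_gt)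
    also have "\<dots> \<le> C / (c - z0) * z0" using l c_gt by (intro mult_left_mono) (auto simp: C_def)
    finally show ?thesis using K by (simp add: mult.commute)
  qed
  have up: "G s c \<le> K" if "0 < s" "s < \<delta>" for s using \<delta>(2)[OF that] K(1) by simp
  show ?thesis using K(3) \<delta>(1) low up by blast
qed

text \<open>By the semigroup property the increment is -s \<open>G s w\<close> with w = u_t(l) in
  [0, z0], where \<open>increment_bound\<close> holds uniformly.\<close>

lemma time_lipschitz:
  "\<exists>K \<delta>. 0 < K \<and> 0 < \<delta> \<and>
    (\<forall>t s l. 0 \<le> t \<longrightarrow> 0 \<le> s \<longrightarrow> s < \<delta> \<longrightarrow> 0 \<le> l \<longrightarrow> l \<le> z0 \<longrightarrow> \<bar>u (t + s) l - u t l\<bar> \<le> K * s)"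
proof -
  obtain K \<delta> where K: "0 < K" "0 < \<delta>"
    and low: "\<And>s l. 0 < s \<Longrightarrow> s < \<delta> \<Longrightarrow> 0 \<le> l \<Longrightarrow> l \<le> z0 \<Longrightarrow> - K \<le> G s l"
    using increment_bound by blast
  have "\<bar>u (t + s) l - u t l\<bar> \<le> K * s" if "0 \<le> t" "0 \<le> s" "s < \<delta>" "0 \<le> l" "l \<le> z0" for t s l
  proof (cases "s = 0")
    case False
    then have s: "0 < s" using that by simp
    define w where "w = u t l"
    have w: "0 \<le> w" "w \<le> z0" using below[of t l] that u_nonneg[of t l] by (auto simp: w_def)
    have us: "u (t + s) l = u s w" using semigroup[of t s l] that by (simp add: w_def add.commute)
    have "w \<le> u s w" using below[of s w] w s by simp
    moreover have "- K * s \<le> w - u s w" using low[OF s _ w] that(3) s by (simp add: G_def field_simps)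
    ultimately show ?thesis unfolding us w_def[symmetric] by simp
  qed simp
  then show ?thesis using K by blast
qed

lemma u_continuous_time:
  assumes l: "0 \<le> l" "l \<le> z0" shows "continuous_on {0..} (\<lambda>t. u t l)"
proof -
  obtain K \<delta> where K: "0 < K" "0 < \<delta>"
    and lip: "\<And>t s l. 0 \<le> t \<Longrightarrow> 0 \<le> s \<Longrightarrow> s < \<delta> \<Longrightarrow> 0 \<le> l \<Longrightarrow> l \<le> z0 \<Longrightarrow> \<bar>u (t + s) l - u t l\<bar> \<le> K * s"
    using time_lipschitz by blast
  have lip': "\<bar>u t l - u t' l\<bar> \<le> K * \<bar>t - t'\<bar>" if "0 \<le> t" "0 \<le> t'" "\<bar>t - t'\<bar> < \<delta>" for t t'
  proof (cases "t \<le> t'")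
    case True then show ?thesis using lip[of t "t' - t" l] that l by (simp add: abs_minus_commute)
  next
    case False then show ?thesis using lip[of t' "t - t'" l] that l by simp
  qed
  show ?thesis
    unfolding continuous_on_iff
  proof (intro ballI allI impI)
    fix t e :: real assume t: "t \<in> {0..}" and e: "0 < e"
    define d where "d = min \<delta> (e / K)"
    have "dist (u t' l) (u t l) < e" if "t' \<in> {0..}" "dist t' t < d" for t'
    proof -
      have "\<bar>u t' l - u t l\<bar> \<le> K * \<bar>t' - t\<bar>" using lip'[of t' t] that t by (simp add: d_def dist_real_def)
      also have "\<dots> < K * (e / K)" using that K by (intro mult_strict_left_mono) (auto simp: d_def dist_real_def)
      finally show ?thesis using K by (simp add: dist_real_def)
    qed
    moreover have "0 < d" using K e by (simp add: d_def)
    ultimately show "\<exists>d>0. \<forall>t'\<in>{0..}. dist t' t < d \<longrightarrow> dist (u t' l) (u t l) < e" by blast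
  qed
qed

text \<open>\<open>0 powr 0 = 0\<close> makes \<open>s powr r\<close> continuous in r down to r = 0
  even at s = 0: the state oo contributes 0 at every level.\<close>

lemma u_continuous_at_0:
  assumes t: "0 \<le> t" and S: "\<And>n. 0 \<le> S n" "S \<longlonglongrightarrow> 0"
  shows "(\<lambda>n. u t (S n)) \<longlonglongrightarrow> u t 0"
proof -
  interpret finite_measure "N t 1" using N[OF t, of 1] by (simp add: unit_measure_def)
  have sN: "sets (N t 1) = sets borel" using N[OF t, of 1] by (simp add: unit_measure_def)
  have "(\<lambda>n. \<integral>s. s powr (S n / c) \<partial>N t 1) \<longlonglongrightarrow> (\<integral>s. s powr (0 / c) \<partial>N t 1)"
  proof (rule integral_dominated_convergence[where w="\<lambda>_. 1"])
    show "AE s in N t 1. (\<lambda>n. s powr (S n / c)) \<longlonglongrightarrow> s powr (0 / c)"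
    proof (rule AE_I2)
      fix s :: real
      show "(\<lambda>n. s powr (S n / c)) \<longlonglongrightarrow> s powr (0 / c)"
      proof (cases "s = 0")
        case False
        then show ?thesis using S(2) c by (intro tendsto_powr tendsto_divide tendsto_const) auto
      qed simp
    qed
    show "AE s in N t 1. norm (s powr (S n / c)) \<le> 1" for n
      using AE_unit[OF t, of 1] by (rule AE_mp[OF _ AE_I2]) (use S(1)[of n] c in \<open>auto intro: powr_le1\<close>)
  qed (auto simp: measurable_cong_sets[OF sN refl])
  then have "(\<lambda>n. exp (- u t (S n))) \<longlonglongrightarrow> exp (- u t 0)"
    unfolding lap'[OF t zero_le_one S(1)] lap'[OF t zero_le_one order_refl] by simp
  then have "(\<lambda>n. ln (exp (- u t (S n)))) \<longlonglongrightarrow> ln (exp (- u t 0))"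
    by (rule tendsto_ln) simp
  from tendsto_minus[OF this] show ?thesis by simp
qed

end

text \<open>Convergence is required for l > 0 only; the level 0 is handled by continuity in
  \<open>Psi_0_nonpos\<close> and \<open>ode_zero\<close>.\<close>

locale limit_flow = laplace_flow + lk_data "g c" "g (2 * c)" c \<rho> for \<rho> +
  assumes G_tendsto: "\<And>l. 0 < l \<Longrightarrow> ((\<lambda>t. G t l) \<longlongrightarrow> Psi l) (at_right 0)"
begin

section \<open>Identification of Psi above z0 and its sign below\<close>

lemma Psi_above: "z0 < l \<Longrightarrow> Psi l = g l"
  using tendsto_unique[OF _ G_tendsto[of l] deriv_above[of l, folded G_def]] z0 by simp

lemma Psi_eq_g: "z0 \<le> l \<Longrightarrow> Psi l = g l"
proof (cases "l = z0")
  case True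
  have "continuous_on {z0..} Psi" using continuous_on_subset[OF Psi_continuous] z0 by simp
  then have "(Psi \<longlongrightarrow> Psi z0) (at_right z0)"
    by (rule continuous_on_Ici_at_right)
  moreover have "(g \<longlongrightarrow> g z0) (at_right z0)"
    using g_cont by (rule continuous_on_Ici_at_right)
  then have "(Psi \<longlongrightarrow> g z0) (at_right z0)"
    by (rule Lim_transform_eventually) (auto simp: eventually_at_filter Psi_above)
  ultimately show ?thesis using True tendsto_unique[of "at_right z0"] by auto
qed (simp add: Psi_above)

text \<open>The chord of the convex \<open>G t\<close> from 0 to d, where \<open>G t 0\<close> is
  nonpositive. The chord is taken before the limit because the sign of \<open>Psi 0\<close> is only
  deduced from this bound.\<close>

lemma Psi_upper:
  assumes "0 < l" "z0 < d" "l \<le> d" shows "Psi l \<le> l / d * g d"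
proof (rule tendsto_le[OF _ _ G_tendsto[OF assms(1)]])
  show "((\<lambda>t. l / d * G t d) \<longlongrightarrow> l / d * g d) (at_right 0)"
    using deriv_above[OF assms(2), folded G_def] by (intro tendsto_intros)
  have "G t l \<le> l / d * G t d" if t: "0 < t" for t
  proof -
    have "G t ((1 - l / d) *\<^sub>R 0 + (l / d) *\<^sub>R d) \<le> (1 - l / d) * G t 0 + (l / d) * G t d"
      using assms z0 by (intro convex_onD[OF G_convex[OF t]]) auto
    moreover have "(1 - l / d) *\<^sub>R 0 + (l / d) *\<^sub>R d = l" using assms z0 by simp
    moreover have "(1 - l / d) * G t 0 \<le> 0"
      using assms z0 t u_nonneg[of t 0] by (intro mult_nonneg_nonpos) (auto simp: G_def)
    ultimately show ?thesis by simp
  qed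
  then show "\<forall>\<^sub>F t in at_right 0. G t l \<le> l / d * G t d" by (auto simp: eventually_at_filter)
qed simp

text \<open>Let l tend to 0 in \<open>Psi_upper\<close> with d = c. This will be the nonnegativity
  of p.\<close>

lemma Psi_0_nonpos: "Psi 0 \<le> 0"
proof -
  have "(Psi \<longlongrightarrow> Psi 0) (at_right 0)"
    using Psi_continuous by (rule continuous_on_Ici_at_right)
  moreover have "((\<lambda>l. l / c * g c) \<longlongrightarrow> 0 / c * g c) (at_right 0)"
    using c by (intro tendsto_intros) auto
  moreover have "\<forall>\<^sub>F l in at_right 0. Psi l \<le> l / c * g c"
    using Psi_upper[OF _ c_gt] c by (auto simp: eventually_at_right_field intro!: exI[of _ c])
  ultimately have "Psi 0 \<le> 0 / c * g c" by (intro tendsto_le[of "at_right 0"]) auto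
  then show ?thesis by simp
qed

text \<open>Let d decrease to z0 in \<open>Psi_upper\<close> and use
  \<open>g z0 = 0\<close>.\<close>

lemma Psi_below: "0 \<le> l \<Longrightarrow> l \<le> z0 \<Longrightarrow> Psi l \<le> 0"
proof (cases "l = 0")
  case False
  assume l: "0 \<le> l" "l \<le> z0"
  have "(g \<longlongrightarrow> 0) (at_right z0)"
    using continuous_on_Ici_at_right[OF g_cont] g_z0 by simp
  then have "((\<lambda>d. l / d * g d) \<longlongrightarrow> l / z0 * 0) (at_right z0)"
    using l False by (intro tendsto_intros) auto
  moreover have "\<forall>\<^sub>F d in at_right z0. Psi l \<le> l / d * g d"
    using Psi_upper[of l] l False by (auto simp: eventually_at_filter)
  ultimately have "Psi l \<le> l / z0 * 0" by (intro tendsto_lowerbound) auto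
  then show ?thesis by simp
qed (simp add: Psi_0_nonpos)

text \<open>The right derivative is the limit of -\<open>G s\<close> at the fixed point u_t(l). In
  the left quotient the argument u_(t-s)(l) moves with s; Lipschitz bounds for \<open>G s\<close> in
  space and for u in time replace it by u_t(l) at a cost of order s.\<close>

lemma ode_interior:
  assumes l: "0 < l" "l \<le> z0" and t: "0 \<le> t"
  shows "((\<lambda>s. u s l) has_real_derivative - Psi (u t l)) (at t within {0..})"
proof -
  have pos: "l \<le> u s l" "u s l \<le> z0" if "0 \<le> s" for s using below[OF that, of l] l by auto
  have lim: "((\<lambda>s. - G s (u t l)) \<longlongrightarrow> - Psi (u t l)) (at_right 0)"
    using G_tendsto[of "u t l"] pos[OF t] l by (intro tendsto_minus) auto
  have right: "((\<lambda>s. (u s l - u t l) / (s - t)) \<longlongrightarrow> - Psi (u t l)) (at t within {t..})"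
    unfolding at_within_Ici_at_right filterlim_at_right_to_0[of _ _ t]
  proof (rule Lim_transform_eventually[OF lim])
    have "- G s (u t l) = (u (s + t) l - u t l) / (s + t - t)" if "0 < s" for s
      using semigroup[of t s l] that t l by (simp add: G_def minus_divide_left)
    then show "\<forall>\<^sub>F s in at_right 0. - G s (u t l) = (u (s + t) l - u t l) / (s + t - t)"
      by (auto simp: eventually_at_filter)
  qed
  have left: "((\<lambda>s. (u s l - u t l) / (s - t)) \<longlongrightarrow> - Psi (u t l)) (at t within {0..t})"
  proof (cases "t = 0")
    case True
    then have "at t within {0..t} = bot" by (simp add: at_within_eq_bot_iff)
    then show ?thesis by simp
  next
    case False
    then have t0: "0 < t" using t by simp
    obtain K \<delta> where K: "0 < K" "0 < \<delta>"
      and low: "\<And>s l. 0 < s \<Longrightarrow> s < \<delta> \<Longrightarrow> 0 \<le> l \<Longrightarrow> l \<le> z0 \<Longrightarrow> - K \<le> G s l"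
      and up: "\<And>s. 0 < s \<Longrightarrow> s < \<delta> \<Longrightarrow> G s c \<le> K"
      using increment_bound by blast
    obtain K' \<delta>' where K': "0 < K'" "0 < \<delta>'"
      and lip: "\<And>t s l. 0 \<le> t \<Longrightarrow> 0 \<le> s \<Longrightarrow> s < \<delta>' \<Longrightarrow> 0 \<le> l \<Longrightarrow> l \<le> z0 \<Longrightarrow> \<bar>u (t + s) l - u t l\<bar> \<le> K' * s"
      using time_lipschitz by blast
    \<comment> \<open>On [l, z0] the slopes of the convex \<open>G s\<close> are at most those
      towards c, bounded by the first term, and at least those from 0, which are no less than -K / l
      because \<open>G s 0\<close> is nonpositive. The flow started at l stays in [l, z0].\<close>
    define L where "L = 2 * K / (c - z0) + K / l"
    have L: "0 < L" "2 * K / (c - z0) \<le> L" "K / l \<le> L" using K c_gt l by (auto simp: L_def add_pos_pos)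
    have spatial: "\<bar>G s y - G s x\<bar> \<le> L * (y - x)" if s: "0 < s" "s < \<delta>" and xy: "l \<le> x" "x \<le> y" "y \<le> z0" for s x y
    proof (cases "x = y")
      case False
      then have xy': "x < y" using xy by simp
      have "(G s y - G s x) / (y - x) \<le> (G s c - G s y) / (c - y)"
        using xy l c_gt c by (intro convex_on_adjacent_slopes[OF G_convex[OF s(1)] _ _ xy']) auto
      also have "\<dots> \<le> 2 * K / (c - y)"
        using up[OF s] low[OF s, of y] xy l c_gt by (intro divide_right_mono) auto
      also have "\<dots> \<le> 2 * K / (c - z0)"
        using xy c_gt K by (intro divide_left_mono mult_pos_pos) auto
      finally have 1: "(G s y - G s x) / (y - x) \<le> L" using L by simp
      have "(G s x - G s 0) / (x - 0) \<le> (G s y - G s x) / (y - x)"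
        using xy l by (intro convex_on_adjacent_slopes[OF G_convex[OF s(1)] _ _ _ xy']) auto
      moreover have "- K / x \<le> (G s x - G s 0) / (x - 0)"
      proof -
        have "G s 0 \<le> 0" using u_nonneg[of s 0] s by (simp add: G_def)
        moreover have "- K \<le> G s x" using low[OF s, of x] xy l by simp
        ultimately have "- K / x \<le> (G s x - G s 0) / x" using xy l by (intro divide_right_mono) auto
        then show ?thesis by simp
      qed
      moreover have "- L \<le> - K / x"
      proof -
        have "K / x \<le> K / l" using xy l K by (intro divide_left_mono mult_pos_pos) auto
        then show ?thesis using L by simp
      qed
      ultimately have 2: "- L \<le> (G s y - G s x) / (y - x)" by linarith
      have "G s y - G s x \<le> L * (y - x)" "- L * (y - x) \<le> G s y - G s x"
        using 1 2 xy' by (simp_all only: pos_divide_le_eq pos_le_divide_eq diff_gt_0_iff_gt)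
      then show ?thesis by (simp add: abs_le_iff)
    qed simp
    have "((\<lambda>s. - G s (u (t - s) l) - (- G s (u t l))) \<longlongrightarrow> 0) (at_right 0)"
    proof (rule Lim_null_comparison)
      show "((\<lambda>s. L * (K' * s)) \<longlongrightarrow> 0) (at_right 0)" by real_asymp
      have "norm (- G s (u (t - s) l) - (- G s (u t l))) \<le> L * (K' * s)"
        if s: "0 < s" "s < min (min \<delta> \<delta>') t" for s
      proof -
        have ut: "u t l = u s (u (t - s) l)" using semigroup[of "t - s" s l] s t l by simp
        have w: "l \<le> u (t - s) l" "u (t - s) l \<le> z0" using pos[of "t - s"] s by auto
        have "u (t - s) l \<le> u t l" unfolding ut using below(1)[of s "u (t - s) l"] w l s by simp
        then have "\<bar>G s (u t l) - G s (u (t - s) l)\<bar> \<le> L * (u t l - u (t - s) l)"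
          using spatial[of s "u (t - s) l" "u t l"] s w pos[OF t] by simp
        also have "\<dots> \<le> L * (K' * s)"
          using lip[of "t - s" s l] s l L by (intro mult_left_mono) auto
        finally show ?thesis by simp
      qed
      then show "\<forall>\<^sub>F s in at_right 0. norm (- G s (u (t - s) l) - (- G s (u t l))) \<le> L * (K' * s)"
        using K K' t0 by (auto simp: eventually_at_right_field intro!: exI[of _ "min (min \<delta> \<delta>') t"])
    qed
    from tendsto_add[OF this lim]
    have lim': "((\<lambda>s. - G s (u (t - s) l)) \<longlongrightarrow> - Psi (u t l)) (at_right 0)" by simp
    show ?thesis
      unfolding at_within_Icc_at_left[OF t0] filterlim_at_left_to_right[of _ _ t] filterlim_at_right_to_0[of _ _ "- t"]
    proof (rule Lim_transform_eventually[OF lim'])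
      have "- G s (u (t - s) l) = (u (- (s + - t)) l - u t l) / (- (s + - t) - t)" if s: "0 < s" "s < t" for s
      proof -
        have ut: "u t l = u s (u (t - s) l)" using semigroup[of "t - s" s l] s t l by simp
        show ?thesis unfolding ut using s by (simp add: G_def field_simps)
      qed
      then show "\<forall>\<^sub>F s in at_right 0. - G s (u (t - s) l) = (u (- (s + - t)) l - u t l) / (- (s + - t) - t)"
        using t0 by (auto simp: eventually_at_right_field intro!: exI[of _ t])
    qed
  qed
  have "{0..} = {0..t} \<union> {t..}" using t by auto
  then show ?thesis
    unfolding has_field_derivative_iff using left right
    by (simp only: at_within_union filterlim_sup)
qed

text \<open>The slope bound K / l of \<open>ode_interior\<close> degenerates at l = 0. Instead, the
  integral equation for starting levels S n > 0 is passed to the limit and then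
  differentiated.\<close>

lemma ode_zero:
  assumes z0p: "0 < z0" and t: "0 \<le> t"
  shows "((\<lambda>s. u s 0) has_real_derivative - Psi (u t 0)) (at t within {0..})"
proof -
  define S where "S n = z0 / (real n + 1)" for n :: nat
  have S: "0 < S n" "S n \<le> z0" for n using z0p divide_left_mono[of 1 "real n + 1" z0] by (auto simp: S_def)
  have S0: "S \<longlonglongrightarrow> 0" unfolding S_def by real_asymp
  have Pc: "continuous_on {0..z0} Psi" by (rule continuous_on_subset[OF Psi_continuous]) auto
  have "bounded (Psi ` {0..z0})" using Pc compact_continuous_image compact_imp_bounded by blast
  then obtain D where "\<forall>y\<in>Psi ` {0..z0}. norm y \<le> D" unfolding bounded_iff by blast
  then have D: "\<bar>Psi l\<bar> \<le> D" if "l \<in> {0..z0}" for l using that by simp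
  have range: "u s l \<in> {0..z0}" if "0 \<le> s" "0 \<le> l" "l \<le> z0" for s l
    using below[of s l] that by auto
  have int_eq: "u T 0 = integral {0..T} (\<lambda>s. - Psi (u s 0))" if T: "0 \<le> T" for T
  proof -
    have hi: "((\<lambda>s. - Psi (u s (S n))) has_integral (u T (S n) - S n)) {0..T}" for n
    proof -
      have "((\<lambda>s. - Psi (u s (S n))) has_integral (u T (S n) - u 0 (S n))) {0..T}"
      proof (rule fundamental_theorem_of_calculus[OF T])
        fix s assume "s \<in> {0..T}"
        then have "((\<lambda>s. u s (S n)) has_real_derivative - Psi (u s (S n))) (at s within {0..T})"
          by (intro DERIV_subset[OF ode_interior[OF S]]) auto
        then show "((\<lambda>s. u s (S n)) has_vector_derivative - Psi (u s (S n))) (at s within {0..T})"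
          by (simp add: has_real_derivative_iff_has_vector_derivative)
      qed
      then show ?thesis using u_0[of "S n"] S[of n] by simp
    qed
    have "(\<lambda>n. integral {0..T} (\<lambda>s. - Psi (u s (S n)))) \<longlonglongrightarrow> integral {0..T} (\<lambda>s. - Psi (u s 0))"
    proof (rule dominated_convergence(2)[where h="\<lambda>_. D"])
      show "(\<lambda>s. - Psi (u s (S n))) integrable_on {0..T}" for n using hi by blast
      show "norm (- Psi (u s (S n))) \<le> D" if "s \<in> {0..T}" for s n
        using D[OF range] that S[of n] by auto
      show "(\<lambda>n. - Psi (u s (S n))) \<longlonglongrightarrow> - Psi (u s 0)" if "s \<in> {0..T}" for s
      proof (intro tendsto_minus continuous_on_tendsto_compose[OF Pc])
        show "(\<lambda>n. u s (S n)) \<longlonglongrightarrow> u s 0" using that S S0 by (intro u_continuous_at_0) (auto intro: less_imp_le)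
        show "u s 0 \<in> {0..z0}" using that z0 by (intro range) auto
        show "\<forall>\<^sub>F n in sequentially. u s (S n) \<in> {0..z0}"
          by (rule always_eventually, rule allI, rule range) (use that S in \<open>auto intro: less_imp_le\<close>)
      qed
    qed auto
    moreover have "(\<lambda>n. integral {0..T} (\<lambda>s. - Psi (u s (S n)))) \<longlonglongrightarrow> u T 0 - 0"
      unfolding integral_unique[OF hi] using S0 S T by (intro tendsto_diff u_continuous_at_0) (auto intro: less_imp_le)
    ultimately show ?thesis using LIMSEQ_unique by fastforce
  qed
  have cont: "continuous_on {0..t + 1} (\<lambda>s. - Psi (u s 0))"
  proof (intro continuous_on_minus continuous_on_compose2[OF Pc])
    show "continuous_on {0..t + 1} (\<lambda>s. u s 0)"
      by (rule continuous_on_subset[OF u_continuous_time]) (use z0 in auto)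
  qed (use range z0 in auto)
  have "((\<lambda>T. integral {0..T} (\<lambda>s. - Psi (u s 0))) has_real_derivative - Psi (u t 0)) (at t within {0..t + 1})"
    using t by (intro integral_has_real_derivative[OF cont]) auto
  then have "((\<lambda>T. u T 0) has_real_derivative - Psi (u t 0)) (at t within {0..t + 1})"
    by (rule has_field_derivative_transform_within[where d=1]) (use t int_eq in auto)
  moreover have "at t within {0..t + 1} = at t within {0..}"
    by (rule at_within_nhd[of t "{..<t + 1}"]) auto
  ultimately show ?thesis by simp
qed

lemma ode_below:
  assumes l: "0 \<le> l" "l \<le> z0" and t: "0 \<le> t"
  shows "((\<lambda>s. u s l) has_real_derivative - Psi (u t l)) (at t within {0..})"
proof (cases "l = 0")
  case False then show ?thesis using ode_interior l t by simp
next
  case True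
  show ?thesis
  proof (cases "z0 = 0")
    case False then show ?thesis using True ode_zero t z0 by simp
  next
    case z: True
    have "((\<lambda>s. 0) has_real_derivative - Psi (u t l)) (at t within {0..})"
      using u_z0[OF t] Psi_eq_g[of z0] g_z0 True z by simp
    then show ?thesis
      by (rule has_field_derivative_transform_within[where d=1]) (use t u_z0 True z in auto)
  qed
qed

end

section \<open>The extinction time transform\<close>

lemma nn_integral_FTC_open:
  fixes f F :: "real \<Rightarrow> real" and a b :: ereal
  assumes ab: "a < b"
    and F: "\<And>x. a < ereal x \<Longrightarrow> ereal x < b \<Longrightarrow> DERIV F x :> f x"
    and f: "\<And>x. a < ereal x \<Longrightarrow> ereal x < b \<Longrightarrow> isCont f x"
    and nonneg: "\<And>x. a < ereal x \<Longrightarrow> ereal x < b \<Longrightarrow> 0 \<le> f x"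
    and A: "((F \<circ> real_of_ereal) \<longlongrightarrow> A) (at_right a)"
    and B: "((F \<circ> real_of_ereal) \<longlongrightarrow> B) (at_left b)"
  shows "(\<integral>\<^sup>+x. ennreal (indicator (einterval a b) x * f x) \<partial>lborel) = ennreal (B - A)"
proof -
  have ae: "AE x in lborel. a < ereal x \<longrightarrow> ereal x < b \<longrightarrow> 0 \<le> f x" using nonneg by simp
  note FTC = interval_integral_FTC_nonneg[OF ab F f ae A B]
  have "(\<integral>\<^sup>+x. ennreal (indicator (einterval a b) x * f x) \<partial>lborel)
      = ennreal (\<integral>x. indicator (einterval a b) x * f x \<partial>lborel)"
    using FTC(1) nonneg unfolding set_integrable_def
    by (intro nn_integral_eq_integral) (auto simp: indicator_def einterval_iff)
  also have "(\<integral>x. indicator (einterval a b) x * f x \<partial>lborel) = B - A"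
    using FTC(2) ab less_imp_le[OF ab] by (simp add: interval_lebesgue_integral_def set_lebesgue_integral_def)
  finally show ?thesis .
qed

locale cumulant_data =
  fixes z0 :: real and g :: "real \<Rightarrow> real"
  assumes g_C1: "\<exists>g'. (\<forall>z\<ge>z0. (g has_real_derivative g' z) (at z within {z0..})) \<and> continuous_on {z0..} g'"
    and g_z0: "g z0 = 0"
    and g_pos: "\<forall>z>z0. 0 < g z"
    and g_int: "\<forall>z>z0. set_integrable lborel {z<..} (\<lambda>w. 1 / g w)"
begin

section \<open>The travel time from oo and its inverse\<close>

definition tau :: "real \<Rightarrow> real" where "tau z = (LBINT w:{z<..}. 1 / g w)"

lemma g_continuous: "continuous_on {z0..} g"
  using g_C1 by (meson DERIV_continuous_on atLeast_iff)

lemma inv_g_continuous: "continuous_on {z0<..} (\<lambda>w. 1 / g w)"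
proof -
  have "continuous_on {z0<..} g" by (rule continuous_on_subset[OF g_continuous]) auto
  then show ?thesis using g_pos by (intro continuous_intros) (auto simp: less_imp_neq[symmetric] dest!: spec)
qed

lemma inv_g_isCont: "z0 < z \<Longrightarrow> isCont (\<lambda>w. 1 / g w) z"
  using inv_g_continuous by (simp add: continuous_on_eq_continuous_at)

lemma tau_nonneg: "z0 < z \<Longrightarrow> 0 \<le> tau z"
  unfolding tau_def set_lebesgue_integral_def using g_pos
  by (intro integral_nonneg_AE AE_I2) (auto simp: indicator_def less_imp_le)

lemma tau_diff:
  assumes "z0 < a" "a \<le> y" shows "tau y = tau a - integral {a..y} (\<lambda>w. 1 / g w)"
proof -
  have ia: "set_integrable lborel {a<..} (\<lambda>w. 1 / g w)" and iy: "set_integrable lborel {y<..} (\<lambda>w. 1 / g w)"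
    using g_int assms by auto
  have i1: "set_integrable lborel {a<..y} (\<lambda>w. 1 / g w)"
    by (rule set_integrable_subset[OF ia]) auto
  have un: "{a<..} = {a<..y} \<union> {y<..}" using assms by auto
  have "tau a = (LBINT w:{a<..y}. 1 / g w) + tau y"
    unfolding tau_def un by (rule set_integral_Un[OF _ i1 iy]) auto
  also have "(LBINT w:{a<..y}. 1 / g w) = (LBINT w:{a..y}. 1 / g w)"
    using interval_integral_Ioc[OF assms(2)] interval_integral_Icc[OF assms(2)] by metis
  also have "\<dots> = integral {a..y} (\<lambda>w. 1 / g w)"
  proof (rule set_borel_integral_eq_integral(2))
    have "continuous_on {a..y} (\<lambda>w. 1 / g w)"
      by (rule continuous_on_subset[OF inv_g_continuous]) (use assms in auto)
    then show "set_integrable lborel {a..y} (\<lambda>w. 1 / g w)"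
      by (rule borel_integrable_atLeastAtMost')
  qed
  finally show ?thesis by simp
qed

lemma tau_deriv:
  assumes z: "z0 < z" shows "(tau has_real_derivative - 1 / g z) (at z)"
proof -
  define a where "a = (z0 + z) / 2"
  have a: "z0 < a" "a < z" using z by (auto simp: a_def)
  have "continuous_on {a..z + 1} (\<lambda>w. 1 / g w)"
    by (rule continuous_on_subset[OF inv_g_continuous]) (use a in auto)
  then have "((\<lambda>y. integral {a..y} (\<lambda>w. 1 / g w)) has_real_derivative 1 / g z) (at z within {a..z + 1})"
    using a by (intro integral_has_real_derivative) auto
  then have "((\<lambda>y. tau a - integral {a..y} (\<lambda>w. 1 / g w)) has_real_derivative 0 - 1 / g z) (at z within {a..z + 1})"
    by (intro DERIV_diff DERIV_const)
  then have "((\<lambda>y. tau a - integral {a..y} (\<lambda>w. 1 / g w)) has_real_derivative - 1 / g z) (at z within {a..z + 1})"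
    by simp
  then have "(tau has_real_derivative - 1 / g z) (at z within {a..z + 1})"
  proof (rule has_field_derivative_transform_within[where d=1])
    show "tau a - integral {a..x} (\<lambda>w. 1 / g w) = tau x" if "x \<in> {a..z + 1}" for x
      using tau_diff[OF a(1), of x] that by simp
  qed (use a in auto)
  then show ?thesis using a by (simp add: at_within_Icc_at)
qed

lemma tau_isCont: "z0 < z \<Longrightarrow> isCont tau z"
  using DERIV_isCont[OF tau_deriv] .

lemma tau_strict: "z0 < a \<Longrightarrow> a < b \<Longrightarrow> tau b < tau a"
proof (rule DERIV_neg_imp_decreasing[where f=tau])
  fix x assume "z0 < a" "a \<le> x"
  then show "\<exists>y. (tau has_real_derivative y) (at x) \<and> y < 0"
    using tau_deriv[of x] g_pos by (intro exI[of _ "- 1 / g x"]) auto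
qed

lemma tau_less_iff: "z0 < a \<Longrightarrow> z0 < b \<Longrightarrow> tau b < tau a \<longleftrightarrow> a < b"
  using tau_strict[of a b] tau_strict[of b a] by (cases a b rule: linorder_cases) auto

lemma tau_pos: "z0 < z \<Longrightarrow> 0 < tau z"
  using tau_strict[of z "z + 1"] tau_nonneg[of "z + 1"] by simp

lemma tau_at_top: "(tau \<longlongrightarrow> 0) at_top"
proof -
  define a where "a = z0 + 1"
  define f where "f x = indicator {a<..} x * (1 / g x)" for x
  have fi: "integrable lborel f"
    using g_int[rule_format, of a] unfolding f_def set_integrable_def by (simp add: a_def)
  have "((\<lambda>t. \<integral>x. indicator {t<..} x * f x \<partial>lborel) \<longlongrightarrow> (\<integral>x. 0 \<partial>(lborel :: real measure))) at_top"
  proof (rule integral_dominated_convergence_at_top[where w="\<lambda>x. \<bar>f x\<bar>"])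
    show "AE x in lborel. ((\<lambda>t. indicator {t<..} x * f x) \<longlongrightarrow> 0) at_top"
    proof (rule AE_I2)
      fix x :: real
      have "\<forall>\<^sub>F t in at_top. indicator {t<..} x * f x = 0"
        using eventually_ge_at_top[of x] by eventually_elim simp
      then show "((\<lambda>t. indicator {t<..} x * f x) \<longlongrightarrow> 0) at_top" by (rule tendsto_eventually)
    qed
    show "integrable lborel (\<lambda>x. \<bar>f x\<bar>)" using fi by simp
    show "(\<lambda>x. indicator {t<..} x * f x) \<in> borel_measurable lborel" for t
      using fi by (intro borel_measurable_times) auto
  qed (auto simp: indicator_def)
  then have "((\<lambda>t. \<integral>x. indicator {t<..} x * f x \<partial>lborel) \<longlongrightarrow> 0) at_top" by simp
  moreover have "\<forall>\<^sub>F t in at_top. (\<integral>x. indicator {t<..} x * f x \<partial>lborel) = tau t"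
    using eventually_ge_at_top[of a]
  proof eventually_elim
    case (elim t)
    show ?case unfolding tau_def set_lebesgue_integral_def f_def
      using elim by (intro Bochner_Integration.integral_cong) (auto simp: indicator_def)
  qed
  ultimately show ?thesis by (rule Lim_transform_eventually)
qed

text \<open>Differentiability of g at its zero z0 gives g(z) <= K (z - z0) nearby, so 1/g diverges
  logarithmically when integrated down to z0. Hence \<open>tau\<close> takes every positive value
  and its inverse is defined for all T > 0.\<close>

lemma tau_at_z0: "filterlim tau at_top (at_right z0)"
proof -
  obtain D where "(g has_real_derivative D) (at z0 within {z0..})" using g_C1 by blast
  then have "((\<lambda>z. g z / (z - z0)) \<longlongrightarrow> D) (at_right z0)"
    by (simp add: has_field_derivative_iff at_within_Ici_at_right g_z0)
  then have "\<forall>\<^sub>F z in at_right z0. g z / (z - z0) < \<bar>D\<bar> + 1"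
    by (rule order_tendstoD) simp
  then obtain b where b: "z0 < b" "\<And>z. z0 < z \<Longrightarrow> z < b \<Longrightarrow> g z / (z - z0) < \<bar>D\<bar> + 1"
    unfolding eventually_at_right_field by blast
  define K where "K = \<bar>D\<bar> + 1"
  have K: "0 < K" by (simp add: K_def)
  define w where "w = (z0 + b) / 2"
  have w: "z0 < w" "w < b" using b(1) by (auto simp: w_def)
  \<comment> \<open>Compares \<open>tau\<close> with the travel time for the linear speed K (z -
    z0); \<open>h\<close> is nonincreasing near z0.\<close>
  define h where "h z = tau z + ln (z - z0) / K" for z
  have le: "h w - ln (z - z0) / K \<le> tau z" if z: "z0 < z" "z < w" for z
  proof -
    have "h w \<le> h z"
    proof (rule DERIV_nonpos_imp_nonincreasing[where f=h])
      fix x assume x: "z \<le> x" "x \<le> w"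
      have x0: "z0 < x" "x < b" using x z w by auto
      have "g x < K * (x - z0)" using b(2)[OF x0] x0 by (simp add: K_def pos_divide_less_eq)
      then have "1 / (K * (x - z0)) \<le> 1 / g x"
        using g_pos x0 K by (intro divide_left_mono mult_pos_pos) auto
      moreover have "(h has_real_derivative - 1 / g x + 1 / (K * (x - z0))) (at x)"
        unfolding h_def using x0 K by (auto intro!: derivative_eq_intros tau_deriv simp: field_simps)
      ultimately show "\<exists>y. (h has_real_derivative y) (at x) \<and> y \<le> 0" by (intro exI conjI) auto
    qed (use z in simp)
    then show ?thesis by (simp add: h_def)
  qed
  have "filterlim (\<lambda>z. h w - ln (z - z0) / K) at_top (at_right z0)"
    unfolding filterlim_at_right_to_0[of _ _ z0] using K by real_asymp
  moreover have "\<forall>\<^sub>F z in at_right z0. h w - ln (z - z0) / K \<le> tau z"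
    unfolding eventually_at_right_field using le w by blast
  ultimately show ?thesis by (rule filterlim_at_top_mono)
qed

text \<open>The trajectory of v' = -g(v) that comes down from oo at time 0. Started at l > z0, the
  flow is this trajectory entered at time \<open>tau l\<close>.\<close>

definition v :: "real \<Rightarrow> real" where "v T = (THE z. z0 < z \<and> tau z = T)"

lemma tau_surj:
  assumes T: "0 < T" shows "\<exists>z. z0 < z \<and> tau z = T"
proof -
  have "\<forall>\<^sub>F z in at_right z0. T \<le> tau z" using tau_at_z0 by (auto simp: filterlim_at_top)
  then obtain b where "z0 < b" "\<And>z. z0 < z \<Longrightarrow> z < b \<Longrightarrow> T \<le> tau z"
    unfolding eventually_at_right_field by blast
  moreover define a where "a = (z0 + b) / 2"
  ultimately have a: "z0 < a" "T \<le> tau a" by auto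
  have "\<forall>\<^sub>F z in at_top. tau z < T" using tau_at_top T by (rule order_tendstoD)
  then have "\<forall>\<^sub>F z in at_top. tau z < T \<and> a \<le> z" using eventually_ge_at_top by (rule eventually_conj)
  then obtain d where d: "tau d < T" "a \<le> d" using eventually_happens by fastforce
  have "\<exists>x\<ge>a. x \<le> d \<and> tau x = T"
    using a d by (intro IVT2) (auto intro: tau_isCont)
  then show ?thesis using a(1) less_le_trans by blast
qed

lemma v_props:
  assumes T: "0 < T" shows "z0 < v T" "tau (v T) = T"
proof -
  obtain z where z: "z0 < z" "tau z = T" using tau_surj[OF T] by blast
  have uniq: "y = z" if "z0 < y \<and> tau y = T" for y
    using that z tau_strict[of y z] tau_strict[of z y] by (cases y z rule: linorder_cases) auto
  have "v T = z" unfolding v_def by (rule the_equality) (rule conjI[OF z], rule uniq)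
  with z show "z0 < v T" "tau (v T) = T" by (simp_all only:)
qed

lemma v_tau: assumes "z0 < z" shows "v (tau z) = z"
  using v_props[OF tau_pos[OF assms]] tau_less_iff[of "v (tau z)" z] tau_less_iff[of z "v (tau z)"] assms
  by (metis linorder_less_linear order_less_irrefl)

lemma v_antimono: "0 < S \<Longrightarrow> S \<le> T \<Longrightarrow> v T \<le> v S"
  using v_props[of S] v_props[of T] tau_less_iff[of "v S" "v T"] by force

lemma v_deriv:
  assumes T: "0 < T" shows "(v has_real_derivative - g (v T)) (at T)"
proof -
  note vT = v_props[OF T]
  have gp: "0 < g (v T)" using g_pos vT by simp
  define a where "a = (z0 + v T) / 2"
  have a: "z0 < a" "a < v T" using vT by (auto simp: a_def)
  have cont: "isCont v (tau (v T))"
    by (rule isCont_inverse_function2[where a=a and b="v T + 1"]) (use a in \<open>auto intro!: v_tau tau_isCont\<close>)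
  have "(v has_real_derivative inverse (- 1 / g (v T))) (at T)"
    by (rule DERIV_inverse_function[where f=tau and a=0 and b="T + 1"])
       (use vT T gp cont v_props tau_deriv in auto)
  then show ?thesis using gp by simp
qed

section \<open>Integration by parts in the given transform\<close>

lemma exp_tau_deriv:
  assumes "z0 < z" shows "((\<lambda>z. exp (- q * tau z)) has_real_derivative q / g z * exp (- q * tau z)) (at z)"
  using assms by (auto intro!: derivative_eq_intros tau_deriv)

lemma exp_tau_isCont: "z0 < z \<Longrightarrow> isCont (\<lambda>z. q / g z * exp (- q * tau z)) z"
proof -
  assume z: "z0 < z"
  have "isCont (\<lambda>z. q * (1 / g z) * exp (- q * tau z)) z"
    by (intro continuous_intros inv_g_isCont tau_isCont z)
  then show ?thesis by simp
qed

lemma exp_tau_limits: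
  assumes q: "0 < q"
  shows "((\<lambda>z. exp (- q * tau z)) \<longlongrightarrow> 0) (at_right z0)" "((\<lambda>z. exp (- q * tau z)) \<longlongrightarrow> 1) at_top"
proof -
  have "filterlim (\<lambda>z. q * tau z) at_top (at_right z0)"
    using q by (intro filterlim_tendsto_pos_mult_at_top[OF tendsto_const] tau_at_z0)
  then have "filterlim (\<lambda>z. - (q * tau z)) at_bot (at_right z0)" by (simp add: filterlim_uminus_at_bot)
  from filterlim_compose[OF exp_at_bot this] show "((\<lambda>z. exp (- q * tau z)) \<longlongrightarrow> 0) (at_right z0)" by simp
  have "((\<lambda>z. exp (- q * tau z)) \<longlongrightarrow> exp (- q * 0)) at_top"
    by (intro tendsto_intros tau_at_top)
  then show "((\<lambda>z. exp (- q * tau z)) \<longlongrightarrow> 1) at_top" by simp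
qed

text \<open>exp(-q tau) rises from 0 at z0 to 1 at oo, so it is a distribution function, and q/g
  times exp(-q tau) is its density.\<close>

lemma nn_exp_tau:
  assumes q: "0 < q"
  shows "z0 < w \<Longrightarrow> (\<integral>\<^sup>+z. ennreal (indicator {z0<..<w} z * (q / g z * exp (- q * tau z))) \<partial>lborel) = ennreal (exp (- q * tau w))"
    and "(\<integral>\<^sup>+z. ennreal (indicator {z0<..} z * (q / g z * exp (- q * tau z))) \<partial>lborel) = 1"
proof -
  have nonneg: "0 \<le> q / g z * exp (- q * tau z)" if "z0 < z" for z
    using g_pos q that by (simp add: less_imp_le)
  { assume w: "z0 < w"
    have left: "((\<lambda>z. exp (- q * tau z)) \<longlongrightarrow> exp (- q * tau w)) (at_left w)"
      by (intro tendsto_intros tendsto_within_subset[OF tau_isCont[OF w, unfolded isCont_def]]) auto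
    have "(\<integral>\<^sup>+z. ennreal (indicator (einterval (ereal z0) (ereal w)) z * (q / g z * exp (- q * tau z))) \<partial>lborel)
        = ennreal (exp (- q * tau w) - 0)"
      by (rule nn_integral_FTC_open[where F="\<lambda>z. exp (- q * tau z)"])
         (use w nonneg exp_tau_deriv exp_tau_isCont exp_tau_limits(1)[OF q] left in \<open>auto simp: ereal_tendsto_simps\<close>)
    then show "(\<integral>\<^sup>+z. ennreal (indicator {z0<..<w} z * (q / g z * exp (- q * tau z))) \<partial>lborel) = ennreal (exp (- q * tau w))"
      by simp }
  have "(\<integral>\<^sup>+z. ennreal (indicator (einterval (ereal z0) \<infinity>) z * (q / g z * exp (- q * tau z))) \<partial>lborel) = ennreal (1 - 0)"
    by (rule nn_integral_FTC_open[where F="\<lambda>z. exp (- q * tau z)"])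
       (use nonneg exp_tau_deriv exp_tau_isCont exp_tau_limits[OF q] in \<open>auto simp: ereal_tendsto_simps\<close>)
  then show "(\<integral>\<^sup>+z. ennreal (indicator {z0<..} z * (q / g z * exp (- q * tau z))) \<partial>lborel) = 1"
    by simp
qed

lemma nn_exp_tail:
  assumes x: "0 < (x::real)"
  shows "(\<integral>\<^sup>+w. ennreal (indicator {z<..} w * (x * exp (- x * w))) \<partial>lborel) = ennreal (exp (- x * z))"
proof -
  have cont: "isCont (\<lambda>w. - exp (- x * w)) z" by (intro continuous_intros)
  have right: "((\<lambda>w. - exp (- x * w)) \<longlongrightarrow> - exp (- x * z)) (at_right z)"
    by (rule tendsto_within_subset[OF cont[unfolded isCont_def]]) auto
  have "((\<lambda>w. - exp (- x * w)) \<longlongrightarrow> 0) at_top" using x by real_asymp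
  then have "(\<integral>\<^sup>+w. ennreal (indicator (einterval (ereal z) \<infinity>) w * (x * exp (- x * w))) \<partial>lborel) = ennreal (0 - (- exp (- x * z)))"
    by (intro nn_integral_FTC_open[where F="\<lambda>w. - exp (- x * w)"])
       (use x right in \<open>auto simp: ereal_tendsto_simps intro!: derivative_eq_intros continuous_intros\<close>)
  then show ?thesis by simp
qed

lemma tau_measurable: "(\<lambda>z. indicator {z0<..} z * exp (- q * tau z)) \<in> borel_measurable borel"
proof -
  have "continuous_on {z0<..} (\<lambda>z. exp (- q * tau z))"
    by (intro continuous_intros continuous_at_imp_continuous_on ballI tau_isCont) auto
  from borel_measurable_continuous_on_indicator[OF _ this] show ?thesis by simp
qed

lemma density_measurable: "(\<lambda>z. indicator {z0<..} z * (q / g z * exp (- q * tau z))) \<in> borel_measurable borel"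
proof -
  have "continuous_on {z0<..} (\<lambda>z. q / g z * exp (- q * tau z))"
    by (intro continuous_at_imp_continuous_on ballI exp_tau_isCont) auto
  from borel_measurable_continuous_on_indicator[OF _ this] show ?thesis by simp
qed

text \<open>The exchange of integrals replaces an integration by parts.\<close>

lemma nn_integral_by_parts:
  assumes q: "0 < q" and x: "0 < x"
  shows "(\<integral>\<^sup>+z. ennreal (indicator {z0<..} z * (q / g z * exp (- q * tau z))) * ennreal (exp (- x * z)) \<partial>lborel)
    = (\<integral>\<^sup>+w. ennreal (indicator {z0<..} w * (x * exp (- x * w) * exp (- q * tau w))) \<partial>lborel)"
proof -
  define h where "h z = indicator {z0<..} z * (q / g z * exp (- q * tau z))" for z
  define k where "k w = x * exp (- x * w)" for w
  have hm[measurable]: "h \<in> borel_measurable borel" unfolding h_def by (rule density_measurable)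
  have km[measurable]: "k \<in> borel_measurable borel" unfolding k_def by measurable
  have h0: "0 \<le> h z" for z using g_pos q by (auto simp: h_def indicator_def less_imp_le)
  have k0: "0 \<le> k w" for w using x by (simp add: k_def)
  have "(\<integral>\<^sup>+z. ennreal (h z) * ennreal (exp (- x * z)) \<partial>lborel)
      = (\<integral>\<^sup>+z. (\<integral>\<^sup>+w. ennreal (h z) * ennreal (indicator {z<..} w * k w) \<partial>lborel) \<partial>lborel)"
    unfolding k_def by (simp only: nn_exp_tail[OF x, symmetric]) (subst nn_integral_cmult, auto)
  also have "\<dots> = (\<integral>\<^sup>+w. (\<integral>\<^sup>+z. ennreal (h z) * ennreal (indicator {z<..} w * k w) \<partial>lborel) \<partial>lborel)"
  proof (rule lborel_pair.Fubini'[symmetric])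
    have "(\<lambda>(z, w). ennreal (h z) * ennreal ((if z < w then 1 else 0) * k w)) \<in> borel_measurable (lborel \<Otimes>\<^sub>M lborel)"
      by measurable
    moreover have "(\<lambda>(z, w). ennreal (h z) * ennreal ((if z < w then 1 else 0) * k w)) = (\<lambda>(z, w). ennreal (h z) * ennreal (indicator {z<..} w * k w))"
      by (auto simp: fun_eq_iff indicator_def)
    ultimately show "(\<lambda>(z, w). ennreal (h z) * ennreal (indicator {z<..} w * k w)) \<in> borel_measurable (lborel \<Otimes>\<^sub>M lborel)"
      by simp
  qed
  also have "\<dots> = (\<integral>\<^sup>+w. ennreal (indicator {z0<..} w * (k w * exp (- q * tau w))) \<partial>lborel)"
  proof (rule nn_integral_cong)
    fix w
    have "(\<integral>\<^sup>+z. ennreal (h z) * ennreal (indicator {z<..} w * k w) \<partial>lborel)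
        = (\<integral>\<^sup>+z. ennreal (k w) * ennreal (indicator {z0<..<w} z * (q / g z * exp (- q * tau z))) \<partial>lborel)"
      by (rule nn_integral_cong) (auto simp: h_def indicator_def mult.commute)
    also have "\<dots> = ennreal (k w) * (\<integral>\<^sup>+z. ennreal (indicator {z0<..<w} z * (q / g z * exp (- q * tau z))) \<partial>lborel)"
    proof (rule nn_integral_cmult)
      have "(\<lambda>z. indicator {..<w} z * h z) \<in> borel_measurable borel" by measurable
      moreover have "(\<lambda>z. indicator {..<w} z * h z) = (\<lambda>z. indicator {z0<..<w} z * (q / g z * exp (- q * tau z)))"
        by (auto simp: fun_eq_iff h_def indicator_def)
      ultimately show "(\<lambda>z. ennreal (indicator {z0<..<w} z * (q / g z * exp (- q * tau z)))) \<in> borel_measurable lborel"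
        by simp
    qed
    also have "\<dots> = ennreal (indicator {z0<..} w * (k w * exp (- q * tau w)))"
    proof (cases "z0 < w")
      case True
      then show ?thesis using nn_exp_tau(1)[OF q True] k0[of w] by (simp add: ennreal_mult)
    qed (simp add: indicator_def)
    finally show "(\<integral>\<^sup>+z. ennreal (h z) * ennreal (indicator {z<..} w * k w) \<partial>lborel)
        = ennreal (indicator {z0<..} w * (k w * exp (- q * tau w)))" .
  qed
  finally show ?thesis by (simp add: h_def k_def)
qed

lemma inner_integral: "(LBINT w:{z<..}. q / g w) = q * tau z"
proof -
  have "(LBINT w:{z<..}. q / g w) = (LBINT w:{z<..}. q * (1 / g w))" by simp
  then show ?thesis unfolding tau_def by (simp only: set_integral_mult_right)
qed

text \<open>The factor q makes the integrand a probability density weighted by exp(-x z); dividing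
  by q compensates, and the same 1/q stands in the denominator of the given quotient.\<close>

lemma Phi_eq:
  assumes q: "0 < q"
  shows "(LBINT z:{z0<..}. (1 / g z) * exp (- x * z - (LBINT w:{z<..}. q / g w)))
    = enn2real (\<integral>\<^sup>+z. ennreal (indicator {z0<..} z * (q / g z * exp (- q * tau z))) * ennreal (exp (- x * z)) \<partial>lborel) / q"
proof -
  define h where "h z = indicator {z0<..} z * (q / g z * exp (- q * tau z))" for z
  have hm[measurable]: "h \<in> borel_measurable borel" unfolding h_def by (rule density_measurable)
  have h0: "0 \<le> h z" for z using g_pos q by (auto simp: h_def indicator_def less_imp_le)
  have "(LBINT z:{z0<..}. (1 / g z) * exp (- x * z - (LBINT w:{z<..}. q / g w))) = (\<integral>z. (h z * exp (- x * z)) / q \<partial>lborel)"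
    unfolding inner_integral unfolding h_def set_lebesgue_integral_def using q
    by (intro Bochner_Integration.integral_cong) (auto simp: exp_diff exp_minus field_simps)
  also have "\<dots> = (\<integral>z. h z * exp (- x * z) \<partial>lborel) / q" by simp
  also have "(\<integral>z. h z * exp (- x * z) \<partial>lborel) = enn2real (\<integral>\<^sup>+z. ennreal (h z * exp (- x * z)) \<partial>lborel)"
    using h0 by (intro integral_eq_nn_integral) auto
  also have "(\<integral>\<^sup>+z. ennreal (h z * exp (- x * z)) \<partial>lborel) = (\<integral>\<^sup>+z. ennreal (h z) * ennreal (exp (- x * z)) \<partial>lborel)"
    using h0 by (intro nn_integral_cong ennreal_mult) auto
  finally show ?thesis unfolding h_def .
qed

lemma Phi_0:
  assumes q: "0 < q"
  shows "(LBINT z:{z0<..}. (1 / g z) * exp (- 0 * z - (LBINT w:{z<..}. q / g w))) = 1 / q"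
  unfolding Phi_eq[OF q] using nn_exp_tau(2)[OF q] by simp

text \<open>An exponential variable of rate x restricted to values above z0. Its mass exp(-x z0)
  will be the probability of extinction.\<close>

definition exp_law :: "real \<Rightarrow> real measure" where
  "exp_law x = density lborel (\<lambda>w. ennreal (indicator {z0<..} w * (x * exp (- x * w))))"

text \<open>exp(-q T) for the time T = tau z, with T = oo for z <= z0.\<close>

definition clock :: "real \<Rightarrow> real \<Rightarrow> real" where
  "clock q z = indicator {z0<..} z * exp (- q * tau z)"

lemma clock_measurable: "clock q \<in> borel_measurable borel"
  unfolding clock_def by (rule tau_measurable)

lemma Phi_pos:
  assumes q: "0 < q" and x: "0 < x"
  shows "(LBINT z:{z0<..}. (1 / g z) * exp (- x * z - (LBINT w:{z<..}. q / g w))) = (\<integral>w. clock q w \<partial>exp_law x) / q"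
proof -
  have m: "(\<lambda>w. ennreal (indicator {z0<..} w * (x * exp (- x * w)))) \<in> borel_measurable lborel" by measurable
  have "(\<integral>w. clock q w \<partial>exp_law x) = enn2real (\<integral>\<^sup>+w. ennreal (clock q w) \<partial>exp_law x)"
  proof (rule integral_eq_nn_integral)
    show "clock q \<in> borel_measurable (exp_law x)" using clock_measurable by (simp add: exp_law_def)
  qed (simp add: clock_def)
  also have "(\<integral>\<^sup>+w. ennreal (clock q w) \<partial>exp_law x)
      = (\<integral>\<^sup>+w. ennreal (indicator {z0<..} w * (x * exp (- x * w))) * ennreal (clock q w) \<partial>lborel)"
    unfolding exp_law_def using m clock_measurable by (intro nn_integral_density) auto
  also have "\<dots> = (\<integral>\<^sup>+w. ennreal (indicator {z0<..} w * (x * exp (- x * w) * exp (- q * tau w))) \<partial>lborel)"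
    using x by (intro nn_integral_cong) (auto simp: clock_def indicator_def ennreal_mult)
  finally show ?thesis unfolding Phi_eq[OF q] nn_integral_by_parts[OF q x] by simp
qed

lemma exp_law_finite:
  assumes x: "0 < x" shows "finite_measure (exp_law x)"
proof (rule finite_measureI)
  have "emeasure (exp_law x) UNIV = (\<integral>\<^sup>+w. ennreal (indicator {z0<..} w * (x * exp (- x * w))) \<partial>lborel)"
    unfolding exp_law_def by (subst emeasure_density) auto
  also have "\<dots> = ennreal (exp (- x * z0))" by (rule nn_exp_tail[OF x])
  finally show "emeasure (exp_law x) (space (exp_law x)) \<noteq> \<infinity>" by (simp add: exp_law_def)
qed

text \<open>The clock increases strictly above z0 and is 0 up to z0, so its upper level sets are
  half lines.\<close>

lemma exp_law_tail:
  assumes x: "0 < x" and q: "0 < q" and l: "z0 < l"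
  shows "measure (distr (exp_law x) borel (clock q)) {exp (- q * tau l)..} = exp (- x * l)"
proof -
  have cm: "clock q \<in> borel_measurable (exp_law x)" using clock_measurable by (simp add: exp_law_def)
  have set: "clock q -` {exp (- q * tau l)..} \<inter> space (exp_law x) = {l..}"
  proof (intro set_eqI iffI)
    fix z assume "z \<in> clock q -` {exp (- q * tau l)..} \<inter> space (exp_law x)"
    then have z: "exp (- q * tau l) \<le> clock q z" by simp
    have z0z: "z0 < z" using z by (rule contrapos_pp) (simp add: clock_def not_le)
    then have "tau z \<le> tau l" using z q by (simp add: clock_def)
    then show "z \<in> {l..}" using tau_less_iff[OF z0z l] by (auto simp: not_less[symmetric])
  next
    fix z assume "z \<in> {l..}"
    then have z: "z0 < z" "tau z \<le> tau l" using l tau_less_iff[of z l] by (auto simp: not_less[symmetric])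
    then show "z \<in> clock q -` {exp (- q * tau l)..} \<inter> space (exp_law x)"
      using q by (simp add: clock_def exp_law_def)
  qed
  have "emeasure (distr (exp_law x) borel (clock q)) {exp (- q * tau l)..} = emeasure (exp_law x) {l..}"
    using cm by (subst emeasure_distr) (simp_all only: set, simp_all)
  also have "\<dots> = (\<integral>\<^sup>+w. ennreal (indicator {z0<..} w * (x * exp (- x * w))) * indicator {l..} w \<partial>lborel)"
    unfolding exp_law_def by (subst emeasure_density) auto
  also have "\<dots> = (\<integral>\<^sup>+w. ennreal (indicator {l<..} w * (x * exp (- x * w))) \<partial>lborel)"
    using AE_lborel_singleton[of l] l
    by (intro nn_integral_cong_AE) (auto simp: indicator_def elim!: eventually_mono)
  also have "\<dots> = ennreal (exp (- x * l))" by (rule nn_exp_tail[OF x])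
  finally show ?thesis by (simp add: measure_def)
qed

lemma clock_unit:
  assumes x: "0 < x" and q: "0 < q"
  shows "unit_measure (distr (exp_law x) borel (clock q))"
proof -
  interpret finite_measure "exp_law x" by (rule exp_law_finite[OF x])
  have cm: "clock q \<in> borel_measurable (exp_law x)" using clock_measurable by (simp add: exp_law_def)
  have "0 \<le> clock q z \<and> clock q z \<le> 1" for z
    using q tau_nonneg[of z] by (auto simp: clock_def indicator_def)
  then show ?thesis
    unfolding unit_measure_def using cm by (auto simp: AE_distr_iff intro!: finite_measure_distr)
qed

text \<open>Taking powers of the clock multiplies its rate, so transforms at q, 2 q, 3 q and so on
  are the moments of a single measure. Order 0 would turn the value 0 below z0 into 1.\<close>

lemma clock_moment:
  assumes x: "0 < x" and q: "0 < q" and j: "1 \<le> j"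
  shows "(\<integral>s. s ^ j \<partial>distr (exp_law x) borel (clock q)) = (\<integral>w. clock (real j * q) w \<partial>exp_law x)"
proof -
  have cm: "clock q \<in> borel_measurable (exp_law x)" using clock_measurable by (simp add: exp_law_def)
  have "(\<integral>s. s ^ j \<partial>distr (exp_law x) borel (clock q)) = (\<integral>w. clock q w ^ j \<partial>exp_law x)"
    using cm by (intro integral_distr) auto
  also have "\<dots> = (\<integral>w. clock (real j * q) w \<partial>exp_law x)"
    using j by (intro Bochner_Integration.integral_cong)
      (auto simp: clock_def indicator_def exp_of_nat_mult[symmetric] mult.assoc)
  finally show ?thesis .
qed

end

section \<open>The process\<close>

text \<open>Additivity and nonnegativity make f monotone. Enclosing n x between consecutive integers
  gives n |f x - x f 1| <= f 1 for every n.\<close>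

lemma additive_nonneg_linear:
  fixes f :: "real \<Rightarrow> real"
  assumes add: "\<And>x y. 0 \<le> x \<Longrightarrow> 0 \<le> y \<Longrightarrow> f (x + y) = f x + f y"
    and nonneg: "\<And>x. 0 \<le> x \<Longrightarrow> 0 \<le> f x" and x: "0 \<le> x"
  shows "f x = x * f 1"
proof -
  have mult: "f (real n * y) = real n * f y" if y: "0 \<le> y" for n y
  proof (induction n)
    case 0
    show ?case using add[of 0 0] by simp
  next
    case (Suc n)
    have "f (real (Suc n) * y) = f (real n * y + y)" by (simp add: algebra_simps)
    also have "\<dots> = real n * f y + f y" using add[of "real n * y" y] y Suc by simp
    finally show ?case by (simp add: algebra_simps)
  qed
  have mono: "f a \<le> f b" if "0 \<le> a" "a \<le> b" for a b
    using add[of a "b - a"] nonneg[of "b - a"] that by simp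
  have bound: "real n * \<bar>f x - x * f 1\<bar> \<le> f 1" for n
  proof -
    define y where "y = real n * x"
    define k where "k = nat \<lfloor>y\<rfloor>"
    have y: "0 \<le> y" using x by (simp add: y_def)
    have k: "real k \<le> y" "y \<le> real k + 1" using y by (simp_all add: k_def)
    have fk: "f (real k) = real k * f 1" "f (real k + 1) = (real k + 1) * f 1"
      using mult[of 1 k] mult[of 1 "Suc k"] by (simp_all add: add.commute)
    have "real k * f 1 \<le> f y" "f y \<le> (real k + 1) * f 1"
      using mono[of "real k" y] mono[of y "real k + 1"] k y unfolding fk by auto
    moreover have "real k * f 1 \<le> y * f 1" "y * f 1 \<le> (real k + 1) * f 1"
      using k nonneg[of 1] by (auto intro!: mult_right_mono)
    ultimately have "\<bar>f y - y * f 1\<bar> \<le> f 1" by (simp add: algebra_simps abs_le_iff)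
    moreover have "f y - y * f 1 = real n * (f x - x * f 1)"
      using mult[OF x, of n] by (simp add: y_def algebra_simps)
    ultimately show ?thesis by (simp add: abs_mult)
  qed
  have "\<bar>f x - x * f 1\<bar> \<le> 0"
  proof (rule ccontr)
    assume "\<not> ?thesis"
    then obtain n where "f 1 < real n * \<bar>f x - x * f 1\<bar>"
      using reals_Archimedean3[of "\<bar>f x - x * f 1\<bar>"] by auto
    then show False using bound[of n] by simp
  qed
  then show ?thesis by simp
qed

lemma exp_neg_measurable: "exp_neg l \<in> borel_measurable borel"
  unfolding exp_neg_def by measurable

lemma exp_neg_bounds: "0 \<le> l \<Longrightarrow> 0 \<le> exp_neg l y \<and> exp_neg l y \<le> 1"
  by (simp add: exp_neg_def)

lemma exp_neg_antimono: "a \<le> b \<Longrightarrow> exp_neg b y \<le> exp_neg a y"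
  by (simp add: exp_neg_def mult_right_mono)

text \<open>For r = 0 and y = oo both sides are 0, because 0 powr 0 = 0.\<close>

lemma exp_neg_powr: "exp_neg c y powr r = exp_neg (c * r) y"
  by (simp add: exp_neg_def powr_def mult_ac)

locale csbp_setting = cumulant_data z0 g for z0 :: real and g +
  fixes \<Omega> :: "'a set" and P :: "real \<Rightarrow> 'a measure" and F :: "real \<Rightarrow> 'a set set"
    and X :: "real \<Rightarrow> 'a \<Rightarrow> ennreal" and \<zeta> :: "'a \<Rightarrow> ennreal" and Q :: real
  assumes setting: "standing_setting \<Omega> P F X \<zeta>"
    and absorb: "zero_absorbing P X \<zeta>"
    and Qpos: "0 < Q" and z0: "0 \<le> z0"
    and laplace: "\<And>x q. 0 \<le> x \<Longrightarrow> Q < q \<Longrightarrow>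
        (\<integral> \<omega>. exp (- q * enn2real (T_minus X \<zeta> 0 \<omega>)) * indicator {\<omega>. T_minus X \<zeta> 0 \<omega> < \<zeta> \<omega>} \<omega> \<partial>P x)
        = (LBINT z:{z0<..}. (1 / g z) * exp (- x * z - (LBINT w:{z<..}. q / g w)))
          / (LBINT z:{z0<..}. (1 / g z) * exp (- 0 * z - (LBINT w:{z<..}. q / g w)))"
begin

section \<open>Markov property at fixed times and the law of extinction\<close>

lemmas setting' = setting[unfolded standing_setting_def]
lemmas markov_raw = setting'[THEN conjunct2, THEN conjunct2, THEN conjunct2, THEN conjunct2, THEN conjunct2, THEN conjunct2,
  THEN conjunct2, THEN conjunct2, THEN conjunct2, THEN conjunct2, THEN conjunct2, THEN conjunct2, THEN conjunct1]
lemmas normality = setting'[THEN conjunct2, THEN conjunct2, THEN conjunct2, THEN conjunct2, THEN conjunct2, THEN conjunct2,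
  THEN conjunct2, THEN conjunct2, THEN conjunct2, THEN conjunct2, THEN conjunct2, THEN conjunct1, rule_format]
lemmas cemetery = setting'[THEN conjunct2, THEN conjunct2, THEN conjunct2, THEN conjunct2, THEN conjunct2, THEN conjunct2,
  THEN conjunct2, THEN conjunct1, rule_format]
lemmas adapted = setting'[THEN conjunct2, THEN conjunct2, THEN conjunct2, THEN conjunct2, THEN conjunct1, rule_format]
lemmas sigma_F = setting'[THEN conjunct2, THEN conjunct1, rule_format]

lemma prob_P: "0 \<le> x \<Longrightarrow> prob_space (P x)" and space_P: "0 \<le> x \<Longrightarrow> space (P x) = \<Omega>"
  and F_infty_P: "0 \<le> x \<Longrightarrow> F_infty \<Omega> F \<subseteq> sets (P x)"
  using setting'[THEN conjunct1] by auto

lemma X_measurable: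
  assumes t: "0 \<le> t" and x: "0 \<le> x" shows "X t \<in> borel_measurable (P x)"
proof (rule measurableI)
  fix A :: "ennreal set" assume "A \<in> sets borel"
  then have "{\<omega>\<in>\<Omega>. X t \<omega> \<in> A} \<in> F t" using adapted[OF t] by blast
  then have "{\<omega>\<in>\<Omega>. X t \<omega> \<in> A} \<in> F_infty \<Omega> F" using t unfolding F_infty_def by auto
  moreover have "X t -` A \<inter> space (P x) = {\<omega>\<in>\<Omega>. X t \<omega> \<in> A}" using space_P[OF x] by auto
  ultimately show "X t -` A \<inter> space (P x) \<in> sets (P x)" using F_infty_P[OF x] by auto
qed simp

text \<open>The strong Markov property at the constant time t speaks of the event t < \<zeta> only.
  Elsewhere both sides are 0, because X stays at oo after the lifetime and
  \<open>f \<infinity> = 0\<close>.\<close>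

lemma markov:
  fixes f :: "ennreal \<Rightarrow> ennreal"
  assumes t: "0 \<le> t" and s: "0 \<le> s" and x: "0 \<le> x" and f: "f \<in> borel_measurable borel" and f0: "f \<infinity> = 0"
  shows "(\<integral>\<^sup>+\<omega>. f (X (t + s) \<omega>) \<partial>P x)
    = (\<integral>\<^sup>+\<omega>. (if X t \<omega> = \<infinity> then 0 else (\<integral>\<^sup>+\<omega>'. f (X s \<omega>') \<partial>P (enn2real (X t \<omega>)))) \<partial>P x)"
proof -
  define S :: "'a \<Rightarrow> ennreal" where "S = (\<lambda>_. ennreal t)"
  define H where "H p = f (p s)" for p :: "real \<Rightarrow> ennreal"
  have sets: "{\<omega>\<in>\<Omega>. S \<omega> \<le> ennreal r} \<in> F r" if "0 \<le> r" for r
  proof -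
    interpret sigma_algebra \<Omega> "F r" using sigma_F[OF that] .
    show ?thesis by (cases "ennreal t \<le> ennreal r") (auto simp: S_def)
  qed
  have stop: "is_stopping_time \<Omega> F S" using sets by (simp add: is_stopping_time_def)
  have \<Omega>: "\<Omega> \<in> F_at \<Omega> F S"
  proof -
    have "\<Omega> \<inter> {\<omega>\<in>\<Omega>. S \<omega> \<le> ennreal r} = {\<omega>\<in>\<Omega>. S \<omega> \<le> ennreal r}" for r by auto
    then show ?thesis using sets by (simp add: F_at_def F_infty_def sigma_sets_top)
  qed
  have H: "H \<in> borel_measurable path_space"
    unfolding H_def path_space_def
    by (rule measurable_compose[OF measurable_component_singleton[where M="\<lambda>_. borel"] f]) (use s in simp)
  have "\<forall>x\<ge>0. \<forall>A\<in>F_at \<Omega> F S.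
          (\<integral>\<^sup>+ \<omega>. H (shifted_path X S \<omega>) * indicator (A \<inter> {\<omega>. S \<omega> < \<zeta> \<omega>}) \<omega> \<partial>P x) =
          (\<integral>\<^sup>+ \<omega>. (\<integral>\<^sup>+ \<omega>'. H (path X \<omega>') \<partial>P (enn2real (Xat X S \<omega>)))
                     * indicator (A \<inter> {\<omega>. S \<omega> < \<zeta> \<omega>}) \<omega> \<partial>P x)"
    using markov_raw stop H by blast
  then have eq: "(\<integral>\<^sup>+ \<omega>. H (shifted_path X S \<omega>) * indicator (\<Omega> \<inter> {\<omega>. S \<omega> < \<zeta> \<omega>}) \<omega> \<partial>P x) =
          (\<integral>\<^sup>+ \<omega>. (\<integral>\<^sup>+ \<omega>'. H (path X \<omega>') \<partial>P (enn2real (Xat X S \<omega>)))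
                     * indicator (\<Omega> \<inter> {\<omega>. S \<omega> < \<zeta> \<omega>}) \<omega> \<partial>P x)"
    using x \<Omega> by blast
  have shift: "H (shifted_path X S \<omega>) = f (X (t + s) \<omega>)" for \<omega>
    using t s by (simp add: H_def shifted_path_def Xat_def S_def ennreal_plus[symmetric] del: ennreal_plus)
  have path: "H (path X \<omega>) = f (X s \<omega>)" for \<omega> using s by (simp add: H_def path_def)
  have at: "Xat X S \<omega> = X t \<omega>" for \<omega> using t by (simp add: Xat_def S_def)
  have "(\<integral>\<^sup>+\<omega>. f (X (t + s) \<omega>) \<partial>P x) = (\<integral>\<^sup>+ \<omega>. H (shifted_path X S \<omega>) * indicator (\<Omega> \<inter> {\<omega>. S \<omega> < \<zeta> \<omega>}) \<omega> \<partial>P x)"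
  proof (rule nn_integral_cong)
    fix \<omega> assume "\<omega> \<in> space (P x)"
    then have \<omega>: "\<omega> \<in> \<Omega>" using space_P[OF x] by simp
    show "f (X (t + s) \<omega>) = H (shifted_path X S \<omega>) * indicator (\<Omega> \<inter> {\<omega>. S \<omega> < \<zeta> \<omega>}) \<omega>"
    proof (cases "ennreal t < \<zeta> \<omega>")
      case False
      then have "\<zeta> \<omega> \<le> ennreal t" by simp
      also have "\<dots> \<le> ennreal (t + s)" using s by (intro ennreal_leI) simp
      finally have "X (t + s) \<omega> = \<infinity>" using cemetery[OF \<omega>, of "t + s"] t s by simp
      then show ?thesis using f0 shift[of \<omega>] by simp
    qed (use \<omega> shift in \<open>simp add: S_def\<close>)
  qed
  also have "\<dots> = (\<integral>\<^sup>+\<omega>. (if X t \<omega> = \<infinity> then 0 else (\<integral>\<^sup>+\<omega>'. f (X s \<omega>') \<partial>P (enn2real (X t \<omega>)))) \<partial>P x)"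
    unfolding eq path at
  proof (rule nn_integral_cong)
    fix \<omega> assume "\<omega> \<in> space (P x)"
    then have \<omega>: "\<omega> \<in> \<Omega>" using space_P[OF x] by simp
    show "(\<integral>\<^sup>+\<omega>'. f (X s \<omega>') \<partial>P (enn2real (X t \<omega>))) * indicator (\<Omega> \<inter> {\<omega>. S \<omega> < \<zeta> \<omega>}) \<omega>
        = (if X t \<omega> = \<infinity> then 0 else (\<integral>\<^sup>+\<omega>'. f (X s \<omega>') \<partial>P (enn2real (X t \<omega>))))"
      using cemetery[OF \<omega> t] \<omega> by (auto simp: S_def indicator_def)
  qed
  finally show ?thesis .
qed

text \<open>By absorption, being at 0 at time t means having arrived by then. The condition T <
  \<zeta> makes T finite, so that \<open>enn2real\<close> does not turn oo into 0.\<close>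

lemma extinct_at_iff:
  assumes t: "0 \<le> t" and x: "0 \<le> x"
  shows "AE \<omega> in P x. (T_minus X \<zeta> 0 \<omega> < \<zeta> \<omega> \<and> enn2real (T_minus X \<zeta> 0 \<omega>) \<le> t) \<longleftrightarrow> X t \<omega> = 0"
proof -
  have "AE \<omega> in P x. T_minus X \<zeta> 0 \<omega> < \<zeta> \<omega> \<longrightarrow> (\<forall>t\<ge>0. T_minus X \<zeta> 0 \<omega> \<le> ennreal t \<longrightarrow> X t \<omega> = 0)"
    using absorb x unfolding zero_absorbing_def by blast
  moreover have "AE \<omega> in P x. \<omega> \<in> \<Omega>" using AE_space[of "P x"] space_P[OF x] by simp
  ultimately show ?thesis
  proof eventually_elim
    case (elim \<omega>)
    show ?case
    proof
      assume T: "T_minus X \<zeta> 0 \<omega> < \<zeta> \<omega> \<and> enn2real (T_minus X \<zeta> 0 \<omega>) \<le> t"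
      then have "T_minus X \<zeta> 0 \<omega> < top" using less_le_trans[OF _ top_greatest] by blast
      then have "T_minus X \<zeta> 0 \<omega> = ennreal (enn2real (T_minus X \<zeta> 0 \<omega>))" by simp
      also have "\<dots> \<le> ennreal t" using T by (intro ennreal_leI) simp
      finally show "X t \<omega> = 0" using elim T t by blast
    next
      assume X0: "X t \<omega> = 0"
      then have life: "ennreal t < \<zeta> \<omega>" using cemetery[OF elim(2) t] by (auto simp: not_le[symmetric])
      have "T_minus X \<zeta> 0 \<omega> \<le> ennreal t"
        unfolding T_minus_def using X0 life t by (intro Inf_lower) auto
      then show "T_minus X \<zeta> 0 \<omega> < \<zeta> \<omega> \<and> enn2real (T_minus X \<zeta> 0 \<omega>) \<le> t"
        using life t by (auto intro: enn2real_leI le_less_trans)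
    qed
  qed
qed

text \<open>Y = exp(-q T) on T < \<zeta> and the clock under the exponential law have equal moments
  of order j >= 1, hence equal tails; and Y >= exp(-q tau l) says that extinction has happened by
  time tau l.\<close>

lemma extinction:
  assumes l: "z0 < l" and x: "0 \<le> x"
  shows "measure (P x) {\<omega> \<in> \<Omega>. X (tau l) \<omega> = 0} = exp (- x * l)"
proof -
  interpret prob_space "P x" using prob_P[OF x] .
  have tl: "0 \<le> tau l" using tau_nonneg[OF l] .
  have Xm: "{\<omega> \<in> \<Omega>. X (tau l) \<omega> = 0} \<in> events"
    using measurable_sets[OF X_measurable[OF tl x], of "{0}"] space_P[OF x] by (simp add: vimage_def Int_def conj_commute)
  show ?thesis
  proof (cases "x = 0")
    \<comment> \<open>Rate 0 gives no exponential law; from x = 0 the process is at 0 from the start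
      and stays there.\<close>
    case True
    have "AE \<omega> in P x. X (tau l) \<omega> = 0"
      using extinct_at_iff[OF tl x] extinct_at_iff[OF order_refl x] normality[OF x]
    proof eventually_elim
      case (elim \<omega>)
      have "X 0 \<omega> = 0" using elim(3) True by simp
      then show ?case using elim(1,2) tl by linarith
    qed
    then have "prob {\<omega> \<in> \<Omega>. X (tau l) \<omega> = 0} = 1"
      using Xm by (subst prob_eq_1) (auto simp: space_P[OF x, symmetric] AE_conj_iff)
    then show ?thesis using True by simp
  next
    case False
    then have xp: "0 < x" using x by simp
    define q where "q = Q + 1"
    have q: "0 < q" "Q < q" using Qpos by (auto simp: q_def)
    define Y where "Y \<omega> = exp (- q * enn2real (T_minus X \<zeta> 0 \<omega>)) * indicator {\<omega>. T_minus X \<zeta> 0 \<omega> < \<zeta> \<omega>} \<omega>" for \<omega>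
    define M where "M = distr (exp_law x) borel (clock q)"
    have uM: "unit_measure M" unfolding M_def by (rule clock_unit[OF xp q(1)])
    have Y01: "0 \<le> Y \<omega>" "Y \<omega> \<le> 1" for \<omega> using q by (auto simp: Y_def indicator_def)
    have mom: "(\<integral>\<omega>. Y \<omega> ^ j \<partial>P x) = (\<integral>s. s ^ j \<partial>M)" if j: "1 \<le> j" for j
    proof -
      have "1 * q \<le> real j * q" using j q by (intro mult_right_mono) auto
      then have jq: "Q < real j * q" "0 < real j * q" using q by linarith+
      have "(\<integral>\<omega>. Y \<omega> ^ j \<partial>P x) = (\<integral> \<omega>. exp (- (real j * q) * enn2real (T_minus X \<zeta> 0 \<omega>)) * indicator {\<omega>. T_minus X \<zeta> 0 \<omega> < \<zeta> \<omega>} \<omega> \<partial>P x)"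
        using j by (intro Bochner_Integration.integral_cong)
          (auto simp: Y_def indicator_def exp_of_nat_mult[symmetric] mult.assoc)
      also have "\<dots> = (\<integral>w. clock (real j * q) w \<partial>exp_law x)"
      proof -
        have "I / k / (1 / k) = I" if "0 < k" for I k :: real using that by simp
        from this[OF jq(2)] show ?thesis unfolding laplace[OF x jq(1)] Phi_0[OF jq(2)] Phi_pos[OF jq(2) xp] .
      qed
      also have "\<dots> = (\<integral>s. s ^ j \<partial>M)" unfolding M_def clock_moment[OF xp q(1) j] ..
      finally show ?thesis .
    qed
    define a where "a = exp (- q * tau l)"
    have a: "0 < a" by (simp add: a_def)
    have Ma: "measure M {a..} = exp (- x * l)" unfolding M_def a_def by (rule exp_law_tail[OF xp q(1) l])
    \<comment> \<open>This yields the measurability of Y: a non-integrable function has integral 0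
      by convention, so a positive first moment forces Y to be integrable and hence
      measurable.\<close>
    have "0 < (\<integral>s. s ^ 1 \<partial>M)"
    proof -
      interpret M: finite_measure M using uM by (simp add: unit_measure_def)
      have sM: "sets M = sets borel" using uM by (simp add: unit_measure_def)
      have ind: "integrable M (\<lambda>s. a * indicator {a..} s)"
        by (simp add: sM M.emeasure_eq_measure integrable_indicator_iff)
      have ae: "AE s in M. s \<in> {0..1}" using uM by (simp add: unit_measure_def del: atLeastAtMost_iff)
      have "(\<integral>s. a * indicator {a..} s \<partial>M) \<le> (\<integral>s. s ^ 1 \<partial>M)"
      proof (rule integral_mono_AE[OF ind moment_integrable[OF uM]])
        show "AE s in M. a * indicator {a..} s \<le> s ^ 1" using ae by eventually_elim (auto simp: indicator_def)
      qed
      moreover have "(\<integral>s. a * indicator {a..} s \<partial>M) = a * measure M {a..}"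
        using sets_eq_imp_space_eq[OF sM] by simp
      moreover have "0 < a * measure M {a..}" using a Ma by simp
      ultimately show ?thesis by linarith
    qed
    then have "(\<integral>\<omega>. Y \<omega> \<partial>P x) \<noteq> 0" using mom[of 1] by simp
    then have "integrable (P x) Y" using not_integrable_integral_eq by blast
    then have Ym: "Y \<in> borel_measurable (P x)" by (rule borel_measurable_integrable)
    have "unit_measure (distr (P x) borel Y)"
      unfolding unit_measure_def using Ym Y01 by (auto simp: AE_distr_iff intro!: finite_measure_distr)
    then have "measure (distr (P x) borel Y) {a..} = measure M {a..}"
      by (rule moment_unique_tail[OF _ uM _ a]) (use Ym mom in \<open>simp add: integral_distr\<close>)
    then have "measure (P x) {\<omega> \<in> space (P x). a \<le> Y \<omega>} = exp (- x * l)"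
      using Ma Ym by (simp add: measure_distr vimage_def Int_def conj_commute)
    moreover have "measure (P x) {\<omega> \<in> space (P x). a \<le> Y \<omega>} = measure (P x) {\<omega> \<in> \<Omega>. X (tau l) \<omega> = 0}"
    proof (rule finite_measure_eq_AE)
      show "AE \<omega> in P x. \<omega> \<in> {\<omega> \<in> space (P x). a \<le> Y \<omega>} \<longleftrightarrow> \<omega> \<in> {\<omega> \<in> \<Omega>. X (tau l) \<omega> = 0}"
        using extinct_at_iff[OF tl x]
      proof eventually_elim
        case (elim \<omega>)
        have "a \<le> Y \<omega> \<longleftrightarrow> (T_minus X \<zeta> 0 \<omega> < \<zeta> \<omega> \<and> enn2real (T_minus X \<zeta> 0 \<omega>) \<le> tau l)"
          using a q by (auto simp: Y_def a_def indicator_def)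
        then show ?case using elim space_P[OF x] by auto
      qed
    qed (use Xm Ym in measurable)
    ultimately show ?thesis by simp
  qed
qed

section \<open>Laplace transforms in space and the branching property\<close>

definition L :: "real \<Rightarrow> real \<Rightarrow> real \<Rightarrow> real" where
  "L t x l = (\<integral>\<omega>. exp_neg l (X t \<omega>) \<partial>P x)"

lemma exp_neg_X_measurable:
  "0 \<le> t \<Longrightarrow> 0 \<le> x \<Longrightarrow> (\<lambda>\<omega>. exp_neg l (X t \<omega>)) \<in> borel_measurable (P x)"
  using measurable_compose[OF X_measurable exp_neg_measurable] by simp

lemma exp_neg_X_integrable:
  assumes "0 \<le> t" "0 \<le> x" "0 \<le> l" shows "integrable (P x) (\<lambda>\<omega>. exp_neg l (X t \<omega>))"
proof -
  interpret prob_space "P x" using prob_P assms by simp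
  show ?thesis using exp_neg_bounds[OF assms(3)]
    by (intro integrable_const_bound[where B=1] exp_neg_X_measurable assms) auto
qed

lemma L_nn:
  assumes "0 \<le> t" "0 \<le> x" "0 \<le> l"
  shows "(\<integral>\<^sup>+\<omega>. ennreal (exp_neg l (X t \<omega>)) \<partial>P x) = ennreal (L t x l)"
  unfolding L_def using exp_neg_bounds[OF assms(3)]
  by (intro nn_integral_eq_integral exp_neg_X_integrable assms) auto

text \<open>The probability of extinction by time t + tau l, computed directly and by conditioning
  at time t, where it is exp(-l X_t).\<close>

lemma L_above:
  assumes t: "0 \<le> t" and x: "0 \<le> x" and l: "z0 < l"
  shows "L t x l = exp (- x * v (t + tau l))"
proof -
  have l0: "0 \<le> l" using l z0 by simp
  have tl: "0 < tau l" using tau_pos[OF l] .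
  define l' where "l' = v (t + tau l)"
  have l': "z0 < l'" "tau l' = t + tau l" using v_props[of "t + tau l"] t tl by (auto simp: l'_def)
  have ext: "(\<integral>\<^sup>+\<omega>. indicator {0} (X (tau k) \<omega>) \<partial>P y) = ennreal (exp (- y * k))" if k: "z0 < k" and y: "0 \<le> y" for k y
  proof -
    interpret prob_space "P y" using prob_P[OF y] .
    have tk: "0 \<le> tau k" using tau_nonneg[OF k] .
    have Xm: "{\<omega> \<in> \<Omega>. X (tau k) \<omega> = 0} \<in> events"
      using measurable_sets[OF X_measurable[OF tk y], of "{0}"] space_P[OF y] by (simp add: vimage_def Int_def conj_commute)
    have "(\<integral>\<^sup>+\<omega>. indicator {0} (X (tau k) \<omega>) \<partial>P y) = (\<integral>\<^sup>+\<omega>. indicator {\<omega> \<in> \<Omega>. X (tau k) \<omega> = 0} \<omega> \<partial>P y)"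
      by (rule nn_integral_cong) (auto simp: indicator_def space_P[OF y])
    also have "\<dots> = ennreal (prob {\<omega> \<in> \<Omega>. X (tau k) \<omega> = 0})" using Xm by (simp add: emeasure_eq_measure)
    finally show ?thesis unfolding extinction[OF k y] .
  qed
  have "ennreal (exp (- x * l')) = (\<integral>\<^sup>+\<omega>. indicator {0} (X (t + tau l) \<omega>) \<partial>P x)"
    using ext[OF l'(1) x] l'(2) by simp
  also have "\<dots> = (\<integral>\<^sup>+\<omega>. (if X t \<omega> = \<infinity> then 0 else (\<integral>\<^sup>+\<omega>'. indicator {0} (X (tau l) \<omega>') \<partial>P (enn2real (X t \<omega>)))) \<partial>P x)"
    using t tl x by (intro markov) auto
  also have "\<dots> = (\<integral>\<^sup>+\<omega>. ennreal (exp_neg l (X t \<omega>)) \<partial>P x)"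
    by (rule nn_integral_cong) (simp add: ext[OF l] exp_neg_def mult.commute)
  also have "\<dots> = ennreal (L t x l)" by (rule L_nn[OF t x l0])
  finally have "exp (- x * l') = L t x l"
    using exp_neg_bounds[OF l0] by (subst (asm) ennreal_inj) (auto simp: L_def intro!: integral_nonneg_AE)
  then show ?thesis by (simp add: l'_def)
qed

lemma L_antimono:
  assumes "0 \<le> t" "0 \<le> x" "0 \<le> a" "a \<le> b" shows "L t x b \<le> L t x a"
  unfolding L_def using assms by (intro integral_mono exp_neg_X_integrable exp_neg_antimono) auto

text \<open>Positivity is inherited from a level above z0, where the transform is explicit, by
  monotonicity. It allows the logarithm in \<open>u\<close>.\<close>

lemma L_bounds:
  assumes "0 \<le> t" "0 \<le> x" "0 \<le> l" shows "0 < L t x l" "L t x l \<le> 1"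
proof -
  interpret prob_space "P x" using prob_P assms by simp
  have "0 < L t x (l + z0 + 1)" using assms z0 by (subst L_above) auto
  also have "\<dots> \<le> L t x l" using assms z0 by (intro L_antimono) auto
  finally show "0 < L t x l" .
  have "L t x l \<le> (\<integral>\<omega>. 1 \<partial>P x)"
    unfolding L_def using exp_neg_bounds[OF assms(3)] by (intro integral_mono exp_neg_X_integrable assms) auto
  then show "L t x l \<le> 1" by (simp add: prob_space)
qed

lemma L_continuous_0:
  assumes t: "0 \<le> t" and x: "0 \<le> x" shows "(\<lambda>n. L t x (1 / real (Suc n))) \<longlonglongrightarrow> L t x 0"
  unfolding L_def
proof (rule integral_dominated_convergence[where w="\<lambda>_. 1"])
  interpret prob_space "P x" using prob_P x by simp
  show "integrable (P x) (\<lambda>_. 1 :: real)" by simp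
  show "AE \<omega> in P x. (\<lambda>n. exp_neg (1 / real (Suc n)) (X t \<omega>)) \<longlonglongrightarrow> exp_neg 0 (X t \<omega>)"
  proof (rule AE_I2)
    fix \<omega>
    have "(\<lambda>n. exp (- (1 / real (Suc n)) * enn2real (X t \<omega>))) \<longlonglongrightarrow> exp (- 0 * enn2real (X t \<omega>))"
      by (intro tendsto_intros LIMSEQ_Suc[OF lim_1_over_n])
    then show "(\<lambda>n. exp_neg (1 / real (Suc n)) (X t \<omega>)) \<longlonglongrightarrow> exp_neg 0 (X t \<omega>)" by (simp add: exp_neg_def)
  qed
  show "AE \<omega> in P x. norm (exp_neg (1 / real (Suc n)) (X t \<omega>)) \<le> 1" for n
    using exp_neg_bounds[of "1 / real (Suc n)"] by simp
qed (use t x exp_neg_X_measurable in auto)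

definition c :: real where "c = z0 + 1"

definition N :: "real \<Rightarrow> real \<Rightarrow> real measure" where
  "N t x = distr (P x) borel (\<lambda>\<omega>. exp_neg c (X t \<omega>))"

lemma c_pos: "0 < c" using z0 by (simp add: c_def)

lemma N_unit: assumes "0 \<le> t" "0 \<le> x" shows "unit_measure (N t x)" "measure (N t x) UNIV = 1"
proof -
  interpret prob_space "P x" using prob_P assms by simp
  have m: "(\<lambda>\<omega>. exp_neg c (X t \<omega>)) \<in> borel_measurable (P x)" using exp_neg_X_measurable assms by simp
  show "unit_measure (N t x)" unfolding unit_measure_def N_def
    using m exp_neg_bounds[of c] c_pos by (auto simp: AE_distr_iff intro!: finite_measure_distr)
  show "measure (N t x) UNIV = 1" unfolding N_def using m by (simp add: measure_distr prob_space)
qed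

lemma N_powr:
  assumes "0 \<le> t" "0 \<le> x" shows "(\<integral>s. s powr r \<partial>N t x) = L t x (c * r)"
  unfolding N_def L_def using exp_neg_X_measurable[OF assms] by (subst integral_distr) (auto simp: exp_neg_powr)

text \<open>exp(-c X_t) under P_(x+y) is compared with the product of independent copies under P_x
  and P_y. The levels c j are explicit, so the moments agree, and then all levels l > 0. At l = 0
  the test function \<open>s powr 0\<close> is discontinuous at s = 0, so this level is reached as a
  limit.\<close>

lemma L_mult:
  assumes t: "0 \<le> t" and x: "0 \<le> x" and y: "0 \<le> y" and l: "0 \<le> l"
  shows "L t (x + y) l = L t x l * L t y l"
proof -
  have xy: "0 \<le> x + y" using x y by simp
  interpret Px: prob_space "P x" using prob_P x by simp
  interpret Py: prob_space "P y" using prob_P y by simp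
  interpret pair_prob_space "P x" "P y" ..
  define e where "e \<omega> = exp_neg c (X t \<omega>)" for \<omega>
  have e01: "0 \<le> e \<omega>" "e \<omega> \<le> 1" for \<omega> using exp_neg_bounds[of c] c_pos by (auto simp: e_def)
  have em[measurable]: "e \<in> borel_measurable (P x)" "e \<in> borel_measurable (P y)"
    unfolding e_def using exp_neg_X_measurable t x y by auto
  define M where "M = distr (P x \<Otimes>\<^sub>M P y) borel (\<lambda>(a, b). e a * e b)"
  have mm: "(\<lambda>(a, b). e a * e b) \<in> borel_measurable (P x \<Otimes>\<^sub>M P y)" by measurable
  have uM: "unit_measure M"
    unfolding unit_measure_def M_def
    using mm e01 by (auto simp: AE_distr_iff mult_le_one intro!: finite_measure_distr)
  have prod: "(\<integral>s. s powr r \<partial>M) = L t x (c * r) * L t y (c * r)" if r: "0 \<le> r" for r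
  proof -
    have "(\<integral>s. s powr r \<partial>M) = (\<integral>(a, b). e a powr r * e b powr r \<partial>(P x \<Otimes>\<^sub>M P y))"
      unfolding M_def using mm by (subst integral_distr) (auto simp: powr_mult e01 intro!: Bochner_Integration.integral_cong)
    also have "\<dots> = (\<integral>a. (\<integral>b. (case (a, b) of (a, b) \<Rightarrow> e a powr r * e b powr r) \<partial>P y) \<partial>P x)"
    proof (rule integral_fst'[symmetric, where f="\<lambda>(a, b). e a powr r * e b powr r"])
      show "integrable (P x \<Otimes>\<^sub>M P y) (\<lambda>(a, b). e a powr r * e b powr r)"
        using e01 r by (intro integrable_const_bound[where B=1]) (auto simp: powr_le1 mult_le_one)
    qed
    also have "\<dots> = (\<integral>a. e a powr r \<partial>P x) * (\<integral>b. e b powr r \<partial>P y)" by simp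
    finally show ?thesis by (simp add: e_def exp_neg_powr L_def)
  qed
  have powj: "(\<integral>s. s ^ j \<partial>K) = (\<integral>s. s powr real j \<partial>K)" if K: "unit_measure K" and j: "1 \<le> j" for K and j :: nat
  proof (rule integral_cong_AE)
    have "AE s in K. s \<in> {0..1}" using K by (simp add: unit_measure_def del: atLeastAtMost_iff)
    then show "AE s in K. s ^ j = s powr real j"
      by eventually_elim (use j in \<open>auto simp: powr_realpow'\<close>)
  qed (use K in \<open>auto simp: unit_measure_def cong: measurable_cong_sets\<close>)
  have pos: "L t (x + y) (c * r) = L t x (c * r) * L t y (c * r)" if r: "0 < r" for r
  proof -
    have "(\<integral>s. s powr r \<partial>N t (x + y)) = (\<integral>s. s powr r \<partial>M)"
    proof (rule moment_unique[OF N_unit(1)[OF t xy] uM])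
      fix j :: nat assume j: "1 \<le> j"
      have "c * 1 \<le> c * real j" using j c_pos by (intro mult_left_mono) auto
      then have cj: "z0 < c * real j" by (simp add: c_def)
      show "(\<integral>s. s ^ j \<partial>N t (x + y)) = (\<integral>s. s ^ j \<partial>M)"
        unfolding powj[OF N_unit(1)[OF t xy] j] powj[OF uM j] N_powr[OF t xy] prod[OF of_nat_0_le_iff]
          L_above[OF t xy cj] L_above[OF t x cj] L_above[OF t y cj]
        by (simp add: exp_add[symmetric] algebra_simps)
    next
      show "continuous_on {0..1} (\<lambda>s. s powr r)" using r by (intro continuous_on_powr') auto
    qed (use r in auto)
    then show ?thesis using N_powr[OF t xy] prod[of r] r by simp
  qed
  show ?thesis
  proof (cases "l = 0")
    case False
    then show ?thesis using pos[of "l / c"] l c_pos by simp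
  next
    case True
    have "L t (x + y) (1 / real (Suc n)) = L t x (1 / real (Suc n)) * L t y (1 / real (Suc n))" for n
      using pos[of "1 / real (Suc n) / c"] c_pos by simp
    then have "(\<lambda>n. L t (x + y) (1 / real (Suc n))) \<longlonglongrightarrow> L t x 0 * L t y 0"
      using tendsto_mult[OF L_continuous_0[OF t x] L_continuous_0[OF t y]] by simp
    then show ?thesis using LIMSEQ_unique[OF L_continuous_0[OF t xy]] True by blast
  qed
qed

definition u :: "real \<Rightarrow> real \<Rightarrow> real" where "u t l = - ln (L t 1 l)"

lemma L_exp:
  assumes "0 \<le> t" "0 \<le> x" "0 \<le> l" shows "L t x l = exp (- x * u t l)"
proof -
  have "- ln (L t x l) = x * - ln (L t 1 l)"
  proof (rule additive_nonneg_linear[of "\<lambda>x. - ln (L t x l)"])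
    fix a b :: real assume "0 \<le> a" "0 \<le> b"
    then show "- ln (L t (a + b) l) = - ln (L t a l) + - ln (L t b l)"
      using L_mult L_bounds(1)[of t a l] L_bounds(1)[of t b l] assms by (simp add: ln_mult)
    show "0 \<le> - ln (L t a l)" using L_bounds[of t a l] assms \<open>0 \<le> a\<close> by simp
  qed (rule assms(2))
  then have "ln (L t x l) = - x * u t l" by (simp add: u_def)
  then show ?thesis using L_bounds(1)[OF assms] by (metis exp_ln)
qed

lemma u_nonneg: "0 \<le> t \<Longrightarrow> 0 \<le> l \<Longrightarrow> 0 \<le> u t l"
  using L_bounds[of t 1 l] by (simp add: u_def)

lemma u_above: "0 \<le> t \<Longrightarrow> z0 < l \<Longrightarrow> u t l = v (t + tau l)"
  by (simp add: u_def L_above)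

lemma u_start:
  assumes l: "0 \<le> l" shows "u 0 l = l"
proof -
  interpret prob_space "P 1" using prob_P by simp
  have "L 0 1 l = (\<integral>\<omega>. exp (- l) \<partial>P 1)"
    unfolding L_def
  proof (rule integral_cong_AE)
    show "AE \<omega> in P 1. exp_neg l (X 0 \<omega>) = exp (- l)"
      using normality[of 1, simplified] by eventually_elim (simp add: exp_neg_def)
  qed (auto intro: exp_neg_X_measurable)
  then show ?thesis by (simp add: u_def prob_space)
qed

lemma u_semigroup:
  assumes s: "0 \<le> s" and t: "0 \<le> t" and l: "0 \<le> l" shows "u (t + s) l = u t (u s l)"
proof -
  have us: "0 \<le> u s l" using u_nonneg[OF s l] .
  have "ennreal (L (t + s) 1 l) = (\<integral>\<^sup>+\<omega>. ennreal (exp_neg l (X (t + s) \<omega>)) \<partial>P 1)"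
    using s t l by (intro L_nn[symmetric]) auto
  also have "\<dots> = (\<integral>\<^sup>+\<omega>. (if X t \<omega> = \<infinity> then 0 else (\<integral>\<^sup>+\<omega>'. ennreal (exp_neg l (X s \<omega>')) \<partial>P (enn2real (X t \<omega>)))) \<partial>P 1)"
    using s t exp_neg_measurable[of l] by (intro markov[where f="\<lambda>y. ennreal (exp_neg l y)"]) (auto simp: exp_neg_def)
  also have "\<dots> = (\<integral>\<^sup>+\<omega>. ennreal (exp_neg (u s l) (X t \<omega>)) \<partial>P 1)"
  proof (rule nn_integral_cong)
    fix \<omega>
    have "(\<integral>\<^sup>+\<omega>'. ennreal (exp_neg l (X s \<omega>')) \<partial>P (enn2real (X t \<omega>))) = ennreal (exp (- enn2real (X t \<omega>) * u s l))"
      using s l L_nn[of s "enn2real (X t \<omega>)" l] L_exp[of s "enn2real (X t \<omega>)" l] by simp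
    then show "(if X t \<omega> = \<infinity> then 0 else (\<integral>\<^sup>+\<omega>'. ennreal (exp_neg l (X s \<omega>')) \<partial>P (enn2real (X t \<omega>))))
        = ennreal (exp_neg (u s l) (X t \<omega>))"
      by (simp add: exp_neg_def[of "u s l"] mult.commute)
  qed
  also have "\<dots> = ennreal (L t 1 (u s l))" using t us by (intro L_nn) auto
  finally have "L (t + s) 1 l = L t 1 (u s l)"
    using L_bounds(1)[of "t + s" 1 l] L_bounds(1)[of t 1 "u s l"] s t l us by (subst (asm) ennreal_inj) auto
  then show ?thesis by (simp add: u_def)
qed

sublocale laplace_flow u N z0 c g
proof
  show "z0 < c" by (simp add: c_def)
  show "(\<integral>s. s powr r \<partial>N t x) = exp (- x * u t (c * r))" if "0 \<le> t" "0 \<le> x" "0 \<le> r" for t x r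
    using that c_pos by (simp add: N_powr L_exp)
  show "z0 < u t l \<and> u t l \<le> l" if "0 \<le> t" "z0 < l" for t l
    using that v_props[of "t + tau l"] v_antimono[of "tau l" "t + tau l"] v_tau[of l] tau_pos[of l]
    by (simp add: u_above)
  show "((\<lambda>t. (l - u t l) / t) \<longlongrightarrow> g l) (at_right 0)" if l: "z0 < l" for l
  proof -
    have "((\<lambda>h. (v (tau l + h) - v (tau l)) / h) \<longlongrightarrow> - g l) (at 0)"
      using v_deriv[OF tau_pos[OF l]] v_tau[OF l] by (simp add: DERIV_def)
    then have "((\<lambda>h. (v (tau l + h) - v (tau l)) / h) \<longlongrightarrow> - g l) (at_right 0)"
      by (rule tendsto_within_subset) auto
    from tendsto_minus[OF this] have "((\<lambda>h. - ((v (tau l + h) - v (tau l)) / h)) \<longlongrightarrow> g l) (at_right 0)" by simp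
    then show ?thesis
    proof (rule Lim_transform_eventually)
      have "- ((v (tau l + h) - v (tau l)) / h) = (l - u h l) / h" if "0 < h" for h
        using that l by (simp add: u_above v_tau add.commute minus_divide_left)
      then show "\<forall>\<^sub>F h in at_right 0. - ((v (tau l + h) - v (tau l)) / h) = (l - u h l) / h"
        by (auto simp: eventually_at_filter)
    qed
  qed
qed (auto intro: z0 N_unit u_nonneg u_start u_semigroup g_continuous g_z0)

end

section \<open>Reading off psi, p and z0 from the limit Psi\<close>

theorem mainTheorem10:
  fixes \<Omega> :: "'a set" and P :: "real \<Rightarrow> 'a measure" and F :: "real \<Rightarrow> 'a set set"
    and X :: "real \<Rightarrow> 'a \<Rightarrow> ennreal" and \<zeta> :: "'a \<Rightarrow> ennreal"
    and Q z0 :: real and g :: "real \<Rightarrow> real"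
  assumes setting: "standing_setting \<Omega> P F X \<zeta>"
    and nnj: "no_negative_jumps P X \<zeta>"
    and absorb: "zero_absorbing P X \<zeta>"
    and Qpos: "0 < Q" and z0: "0 \<le> z0"
    and g_C1: "\<exists>g'. (\<forall>z\<ge>z0. (g has_real_derivative g' z) (at z within {z0..})) \<and> continuous_on {z0..} g'"
    and g_nonneg: "\<forall>z\<ge>z0. 0 \<le> g z"
    and g_z0: "g z0 = 0"
    and g_pos: "\<forall>z>z0. 0 < g z"
    and g_int: "\<forall>z>z0. set_integrable lborel {z<..} (\<lambda>w. 1 / g w)"
    and laplace: "\<forall>l x q. 0 \<le> l \<and> l \<le> x \<and> Q < q \<longrightarrow>
        (\<integral> \<omega>. exp (- q * enn2real (T_minus X \<zeta> l \<omega>)) * indicator {\<omega>. T_minus X \<zeta> l \<omega> < \<zeta> \<omega>} \<omega> \<partial>P x)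
        = (LBINT z:{z0<..}. (1 / g z) * exp (- x * z - (LBINT w:{z<..}. q / g w)))
          / (LBINT z:{z0<..}. (1 / g z) * exp (- l * z - (LBINT w:{z<..}. q / g w)))"
  shows "\<exists>\<psi> p. spos_levy_exponent \<psi> \<and> 0 \<le> p \<and>
           set_integrable lborel {psi_inv \<psi> 0 + 1..} (\<lambda>z. 1 / \<psi> z) \<and>
           is_CSBP P X \<psi> p \<and>
           z0 = psi_inv \<psi> p \<and> (\<forall>z\<ge>psi_inv \<psi> p. g z = \<psi> z - p)"
proof -
  interpret csbp_setting z0 g \<Omega> P F X \<zeta> Q
  proof
    fix x q :: real assume "0 \<le> x" "Q < q"
    then show "(\<integral> \<omega>. exp (- q * enn2real (T_minus X \<zeta> 0 \<omega>)) * indicator {\<omega>. T_minus X \<zeta> 0 \<omega> < \<zeta> \<omega>} \<omega> \<partial>P x)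
        = (LBINT z:{z0<..}. (1 / g z) * exp (- x * z - (LBINT w:{z<..}. q / g w)))
          / (LBINT z:{z0<..}. (1 / g z) * exp (- 0 * z - (LBINT w:{z<..}. q / g w)))"
      using laplace by blast
  qed (fact g_C1 g_z0 g_pos g_int setting absorb Qpos z0)+
  obtain \<rho> where lk: "lk_data c \<rho>"
    and lim: "\<And>l. 0 < l \<Longrightarrow> ((\<lambda>t. G t l) \<longlongrightarrow> lk_data.Psi (g c) (g (2 * c)) c \<rho> l) (at_right 0)"
    using limit_measure by blast
  interpret lk: lk_data "g c" "g (2 * c)" c \<rho> by (rule lk)
  interpret fl: limit_flow u N z0 c g \<rho> by unfold_locales (rule lim)
  \<comment> \<open>Psi is the whole branching mechanism psi - p; since psi must vanish at 0, its
    value at 0 is -p.\<close>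
  define p where "p = - lk.Psi 0"
  define \<psi> where "\<psi> = (\<lambda>z. lk.Psi z - lk.Psi 0)"
  have \<psi>_p: "\<psi> z - p = lk.Psi z" for z by (simp add: \<psi>_def p_def)
  have p: "0 \<le> p" using fl.Psi_0_nonpos by (simp add: p_def)
  \<comment> \<open>The sign of Psi turns the set defining \<open>psi_inv \<psi> p\<close> into the
    open half line above z0.\<close>
  have Psi_pos: "0 < lk.Psi z \<longleftrightarrow> z0 < z" if "0 \<le> z" for z
    using fl.Psi_above[of z] fl.Psi_below[of z] that g_pos by (cases "z0 < z") auto
  have above: "p < \<psi> z" if "z0 < z" for z
    using Psi_pos[of z] that z0 \<psi>_p[of z] by simp
  have inv_p: "psi_inv \<psi> p = z0"
  proof -
    have "p < \<psi> z \<longleftrightarrow> 0 < lk.Psi z" for z using \<psi>_p[of z] by linarith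
    then have "{z. 0 \<le> z \<and> p < \<psi> z} = {z0<..}"
      using Psi_pos z0 by auto
    then show ?thesis by (simp add: psi_inv_def)
  qed
  have levy: "spos_levy_exponent \<psi>"
    unfolding \<psi>_def
  proof (rule lk.levy_khintchine)
    show "0 \<le> z0 + 1" "0 < lk.Psi (z0 + 1) - lk.Psi 0"
      using above[of "z0 + 1"] p z0 by (auto simp: \<psi>_def)
  qed
  have g_eq: "g z = \<psi> z - p" if "z0 \<le> z" for z
    using fl.Psi_eq_g[OF that] \<psi>_p by simp
  have csbp: "is_CSBP P X \<psi> p"
    unfolding is_CSBP_def
  proof (intro exI[of _ u] conjI allI impI)
    fix l :: real assume l: "0 \<le> l"
    show "u 0 l = l" by (rule u_start[OF l])
    fix t :: real assume t: "0 \<le> t"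
    have "p - \<psi> (u t l) = - lk.Psi (u t l)" using \<psi>_p[of "u t l"] by simp
    moreover have "((\<lambda>s. u s l) has_real_derivative - lk.Psi (u t l)) (at t within {0..})"
    proof (cases "l \<le> z0")
      case True then show ?thesis using fl.ode_below l t by blast
    next
      case False
      then have l0: "z0 < l" by simp
      have T: "0 < t + tau l" using t tau_pos[OF l0] by simp
      have "(v has_real_derivative - g (v (t + tau l))) (at (t + tau l))" by (rule v_deriv[OF T])
      then have "((\<lambda>s. v (s + tau l)) has_real_derivative - g (v (t + tau l))) (at t)"
        by (simp add: DERIV_shift)
      then have "((\<lambda>s. v (s + tau l)) has_real_derivative - g (v (t + tau l))) (at t within {0..})"
        by (rule has_field_derivative_at_within)
      moreover have "g (v (t + tau l)) = lk.Psi (u t l)"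
        using fl.Psi_above[of "u t l"] v_props[OF T] u_above[OF t l0] by simp
      ultimately have "((\<lambda>s. v (s + tau l)) has_real_derivative - lk.Psi (u t l)) (at t within {0..})" by simp
      then show ?thesis
        by (rule has_field_derivative_transform_within[where d=1]) (use t l0 u_above in auto)
    qed
    ultimately show "((\<lambda>s. u s l) has_real_derivative p - \<psi> (u t l)) (at t within {0..})" by simp
  next
    fix x t l :: real assume "0 \<le> x" "0 \<le> t" "0 \<le> l"
    then show "(\<integral>\<omega>. exp_neg l (X t \<omega>) \<partial>P x) = exp (- x * u t l)"
      using L_exp[of t x l] by (simp add: L_def)
  qed
  \<comment> \<open>Beyond z0 + 1, psi = g + p >= g and the integrability of 1/g suffices. The
    compact rest is handled by continuity, since psi is positive to the right of its last
    zero.\<close>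
  have integrable: "set_integrable lborel {psi_inv \<psi> 0 + 1..} (\<lambda>z. 1 / \<psi> z)"
  proof -
    define S where "S = {z. 0 \<le> z \<and> 0 < \<psi> z}"
    define z1 where "z1 = psi_inv \<psi> 0"
    have z1: "z1 = Inf S" by (simp add: z1_def psi_inv_def S_def)
    have sub: "z \<in> S" if "z0 < z" for z using above[OF that] p z0 that by (simp add: S_def)
    have ne: "S \<noteq> {}" using sub[of "z0 + 1"] by auto
    have bdd: "bdd_below S" by (rule bdd_belowI[of _ 0]) (simp add: S_def)
    have z1_0: "0 \<le> z1" unfolding z1 by (rule cInf_greatest[OF ne]) (simp add: S_def)
    have z1_z0: "z1 \<le> z0"
      by (rule dense_ge) (use sub bdd in \<open>auto simp: z1 intro: cInf_lower\<close>)
    have conv: "convex_on {0..} \<psi>"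
    proof -
      have "convex_on {0..} (\<lambda>z. lk.Psi z + (- lk.Psi 0))"
        by (intro convex_on_add lk.Psi_convex) (simp add: convex_on_const)
      then show ?thesis by (simp add: \<psi>_def)
    qed
    \<comment> \<open>Since psi is convex with value 0 at 0, the chord from 0 to z gives psi(y) <=
      (y/z) psi(z), so positivity spreads to the right.\<close>
    have pos: "0 < \<psi> z" if z: "z1 < z" for z
    proof -
      obtain y where y: "y \<in> S" "y < z" using z unfolding z1 cInf_less_iff[OF ne bdd] by blast
      have "y \<noteq> 0" using y by (auto simp: S_def \<psi>_def)
      then have y0: "0 < y" "0 < \<psi> y" using y by (auto simp: S_def)
      have "\<psi> ((1 - y / z) *\<^sub>R 0 + (y / z) *\<^sub>R z) \<le> (1 - y / z) * \<psi> 0 + (y / z) * \<psi> z"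
        using y y0 by (intro convex_onD[OF conv]) auto
      moreover have "\<psi> 0 = 0" by (simp add: \<psi>_def)
      ultimately have "0 < y / z * \<psi> z" using y y0 by simp
      moreover have "0 < y / z" using y y0 by simp
      ultimately show ?thesis by (simp only: zero_less_mult_pos)
    qed
    have cont: "continuous_on {z1 + 1..} (\<lambda>z. 1 / \<psi> z)"
    proof (intro continuous_intros)
      show "continuous_on {z1 + 1..} \<psi>"
        unfolding \<psi>_def by (intro continuous_intros continuous_on_subset[OF lk.Psi_continuous]) (use z1_0 in auto)
      show "\<forall>z\<in>{z1 + 1..}. \<psi> z \<noteq> 0"
      proof
        fix z assume "z \<in> {z1 + 1..}"
        then show "\<psi> z \<noteq> 0" using pos[of z] by simp
      qed
    qed
    have 1: "set_integrable lborel {z1 + 1..z0 + 1} (\<lambda>z. 1 / \<psi> z)"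
      by (rule borel_integrable_atLeastAtMost') (rule continuous_on_subset[OF cont], auto)
    have gi: "set_integrable lborel {z0 + 1<..} (\<lambda>w. 1 / g w)" using g_int by simp
    have 2: "set_integrable lborel {z0 + 1<..} (\<lambda>z. 1 / \<psi> z)"
    proof (rule set_integrable_bound[OF gi])
      have "continuous_on {z0 + 1<..} (\<lambda>z. 1 / \<psi> z)"
        by (rule continuous_on_subset[OF cont]) (use z1_z0 in auto)
      then show "set_borel_measurable lborel {z0 + 1<..} (\<lambda>z. 1 / \<psi> z)"
        unfolding set_borel_measurable_def measurable_lborel2
        by (intro borel_measurable_continuous_on_indicator) simp
      show "AE z in lborel. z \<in> {z0 + 1<..} \<longrightarrow> norm (1 / \<psi> z) \<le> norm (1 / g z)"
      proof (intro AE_I2 impI)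
        fix z assume z: "z \<in> {z0 + 1<..}"
        then have "z0 < z" by simp
        then have "0 < g z" "g z = \<psi> z - p" using g_pos g_eq[of z] by (blast, simp)
        moreover from this have "g z \<le> \<psi> z" using p by linarith
        ultimately show "norm (1 / \<psi> z) \<le> norm (1 / g z)" by (simp add: frac_le)
      qed
    qed
    have "{z1 + 1..} = {z1 + 1..z0 + 1} \<union> {z0 + 1<..}" using z1_z0 by auto
    then show ?thesis using set_integrable_Un[OF 1 2] by (simp add: z1_def)
  qed
  show ?thesis using levy p integrable csbp inv_p g_eq by (intro exI[of _ \<psi>] exI[of _ p]) auto
qed

end
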